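(* Let $H$ be a Hopf algebra over a field $k$ and let $A/B$ be an $H$-cleft extension with $A\neq0$. Then an element $Q\in\mathrm{Quot}_{gen}(H)$ is closed in the Galois connection $(\phi,\psi)$ between $\mathrm{Quot}_{gen}(H)$ and $\mathrm{Sub}_{alg}(A/A^{co\,H})$ with $\phi(Q)=A^{co\,Q}$ (that is, $\psi\phi(Q)=Q$) if and only if the extension $A/A^{co\,Q}$ is $Q$-Galois. When $H$ is finite dimensional there is a bijective correspondence $$\mathrm{Sub}_{H\text{-}ext}(A)\simeq\mathrm{Quot}_{gen}(H),$$ given by this Galois connection.
   Context: A (right) $H$-comodule algebra is an associative unital algebra $A$ with a coassociative and counital coaction $\delta:A\to A\otimes H$, $\delta(a)=a_{(0)}\otimes a_{(1)}$, which is an algebra map. An $H$-extension $A/B$ is an $H$-comodule algebra $A$ with $B=A^{co\,H}=\{a:\delta(a)=a\otimes 1\}$; it is cleft if there exists a convolution invertible $H$-comodule map $\gamma:H\to A$. $\mathrm{Quot}_{gen}(H)=\{H/I: I\text{ a coideal and a right ideal of }H\}$, ordered by $H/I\succeq H/J$ iff $I\subseteq J$; it is a complete lattice. For $Q=H/I$ with quotient map $\pi$, $A^{co\,Q}=\{a\in A:(\mathrm{id}\otimes\pi)\delta(a)=a\otimes\pi(1)\}$, a subalgebra of $A$. $A/A^{co\,Q}$ is $Q$-Galois if $A\otimes_{A^{co\,Q}}A\to A\otimes Q$, $a\otimes b\mapsto ab_{(0)}\otimes\pi(b_{(1)})$, is bijective. $\mathrm{Sub}_{alg}(A/A^{co\,H})$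 is the lattice of subalgebras of $A$ containing $A^{co\,H}$, ordered by inclusion. The order-reversing map $\phi(Q)=A^{co\,Q}$ is part of a unique Galois connection $(\phi,\psi)$, with $\psi(C)=\sup\{Q\in\mathrm{Quot}_{gen}(H):C\subseteq A^{co\,Q}\}$. $\mathrm{Sub}_{H\text{-}ext}(A)$ is the poset of all extensions of the form $A^{co\,Q}\subseteq A$, $Q\in\mathrm{Quot}_{gen}(H)$. *)

theory Defs
  imports Complex_Main "HOL-Library.Poly_Mapping" "HOL-Library.Set_Algebras" "HOL-Algebra.Galois_Connection"
begin

section \<open>Vector spaces, quotients and tensor products\<close>

text \<open>
  The algebras \<open>H\<close> and \<open>A\<close> are types with a scalar multiplication, but quotients \<open>H / I\<close> and tensor
  products only exist as sets of cosets. The following record treats both kinds uniformly.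
\<close>

record ('k, 'v) kspace = "'v partial_object" +
  vadd :: "'v \<Rightarrow> 'v \<Rightarrow> 'v"
  vscale :: "'k \<Rightarrow> 'v \<Rightarrow> 'v"

definition type_space :: "('k \<Rightarrow> 'v \<Rightarrow> 'v) \<Rightarrow> ('k, 'v::plus) kspace" where
  "type_space s = \<lparr>carrier = UNIV, vadd = (+), vscale = s\<rparr>"

definition klinear :: "('k, 'v) kspace \<Rightarrow> ('k, 'w) kspace \<Rightarrow> ('v \<Rightarrow> 'w) \<Rightarrow> bool" where
  "klinear V W f \<longleftrightarrow>
     f ` carrier V \<subseteq> carrier W \<and>
     (\<forall>v\<in>carrier V. \<forall>v'\<in>carrier V. f (vadd V v v') = vadd W (f v) (f v')) \<and>
     (\<forall>c. \<forall>v\<in>carrier V. f (vscale V c v) = vscale W c (f v))"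

text \<open>
  The quotient \<open>S / U\<close> for subspaces \<open>U \<subseteq> S\<close>. Addition of cosets is the elementwise
  sum of sets; \<open>c \<cdot> X\<close> is \<open>s c ` X + U\<close> rather than \<open>s c ` X\<close>, which would be \<open>{0}\<close> for \<open>c = 0\<close>.
\<close>

definition quot :: "('k \<Rightarrow> 'v \<Rightarrow> 'v) \<Rightarrow> 'v set \<Rightarrow> 'v set \<Rightarrow> ('k, 'v::plus set) kspace" where
  "quot s S U = \<lparr>carrier = (\<lambda>v. v +o U) ` S, vadd = (+), vscale = (\<lambda>c X. s c ` X + U)\<rparr>"

text \<open>
  Maps out of a tensor product, and Sweedler sums, are evaluated on a representative of the class.
  This is only used for expressions that are (multi)linear in the tensor factors, whose value does
  not depend on the choice.
\<close>

definition rep :: "'v set \<Rightarrow> 'v" where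
  "rep X = (SOME x. x \<in> X)"

text \<open>\<open>'x \<Rightarrow>\<^sub>0 'k\<close> serves as the free vector space on \<open>'x\<close>, with basis \<open>gen\<close>.\<close>

abbreviation gen :: "'x \<Rightarrow> ('x \<Rightarrow>\<^sub>0 'k::field)" where
  "gen p \<equiv> Poly_Mapping.single p 1"

definition fscale :: "'k::field \<Rightarrow> ('x \<Rightarrow>\<^sub>0 'k) \<Rightarrow> ('x \<Rightarrow>\<^sub>0 'k)" where
  "fscale c x = Poly_Mapping.map ((*) c) x"

definition lin_ext ::
    "('k::field \<Rightarrow> 'v \<Rightarrow> 'v) \<Rightarrow> ('x \<Rightarrow> 'v::comm_monoid_add) \<Rightarrow> ('x \<Rightarrow>\<^sub>0 'k) \<Rightarrow> 'v" where
  "lin_ext s f x = (\<Sum>p\<in>Poly_Mapping.keys x. s (Poly_Mapping.lookup x p) (f p))"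

text \<open>The elements that have to be divided out to make \<open>\<iota>\<close> linear on \<open>V\<close>.\<close>

definition lin_rels :: "('k::field, 'v) kspace \<Rightarrow> ('v \<Rightarrow> ('x \<Rightarrow>\<^sub>0 'k)) \<Rightarrow> ('x \<Rightarrow>\<^sub>0 'k) set" where
  "lin_rels V \<iota> =
     {\<iota> (vadd V v v') - \<iota> v - \<iota> v' | v v'. v \<in> carrier V \<and> v' \<in> carrier V} \<union>
     {\<iota> (vscale V c v) - fscale c (\<iota> v) | c v. v \<in> carrier V}"

definition bilin_rels ::
    "('k::field, 'v) kspace \<Rightarrow> ('k, 'w) kspace \<Rightarrow> ('v \<times> 'w \<Rightarrow>\<^sub>0 'k) set" where
  "bilin_rels V W =
     (\<Union>w\<in>carrier W. lin_rels V (\<lambda>v. gen (v, w))) \<union>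
     (\<Union>v\<in>carrier V. lin_rels W (\<lambda>w. gen (v, w)))"

definition tensor_rels ::
    "('k::field, 'v) kspace \<Rightarrow> ('k, 'w) kspace \<Rightarrow> ('v \<times> 'w \<Rightarrow>\<^sub>0 'k) set" where
  "tensor_rels V W = module.span fscale (bilin_rels V W)"

definition tensor ::
    "('k::field, 'v) kspace \<Rightarrow> ('k, 'w) kspace \<Rightarrow> ('k, ('v \<times> 'w \<Rightarrow>\<^sub>0 'k) set) kspace" where
  "tensor V W =
     quot fscale {x. Poly_Mapping.keys x \<subseteq> carrier V \<times> carrier W} (tensor_rels V W)"

definition tcls ::
    "('k::field, 'v) kspace \<Rightarrow> ('k, 'w) kspace \<Rightarrow> ('v \<times> 'w \<Rightarrow>\<^sub>0 'k) \<Rightarrow> ('v \<times> 'w \<Rightarrow>\<^sub>0 'k) set" where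
  "tcls V W x = x +o tensor_rels V W"

text \<open>The class in \<open>U \<otimes> V \<otimes> W\<close>, constructed without bracketing as a quotient of the free space on triples.\<close>

definition tcls3 ::
    "('k::field, 'u) kspace \<Rightarrow> ('k, 'v) kspace \<Rightarrow> ('k, 'w) kspace \<Rightarrow>
     ('u \<times> 'v \<times> 'w \<Rightarrow>\<^sub>0 'k) \<Rightarrow> ('u \<times> 'v \<times> 'w \<Rightarrow>\<^sub>0 'k) set" where
  "tcls3 U V W x = x +o module.span fscale (
     (\<Union>v\<in>carrier V. \<Union>w\<in>carrier W. lin_rels U (\<lambda>u. gen (u, v, w))) \<union>
     (\<Union>u\<in>carrier U. \<Union>w\<in>carrier W. lin_rels V (\<lambda>v. gen (u, v, w))) \<union>
     (\<Union>u\<in>carrier U. \<Union>v\<in>carrier V. lin_rels W (\<lambda>w. gen (u, v, w))))"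

text \<open>
  \<open>A \<otimes>\<^sub>C A\<close> for a unital subalgebra \<open>C\<close> of the algebra \<open>A\<close>. Bilinearity over the ground field is
  implied by biadditivity and \<open>C\<close>-balancedness, as \<open>C\<close> contains the scalars.
\<close>

definition tensor_over ::
    "('k::field \<Rightarrow> 'a \<Rightarrow> 'a) \<Rightarrow> 'a::{ring, monoid_mult} set \<Rightarrow>
     ('k, ('a \<times> 'a \<Rightarrow>\<^sub>0 'k) set) kspace" where
  "tensor_over s C = quot fscale UNIV (module.span fscale (
     bilin_rels (type_space s) (type_space s) \<union>
     {gen (a * c, b) - gen (a, c * b) | a b c. c \<in> C}))"


section \<open>Algebras, Hopf algebras and comodule algebras\<close>

text \<open>The sort \<open>{ring, monoid_mult}\<close> is that of unital rings, the zero ring included.\<close>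

definition k_algebra :: "('k::field \<Rightarrow> 'a \<Rightarrow> 'a::{ring, monoid_mult}) \<Rightarrow> bool" where
  "k_algebra s \<longleftrightarrow> vector_space s \<and>
     (\<forall>c x y. s c x * y = s c (x * y) \<and> x * s c y = s c (x * y))"

text \<open>The product \<open>(a \<otimes> h) (b \<otimes> g) = a b \<otimes> h g\<close>, on representatives.\<close>

definition tmult ::
    "('a::times \<times> 'h::times \<Rightarrow>\<^sub>0 'k::field) \<Rightarrow> ('a \<times> 'h \<Rightarrow>\<^sub>0 'k) \<Rightarrow> ('a \<times> 'h \<Rightarrow>\<^sub>0 'k)" where
  "tmult x y =
     lin_ext fscale (\<lambda>(a, h). lin_ext fscale (\<lambda>(b, g). gen (a * b, h * g)) y) x"

definition algebra_map_into_tensor ::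
    "('k::field \<Rightarrow> 'a \<Rightarrow> 'a) \<Rightarrow> ('k \<Rightarrow> 'h \<Rightarrow> 'h) \<Rightarrow>
     ('a::{ring, monoid_mult} \<Rightarrow> ('a \<times> 'h::{ring, monoid_mult} \<Rightarrow>\<^sub>0 'k) set) \<Rightarrow> bool" where
  "algebra_map_into_tensor sA sH \<delta> \<longleftrightarrow>
     klinear (type_space sA) (tensor (type_space sA) (type_space sH)) \<delta> \<and>
     \<delta> 1 = tcls (type_space sA) (type_space sH) (gen (1, 1)) \<and>
     (\<forall>a b. \<delta> (a * b) =
        tcls (type_space sA) (type_space sH) (tmult (rep (\<delta> a)) (rep (\<delta> b))))"

text \<open>\<open>(\<delta> \<otimes> id) \<circ> \<delta> = (id \<otimes> \<Delta>) \<circ> \<delta>\<close> in \<open>A \<otimes> H \<otimes> H\<close>\<close>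

definition coassociative ::
    "('k::field \<Rightarrow> 'a \<Rightarrow> 'a) \<Rightarrow> ('k \<Rightarrow> 'h \<Rightarrow> 'h) \<Rightarrow>
     ('h::plus \<Rightarrow> ('h \<times> 'h \<Rightarrow>\<^sub>0 'k) set) \<Rightarrow> ('a::plus \<Rightarrow> ('a \<times> 'h \<Rightarrow>\<^sub>0 'k) set) \<Rightarrow> bool" where
  "coassociative sA sH \<Delta> \<delta> \<longleftrightarrow> (\<forall>a.
     tcls3 (type_space sA) (type_space sH) (type_space sH)
       (lin_ext fscale
          (\<lambda>(b, h). lin_ext fscale (\<lambda>(b0, b1). gen (b0, b1, h)) (rep (\<delta> b))) (rep (\<delta> a))) =
     tcls3 (type_space sA) (type_space sH) (type_space sH)
       (lin_ext fscale
          (\<lambda>(b, h). lin_ext fscale (\<lambda>(h1, h2). gen (b, h1, h2)) (rep (\<Delta> h))) (rep (\<delta> a))))"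

record (overloaded) ('k::zero, 'h) hopf =
  hscale :: "'k \<Rightarrow> 'h \<Rightarrow> 'h"
  comult :: "'h \<Rightarrow> ('h \<times> 'h \<Rightarrow>\<^sub>0 'k) set"
  counit :: "'h \<Rightarrow> 'k"
  antipode :: "'h \<Rightarrow> 'h"

record (overloaded) ('k::zero, 'h, 'a) comod_alg =
  ascale :: "'k \<Rightarrow> 'a \<Rightarrow> 'a"
  coact :: "'a \<Rightarrow> ('a \<times> 'h \<Rightarrow>\<^sub>0 'k) set"

abbreviation hspace :: "('k::zero, 'h::plus) hopf \<Rightarrow> ('k, 'h) kspace" where
  "hspace H \<equiv> type_space (hscale H)"

abbreviation aspace :: "('k::zero, 'h, 'a::plus) comod_alg \<Rightarrow> ('k, 'a) kspace" where
  "aspace A \<equiv> type_space (ascale A)"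

text \<open>The convolution product \<open>(f * g) (h) = f (h\<^sub>1) g (h\<^sub>2)\<close> on linear maps from \<open>H\<close> to an algebra.\<close>

definition convolution ::
    "('k::field, 'h) hopf \<Rightarrow> ('k \<Rightarrow> 'a \<Rightarrow> 'a) \<Rightarrow>
     ('h \<Rightarrow> 'a) \<Rightarrow> ('h \<Rightarrow> 'a) \<Rightarrow> 'h \<Rightarrow> 'a::ring" where
  "convolution H s f g h = lin_ext s (\<lambda>(x, y). f x * g y) (rep (comult H h))"

definition hopf_algebra :: "('k::field, 'h::{ring, monoid_mult}) hopf \<Rightarrow> bool" where
  "hopf_algebra H \<longleftrightarrow>
     k_algebra (hscale H) \<and>
     algebra_map_into_tensor (hscale H) (hscale H) (comult H) \<and>
     coassociative (hscale H) (hscale H) (comult H) (comult H) \<and>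
     Vector_Spaces.linear (hscale H) (*) (counit H) \<and>
     counit H 1 = 1 \<and>
     (\<forall>x y. counit H (x * y) = counit H x * counit H y) \<and>
     (\<forall>h. lin_ext (hscale H) (\<lambda>(x, y). hscale H (counit H x) y) (rep (comult H h)) = h) \<and>
     (\<forall>h. lin_ext (hscale H) (\<lambda>(x, y). hscale H (counit H y) x) (rep (comult H h)) = h) \<and>
     Vector_Spaces.linear (hscale H) (hscale H) (antipode H) \<and>
     (\<forall>h. convolution H (hscale H) (antipode H) id h = hscale H (counit H h) 1) \<and>
     (\<forall>h. convolution H (hscale H) id (antipode H) h = hscale H (counit H h) 1)"

definition comodule_algebra ::
    "('k::field, 'h::{ring, monoid_mult}) hopf \<Rightarrow> ('k, 'h, 'a::{ring, monoid_mult}) comod_alg \<Rightarrow> bool"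
  where
  "comodule_algebra H A \<longleftrightarrow>
     k_algebra (ascale A) \<and>
     algebra_map_into_tensor (ascale A) (hscale H) (coact A) \<and>
     coassociative (ascale A) (hscale H) (comult H) (coact A) \<and>
     (\<forall>a. lin_ext (ascale A) (\<lambda>(b, h). ascale A (counit H h) b) (rep (coact A a)) = a)"

definition coinvariants ::
    "('k::field, 'h::{ring, monoid_mult}) hopf \<Rightarrow> ('k, 'h, 'a::plus) comod_alg \<Rightarrow> 'a set" where
  "coinvariants H A = {a. coact A a = tcls (aspace A) (hspace H) (gen (a, 1))}"

definition comodule_map ::
    "('k::field, 'h::{ring, monoid_mult}) hopf \<Rightarrow> ('k, 'h, 'a::{ring, monoid_mult}) comod_alg \<Rightarrow>
     ('h \<Rightarrow> 'a) \<Rightarrow> bool" where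
  "comodule_map H A \<gamma> \<longleftrightarrow>
     Vector_Spaces.linear (hscale H) (ascale A) \<gamma> \<and>
     (\<forall>h. coact A (\<gamma> h) =
        tcls (aspace A) (hspace H)
          (lin_ext fscale (\<lambda>(x, y). gen (\<gamma> x, y)) (rep (comult H h))))"

definition convolution_invertible ::
    "('k::field, 'h::{ring, monoid_mult}) hopf \<Rightarrow> ('k \<Rightarrow> 'a \<Rightarrow> 'a::{ring, monoid_mult}) \<Rightarrow>
     ('h \<Rightarrow> 'a) \<Rightarrow> bool" where
  "convolution_invertible H s \<gamma> \<longleftrightarrow> (\<exists>\<gamma>'.
     Vector_Spaces.linear (hscale H) s \<gamma>' \<and>
     (\<forall>h. convolution H s \<gamma> \<gamma>' h = s (counit H h) 1) \<and>
     (\<forall>h. convolution H s \<gamma>' \<gamma> h = s (counit H h) 1))"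

definition extension ::
    "('k::field, 'h::{ring, monoid_mult}) hopf \<Rightarrow> ('k, 'h, 'a::{ring, monoid_mult}) comod_alg \<Rightarrow>
     'a set \<Rightarrow> bool" where
  "extension H A B \<longleftrightarrow> comodule_algebra H A \<and> B = coinvariants H A"

definition cleft_extension ::
    "('k::field, 'h::{ring, monoid_mult}) hopf \<Rightarrow> ('k, 'h, 'a::{ring, monoid_mult}) comod_alg \<Rightarrow>
     'a set \<Rightarrow> bool" where
  "cleft_extension H A B \<longleftrightarrow> extension H A B \<and>
     (\<exists>\<gamma>. comodule_map H A \<gamma> \<and> convolution_invertible H (ascale A) \<gamma>)"


section \<open>Generalised quotients of a Hopf algebra\<close>

definition coideal :: "('k::field, 'h::{ring, monoid_mult}) hopf \<Rightarrow> 'h set \<Rightarrow> bool" where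
  "coideal H I \<longleftrightarrow>
     module.subspace (hscale H) I \<and>
     (\<forall>i\<in>I. comult H i \<in>
        tcls (hspace H) (hspace H) ` module.span fscale (gen ` (I \<times> UNIV \<union> UNIV \<times> I))) \<and>
     (\<forall>i\<in>I. counit H i = 0)"

definition right_ideal :: "('k::field, 'h::{ring, monoid_mult}) hopf \<Rightarrow> 'h set \<Rightarrow> bool" where
  "right_ideal H I \<longleftrightarrow> module.subspace (hscale H) I \<and> (\<forall>i\<in>I. \<forall>h. i * h \<in> I)"

definition quotient_by ::
    "('k::field, 'h::{ring, monoid_mult}) hopf \<Rightarrow> 'h set \<Rightarrow> ('k, 'h set) kspace" where
  "quotient_by H I = quot (hscale H) UNIV I"

definition quot_gen ::
    "('k::field, 'h::{ring, monoid_mult}) hopf \<Rightarrow> ('k, 'h set) kspace set" where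
  "quot_gen H = {quotient_by H I | I. coideal H I \<and> right_ideal H I}"

text \<open>\<open>P \<sqsubseteq> Q\<close> in this order is \<open>Q \<succeq> P\<close>: with \<open>Q = H / I\<close> and \<open>P = H / J\<close> it means \<open>I \<subseteq> J\<close>.\<close>

definition quot_gen_order ::
    "('k::field, 'h::{ring, monoid_mult}) hopf \<Rightarrow> ('k, 'h set) kspace gorder" where
  "quot_gen_order H = \<lparr>carrier = quot_gen H, eq = (=),
     le = (\<lambda>P Q. \<exists>I J. coideal H I \<and> right_ideal H I \<and> coideal H J \<and> right_ideal H J \<and>
                Q = quotient_by H I \<and> P = quotient_by H J \<and> I \<subseteq> J)\<rparr>"

text \<open>The quotient map \<open>\<pi> : H \<rightarrow> Q\<close>: the coset of \<open>h\<close> is the unique element of \<open>Q\<close> containing \<open>h\<close>.\<close>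

definition proj :: "('k, 'h set) kspace \<Rightarrow> 'h \<Rightarrow> 'h set" where
  "proj Q h = (THE X. X \<in> carrier Q \<and> h \<in> X)"

definition coinvariants_quot ::
    "('k::field, 'h, 'a) comod_alg \<Rightarrow> ('k, 'h::{ring, monoid_mult} set) kspace \<Rightarrow>
     'a::{ring, monoid_mult} set" where
  "coinvariants_quot A Q = {a.
     tcls (aspace A) Q (lin_ext fscale (\<lambda>(b, h). gen (b, proj Q h)) (rep (coact A a))) =
     tcls (aspace A) Q (gen (a, proj Q 1))}"

text \<open>The canonical map \<open>a \<otimes> b \<mapsto> a b\<^sub>0 \<otimes> \<pi> (b\<^sub>1)\<close>\<close>

definition canonical_map ::
    "('k::field, 'h, 'a) comod_alg \<Rightarrow> ('k, 'h::{ring, monoid_mult} set) kspace \<Rightarrow>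
     ('a::{ring, monoid_mult} \<times> 'a \<Rightarrow>\<^sub>0 'k) set \<Rightarrow> ('a \<times> 'h set \<Rightarrow>\<^sub>0 'k) set" where
  "canonical_map A Q X = tcls (aspace A) Q
     (lin_ext fscale
        (\<lambda>(a, b). lin_ext fscale (\<lambda>(b0, b1). gen (a * b0, proj Q b1)) (rep (coact A b)))
        (rep X))"

definition is_Galois ::
    "('k::field, 'h, 'a::{ring, monoid_mult}) comod_alg \<Rightarrow> ('k, 'h::{ring, monoid_mult} set) kspace \<Rightarrow>
     bool" where
  "is_Galois A Q \<longleftrightarrow>
     bij_betw (canonical_map A Q)
       (carrier (tensor_over (ascale A) (coinvariants_quot A Q)))
       (carrier (tensor (aspace A) Q))"


section \<open>The Galois connection\<close>

definition sub_alg ::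
    "('k::field, 'h::{ring, monoid_mult}) hopf \<Rightarrow> ('k, 'h, 'a::{ring, monoid_mult}) comod_alg \<Rightarrow>
     'a set set" where
  "sub_alg H A = {C. module.subspace (ascale A) C \<and> 1 \<in> C \<and> (\<forall>x\<in>C. \<forall>y\<in>C. x * y \<in> C) \<and>
     coinvariants H A \<subseteq> C}"

definition sub_alg_order ::
    "('k::field, 'h::{ring, monoid_mult}) hopf \<Rightarrow> ('k, 'h, 'a::{ring, monoid_mult}) comod_alg \<Rightarrow>
     'a set gorder" where
  "sub_alg_order H A = \<lparr>carrier = sub_alg H A, eq = (=), le = (\<subseteq>)\<rparr>"

abbreviation phi ::
    "('k::field, 'h::{ring, monoid_mult}, 'a::{ring, monoid_mult}) comod_alg \<Rightarrow>
     ('k, 'h set) kspace \<Rightarrow> 'a set" where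
  "phi A Q \<equiv> coinvariants_quot A Q"

definition psi ::
    "('k::field, 'h::{ring, monoid_mult}) hopf \<Rightarrow> ('k, 'h, 'a::{ring, monoid_mult}) comod_alg \<Rightarrow>
     'a set \<Rightarrow> ('k, 'h set) kspace" where
  "psi H A C = \<Squnion>\<^bsub>quot_gen_order H\<^esub> {Q \<in> quot_gen H. C \<subseteq> phi A Q}"

text \<open>Library Galois connections are monotone, hence the dual order on subalgebras.\<close>

definition quot_sub_connection ::
    "('k::field, 'h::{ring, monoid_mult}) hopf \<Rightarrow> ('k, 'h, 'a::{ring, monoid_mult}) comod_alg \<Rightarrow>
     (('k, 'h set) kspace, 'a set) galois" where
  "quot_sub_connection H A =
     \<lparr>orderA = quot_gen_order H, orderB = inv_gorder (sub_alg_order H A),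
      lower = phi A, upper = psi H A\<rparr>"

text \<open>An extension \<open>A\<^bsup>co Q\<^esup> \<subseteq> A\<close> is recorded by its subalgebra \<open>A\<^bsup>co Q\<^esup>\<close>.\<close>

definition sub_Hext ::
    "('k::field, 'h::{ring, monoid_mult}) hopf \<Rightarrow> ('k, 'h, 'a::{ring, monoid_mult}) comod_alg \<Rightarrow>
     'a set set" where
  "sub_Hext H A = {phi A Q | Q. Q \<in> quot_gen H}"

end

theory Submission
  imports Defs "HOL-Library.Function_Algebras"
begin

text \<open>
  Everything is tested on functionals. For \<open>X \<subseteq> A\<close>, the elements \<open>f (c\<^sub>0) c\<^sub>1 - f (c) 1\<close> with \<open>c \<in> X\<close> and
  \<open>f\<close> a functional on \<open>A\<close> span a coideal, and the right ideal \<open>J(X)\<close> generated by it satisfies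
  \<open>J(X) \<subseteq> I\<close> iff \<open>X \<subseteq> A\<^bsup>co H/I\<^esup>\<close>. Hence \<open>\<psi>(X) = H/J(X)\<close>, and \<open>H/I\<close> is closed iff \<open>I \<subseteq> J(A\<^bsup>co H/I\<^esup>)\<close>.
  Let \<open>K = H\<^bsup>co H/I\<^esup>\<close>; always \<open>J(A\<^bsup>co H/I\<^esup>) \<subseteq> K\<^sup>+ H\<close>. In the cleft case \<open>a \<otimes> h \<mapsto> a \<gamma>'(h\<^sub>1) \<otimes> \<gamma>(h\<^sub>2)\<close>
  inverts the canonical map over \<open>H\<close>, and it descends to \<open>H/I\<close> as soon as \<open>I \<subseteq> K\<^sup>+ H\<close>; conversely,
  injectivity of the canonical map over \<open>H/I\<close> forces \<open>I \<subseteq> J(A\<^bsup>co H/I\<^esup>)\<close>.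

  In finite dimension, every coideal right ideal equals \<open>K\<^sup>+ H\<close>: the dimension of the
  \<open>H/I\<close>-coinvariants of \<open>X \<otimes> H\<close> is proportional to \<open>dim X\<close>. The maximum of the ratio over all comodules
  is inherited by subquotients and by tensoring with \<open>H\<close>, and a comodule attaining it has a trivial
  subcomodule after tensoring with \<open>H\<close>. This gives a dimension formula that makes \<open>dim (H/I)\<close> depend only
  on a space which \<open>I\<close> and \<open>K\<^sup>+ H\<close> share.
\<close>

section \<open>Linear functionals and tensors\<close>

text \<open>Quotients and tensor products exist only as cosets, so maps between them are handled by
  pulling back bilinear forms: well-definedness becomes a vanishing or balancedness condition on
  forms. Why the maximal ratio \<rho> propagates: write c(M) for the dimension of the
  H/I-coinvariants of \<open>M \<otimes> H\<close>. Taking coinvariants is only left exact, so c(M)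
  is at most c(N) + c(M/N), and c(M/N) is at most \<rho> dim (M/N). If M attains \<rho>, both a
  subcomodule N and the quotient M/N must attain it too. Tensoring with H multiplies dim by dim H
  and c by at least dim H. A nonzero coinvariant of \<open>X \<otimes> H\<close> spans a copy of the
  trivial comodule k, so c(k) = \<rho>. Then \<open>k \<otimes> H = H\<close> attains \<rho>, and so
  does its quotient H/I, for which c(H/I) = dim H. Thus dim (H/I) times c(k) is dim H. The space
  counted by c(k) consists of elements whose antipode images lie in K, and it is the same for I and
  for K^+ H; nested ideals of equal dimension coincide.\<close>

definition lin :: "('k \<Rightarrow> 'v \<Rightarrow> 'v) \<Rightarrow> ('k \<Rightarrow> 'w \<Rightarrow> 'w) \<Rightarrow> ('v::ab_group_add \<Rightarrow> 'w::ab_group_add) \<Rightarrow> bool" where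
  "lin s t f \<longleftrightarrow> (\<forall>x y. f (x + y) = f x + f y) \<and> (\<forall>c x. f (s c x) = t c (f x))"

definition bil where
  "bil s1 s2 t \<beta> \<longleftrightarrow> (\<forall>y. lin s1 t (\<lambda>x. \<beta> x y)) \<and> (\<forall>x. lin s2 t (\<beta> x))"

text \<open>\<open>lin\<close> states additivity and homogeneity alone, without the vector space
  axioms packed into \<open>Vector_Spaces.linear\<close>; linearity of nested Sweedler expressions
  is then proved by repeatedly applying \<open>lin_intros\<close>.\<close>

named_theorems lin_intros

lemma lin_add: "lin s t f \<Longrightarrow> f (x + y) = f x + f y"
  and lin_scale: "lin s t f \<Longrightarrow> f (s c x) = t c (f x)"
  by (auto simp: lin_def)

lemma lin_zero: assumes "lin s t f" shows "f 0 = 0"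
  using lin_add[OF assms, of 0 0] by simp

lemma lin_diff: "lin s t f \<Longrightarrow> f (x - y) = f x - f y"
  by (metis lin_add add_diff_cancel diff_add_cancel)

lemma lin_sum: "lin s t f \<Longrightarrow> f (\<Sum>i\<in>I. g i) = (\<Sum>i\<in>I. f (g i))"
  by (induction I rule: infinite_finite_induct) (auto simp: lin_zero lin_add)

lemma linear_iff_lin: "Vector_Spaces.linear s t f \<longleftrightarrow> vector_space s \<and> vector_space t \<and> lin s t f"
  by (auto simp: Vector_Spaces.linear_iff lin_def)

lemma lin_id [lin_intros]: "lin s s (\<lambda>x. x)"
  by (simp add: lin_def)

lemma lin_comp: "lin s t f \<Longrightarrow> lin r s g \<Longrightarrow> lin r t (\<lambda>x. f (g x))"
  by (simp add: lin_def)

lemma lin_sub [lin_intros]: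
  assumes "vector_space t" "lin s t f" "lin s t g" shows "lin s t (\<lambda>x. f x - g x)"
proof -
  interpret vector_space t by fact
  show ?thesis using assms(2,3) by (simp add: lin_def scale_right_diff_distrib)
qed

lemma lin_sumI [lin_intros]:
  assumes "vector_space t" "\<And>i. i \<in> I \<Longrightarrow> lin s t (\<lambda>x. f x i)" shows "lin s t (\<lambda>x. \<Sum>i\<in>I. f x i)"
proof -
  interpret vector_space t by fact
  show ?thesis using assms(2) by (simp add: lin_def scale_sum_right sum.distrib)
qed

lemma lin_scale_right [lin_intros]:
  assumes "vector_space t" "lin s t f" shows "lin s t (\<lambda>x. t c (f x))"
proof -
  interpret vector_space t by fact
  show ?thesis using assms(2) by (simp add: lin_def scale_right_distrib scale_left_commute)
qed

lemma lin_scale_left [lin_intros]: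
  assumes "vector_space t" "lin s (*) f" shows "lin s t (\<lambda>x. t (f x) w)"
proof -
  interpret vector_space t by fact
  show ?thesis using assms(2) by (simp add: lin_def scale_left_distrib)
qed

lemma vs_field [lin_intros]: "vector_space ((*) :: 'k::field \<Rightarrow> 'k \<Rightarrow> 'k)"
  by unfold_locales (simp_all add: algebra_simps)

lemma bilI: "(\<And>y. lin s1 t (\<lambda>x. \<beta> x y)) \<Longrightarrow> (\<And>x. lin s2 t (\<lambda>y. \<beta> x y)) \<Longrightarrow> bil s1 s2 t \<beta>"
  by (simp add: bil_def)

lemma bilD1: "bil s1 s2 t \<beta> \<Longrightarrow> lin s1 t (\<lambda>x. \<beta> x y)"
  and bilD2: "bil s1 s2 t \<beta> \<Longrightarrow> lin s2 t (\<lambda>y. \<beta> x y)"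
  by (auto simp: bil_def)

section \<open>Linear extension from the free vector space\<close>

lemma lookup_fscale [simp]: "Poly_Mapping.lookup (fscale c x) p = c * Poly_Mapping.lookup x p"
  unfolding fscale_def by (simp add: Poly_Mapping.map.rep_eq when_def)

lemma vs_fscale: "vector_space (fscale :: 'k::field \<Rightarrow> ('x \<Rightarrow>\<^sub>0 'k) \<Rightarrow> _)"
  by unfold_locales (auto intro!: poly_mapping_eqI simp: lookup_add algebra_simps)

lemma lin_ext_superset:
  assumes "vector_space s" "finite T" "Poly_Mapping.keys x \<subseteq> T"
  shows "lin_ext s f x = (\<Sum>p\<in>T. s (Poly_Mapping.lookup x p) (f p))"
proof -
  interpret vector_space s by fact
  show ?thesis unfolding lin_ext_def
    by (rule sum.mono_neutral_left) (use assms in \<open>auto simp: in_keys_iff\<close>)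
qed

lemma lin_ext_lin: assumes "vector_space s" shows "lin fscale s (lin_ext s f)"
proof -
  interpret vector_space s by fact
  have "lin_ext s f (x + y) = lin_ext s f x + lin_ext s f y" for x y
  proof -
    let ?T = "Poly_Mapping.keys x \<union> Poly_Mapping.keys y"
    have "Poly_Mapping.keys (x + y) \<subseteq> ?T" by (rule Poly_Mapping.keys_add)
    then show ?thesis
      by (simp add: lin_ext_superset[OF assms, where T = ?T] lookup_add scale_left_distrib sum.distrib)
  qed
  moreover have "lin_ext s f (fscale c x) = s c (lin_ext s f x)" for c x
  proof -
    have "Poly_Mapping.keys (fscale c x) \<subseteq> Poly_Mapping.keys x" by (auto simp: in_keys_iff)
    then show ?thesis
      by (simp add: lin_ext_superset[OF assms, where T = "Poly_Mapping.keys x"] scale_sum_right)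
  qed
  ultimately show ?thesis by (simp add: lin_def)
qed

lemma lin_ext_gen [simp]: assumes "vector_space s" shows "lin_ext s f (gen p) = f p"
proof -
  interpret vector_space s by fact
  show ?thesis by (simp add: lin_ext_def)
qed

lemma lin_lin_ext: assumes "lin s t u" shows "u (lin_ext s f x) = lin_ext t (\<lambda>p. u (f p)) x"
  by (simp add: lin_ext_def lin_sum[OF assms] lin_scale[OF assms])

lemma lin_ext_lin_ext:
  "vector_space t \<Longrightarrow> lin_ext t f (lin_ext fscale G x) = lin_ext t (\<lambda>p. lin_ext t f (G p)) x"
  by (rule lin_lin_ext[OF lin_ext_lin])

lemma lin_ext_cong: "(\<And>p. p \<in> Poly_Mapping.keys x \<Longrightarrow> f p = g p) \<Longrightarrow> lin_ext s f x = lin_ext s g x"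
  unfolding lin_ext_def by (rule sum.cong) auto

lemma lin_ext_gen_id: "lin_ext fscale gen x = x"
proof -
  have "lin_ext fscale gen x = (\<Sum>p\<in>Poly_Mapping.keys x. Poly_Mapping.single p (Poly_Mapping.lookup x p))"
    unfolding lin_ext_def by (rule sum.cong) (auto intro!: poly_mapping_eqI simp: lookup_single when_def)
  also have "\<dots> = x"
    by (rule poly_mapping_eqI) (simp add: lookup_sum lookup_single when_def sum.delta' in_keys_iff)
  finally show ?thesis .
qed

text \<open>Cosets and tensors are compared by testing them on functionals and bilinear forms.\<close>

lemma separating_functional:
  assumes "vector_space s" and "x \<notin> module.span s S"
  obtains u where "lin s (*) u" "\<And>y. y \<in> S \<Longrightarrow> u y = 0" "u x = (1::'k::field)"
proof -
  interpret vector_space s by fact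
  interpret k: vector_space_pair s "(*) :: 'k \<Rightarrow> 'k \<Rightarrow> 'k"
    by (intro vector_space_pair.intro assms vs_field)
  obtain b where b: "b \<subseteq> S" "independent b" "S \<subseteq> span b"
    using maximal_independent_subset by blast
  have x: "x \<notin> span b" using assms(2) span_mono[OF b(1)] by blast
  then have "independent (insert x b)" by (rule independent_insertI) (rule b)
  from k.linear_independent_extend[OF this, of "\<lambda>y. if y = x then 1 else 0"]
  obtain g where g: "Vector_Spaces.linear s (*) g"
      "\<forall>y\<in>insert x b. g y = (if y = x then 1 else 0)" by blast
  have l: "lin s (*) g" using g(1) by (simp add: linear_iff_lin)
  have "g y = 0" if "y \<in> span b" for y
  proof -
    have "subspace {y. g y = 0}"
      by (simp add: subspace_def lin_zero[OF l] lin_add[OF l] lin_scale[OF l])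
    moreover have "b \<subseteq> {y. g y = 0}" using g(2) x span_base by auto
    ultimately show ?thesis using that span_minimal by blast
  qed
  with g(2) b l that show ?thesis by (metis insertI1 subsetD)
qed

lemma lin_span_zero:
  assumes "vector_space s" "lin s t u" "vector_space t" "\<And>y. y \<in> S \<Longrightarrow> u y = 0" "x \<in> module.span s S"
  shows "u x = 0"
proof -
  interpret vector_space s by fact
  interpret t: vector_space t by fact
  have "subspace {y. u y = 0}"
    by (simp add: subspace_def lin_zero[OF assms(2)] lin_add[OF assms(2)] lin_scale[OF assms(2)])
  with assms(4,5) span_minimal[of S "{y. u y = 0}"] show ?thesis by blast
qed

lemma span_iff_functionals:
  assumes "vector_space s"
  shows "x \<in> module.span s S \<longleftrightarrow>
    (\<forall>u :: _ \<Rightarrow> 'k::field. lin s (*) u \<and> (\<forall>y\<in>S. u y = 0) \<longrightarrow> u x = 0)"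
  using separating_functional[OF assms, of x S] lin_span_zero[OF assms _ vs_field, of _ S x]
  by (metis one_neq_zero)

lemma functional_ext:
  assumes "vector_space s" "\<And>u :: _ \<Rightarrow> 'k::field. lin s (*) u \<Longrightarrow> u x = u y"
  shows "x = y"
proof -
  interpret vector_space s by fact
  have "x - y \<in> span {}"
    unfolding span_iff_functionals[OF assms(1)] using assms(2) by (auto simp: lin_diff)
  then show ?thesis by simp
qed

lemma coset_eq_iff:
  assumes "vector_space s"
  shows "x +o module.span s S = y +o module.span s S \<longleftrightarrow> x - y \<in> module.span s S"
proof -
  interpret vector_space s by fact
  have "x - y \<in> span S" if "x +o span S = y +o span S"
  proof -
    have "x \<in> x +o span S" using span_zero by (auto simp: elt_set_plus_def intro: exI[of _ 0])
    with that have "x \<in> y +o span S" by (rule subst)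
    then obtain r where "x = y + r" "r \<in> span S" by (auto simp: elt_set_plus_def)
    then show ?thesis by simp
  qed
  moreover have "a +o span S \<subseteq> b +o span S" if "a - b \<in> span S" for a b
  proof
    fix z assume "z \<in> a +o span S"
    then obtain r where r: "z = a + r" "r \<in> span S" by (auto simp: elt_set_plus_def)
    then have "z = b + ((a - b) + r)" "(a - b) + r \<in> span S" using that span_add by auto
    then show "z \<in> b +o span S" unfolding elt_set_plus_def by blast
  qed
  moreover have "y - x \<in> span S" if "x - y \<in> span S" using span_neg[OF that] by simp
  ultimately show ?thesis by blast
qed

lemma rep_coset:
  assumes "vector_space s"
  shows "rep (x +o module.span s S) - x \<in> module.span s S"
proof -
  interpret vector_space s by fact
  have "x \<in> x +o span S" using span_zero by (auto simp: elt_set_plus_def intro: exI[of _ 0])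
  then have "rep (x +o span S) \<in> x +o span S" unfolding rep_def by (rule someI)
  then show ?thesis by (auto simp: elt_set_plus_def)
qed

text \<open>\<open>sw t (\<delta> a) \<beta>\<close> is the Sweedler sum \<open>\<beta> a\<^sub>0 a\<^sub>1\<close>, with values in a vector space with scalar multiplication \<open>t\<close>.\<close>

definition sw :: "('k::field \<Rightarrow> 'w \<Rightarrow> 'w) \<Rightarrow> ('x \<times> 'y \<Rightarrow>\<^sub>0 'k) set \<Rightarrow> ('x \<Rightarrow> 'y \<Rightarrow> 'w::ab_group_add) \<Rightarrow> 'w" where
  "sw t X \<beta> = lin_ext t (\<lambda>(x, y). \<beta> x y) (rep X)"

lemma lin_rels_zero:
  assumes "lin fscale t u" "lin s t (\<lambda>v. u (\<iota> v))" "y \<in> lin_rels (type_space s) \<iota>"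
  shows "u y = 0"
  using assms(3) by (auto simp: lin_rels_def type_space_def lin_diff[OF assms(1)] lin_scale[OF assms(1)]
    lin_add[OF assms(2)] lin_scale[OF assms(2)])

abbreviation "form \<beta> \<equiv> lin_ext (*) (\<lambda>(x, y). \<beta> x y)"

lemma bil_rels_zero:
  assumes t: "vector_space t" and b: "bil s1 s2 t \<beta>"
    and x: "x \<in> module.span fscale (bilin_rels (type_space s1) (type_space s2))"
  shows "lin_ext t (\<lambda>(x, y). \<beta> x y) x = 0"
proof (rule lin_span_zero[OF vs_fscale lin_ext_lin[OF t] t _ x])
  fix y assume "y \<in> bilin_rels (type_space s1) (type_space s2)"
  then show "lin_ext t (\<lambda>(x, y). \<beta> x y) y = 0"
    unfolding bilin_rels_def
    by (elim UnE UN_E; elim lin_rels_zero[OF lin_ext_lin[OF t], rotated])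
      (use b t in \<open>simp_all add: bil_def\<close>)
qed

text \<open>Together with \<open>bil_rels_zero\<close> this is the universal property of the tensor
  product: linear maps on the free space that kill the relations are the same as bilinear
  maps.\<close>

lemma bil_gen:
  assumes u: "lin fscale t u" and z: "\<And>y. y \<in> bilin_rels (type_space s1) (type_space s2) \<Longrightarrow> u y = 0"
  shows "bil s1 s2 t (\<lambda>x y. u (gen (x, y)))"
proof (rule bilI)
  fix y
  have "u (gen (v + v', y) - gen (v, y) - gen (v', y)) = 0" "u (gen (s1 c v, y) - fscale c (gen (v, y))) = 0" for v v' c
    by (rule z; force simp: bilin_rels_def lin_rels_def type_space_def)+
  then show "lin s1 t (\<lambda>x. u (gen (x, y)))"
    by (simp add: lin_def lin_diff[OF u] lin_add[OF u] lin_scale[OF u] algebra_simps)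
next
  fix y
  have "u (gen (y, v + v') - gen (y, v) - gen (y, v')) = 0" "u (gen (y, s2 c v) - fscale c (gen (y, v))) = 0" for v v' c
    by (rule z; force simp: bilin_rels_def lin_rels_def type_space_def)+
  then show "lin s2 t (\<lambda>x. u (gen (y, x)))"
    by (simp add: lin_def lin_diff[OF u] lin_add[OF u] lin_scale[OF u] algebra_simps)
qed

text \<open>Two representatives differ by bilinear relations, which a bilinear map kills; so the
  choice made by \<open>rep\<close> is invisible.\<close>

lemma sw_tcls:
  assumes t: "vector_space t" and b: "bil s1 s2 t \<beta>"
  shows "sw t (tcls (type_space s1) (type_space s2) x) \<beta> = lin_ext t (\<lambda>(x, y). \<beta> x y) x"
proof -
  have "rep (tcls (type_space s1) (type_space s2) x) - x \<in>
      module.span fscale (bilin_rels (type_space s1) (type_space s2))"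
    unfolding tcls_def tensor_rels_def by (rule rep_coset[OF vs_fscale])
  from bil_rels_zero[OF t b this] show ?thesis
    by (simp add: sw_def lin_diff[OF lin_ext_lin[OF t]])
qed

lemma lin_sw: "lin s t u \<Longrightarrow> u (sw s X \<beta>) = sw t X (\<lambda>x y. u (\<beta> x y))"
  unfolding sw_def by (simp add: lin_lin_ext case_prod_unfold)

lemma lin_sw_form [lin_intros]:
  assumes t: "vector_space t" and l: "\<And>x y. lin r t (\<lambda>z. \<beta> z x y)"
  shows "lin r t (\<lambda>z. sw t X (\<beta> z))"
  unfolding sw_def lin_ext_def
  by (intro lin_sumI t) (auto simp: case_prod_unfold intro!: lin_scale_right t l)

lemma carrier_tensor_type_space:
  "X \<in> carrier (tensor (type_space s1) (type_space s2)) \<Longrightarrow> \<exists>x. X = tcls (type_space s1) (type_space s2) x"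
  by (auto simp: tensor_def quot_def tcls_def)

lemma coset_plus:
  assumes "vector_space s"
  shows "(x +o module.span s S) + (y +o module.span s S) = (x + y) +o module.span s S"
proof -
  interpret vector_space s by fact
  have "span S + span S = span S"
    using span_zero span_add by (force simp: set_plus_def intro: exI[of _ 0] bexI[of _ 0])
  then show ?thesis unfolding set_plus_rearrange by simp
qed

lemma coset_scale:
  assumes "vector_space s"
  shows "s c ` (x +o module.span s S) + module.span s S = s c x +o module.span s S"
proof -
  interpret vector_space s by fact
  show ?thesis
  proof (intro equalityI subsetI)
    fix v assume "v \<in> s c ` (x +o span S) + span S"
    then obtain r q where "v = s c (x + r) + q" "r \<in> span S" "q \<in> span S"
      by (auto simp: set_plus_def elt_set_plus_def)
    then have "v = s c x + (s c r + q)" "s c r + q \<in> span S"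
      using span_add span_scale by (auto simp: scale_right_distrib add.assoc)
    then show "v \<in> s c x +o span S" by (auto simp: elt_set_plus_def)
  next
    fix v assume "v \<in> s c x +o span S"
    then obtain q where "v = s c x + q" "q \<in> span S" by (auto simp: elt_set_plus_def)
    moreover have "x \<in> x +o span S"
      using span_zero by (auto simp: elt_set_plus_def intro: bexI[of _ 0])
    ultimately show "v \<in> s c ` (x +o span S) + span S" by (auto simp: set_plus_def)
  qed
qed

lemma tcls_plus: "tcls V W x + tcls V W y = tcls V W (x + y)"
  unfolding tcls_def tensor_rels_def by (rule coset_plus[OF vs_fscale])

lemma tcls_scale: "fscale c ` tcls V W x + tensor_rels V W = tcls V W (fscale c x)"
  unfolding tcls_def tensor_rels_def by (rule coset_scale[OF vs_fscale])

text \<open>\<open>klinear\<close> speaks of coset operations; evaluated on a bilinear map they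
  become ordinary addition and scaling.\<close>

lemma sw_lin:
  assumes d: "klinear (type_space r) (tensor (type_space s1) (type_space s2)) \<delta>"
    and t: "vector_space t" and b: "bil s1 s2 t \<beta>"
  shows "lin r t (\<lambda>a. sw t (\<delta> a) \<beta>)"
proof -
  let ?T = "tcls (type_space s1) (type_space s2)"
  have "\<exists>x. \<delta> a = ?T x" for a
    using d by (intro carrier_tensor_type_space) (auto simp: klinear_def type_space_def)
  then obtain x where x: "\<And>a. \<delta> a = ?T (x a)" by metis
  have 1: "\<delta> (a + b) = \<delta> a + \<delta> b" for a b
    using d by (simp add: klinear_def type_space_def tensor_def quot_def)
  have 2: "\<delta> (r c a) = fscale c ` \<delta> a + tensor_rels (type_space s1) (type_space s2)" for c a
    using d by (simp add: klinear_def type_space_def tensor_def quot_def)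
  show ?thesis unfolding lin_def
  proof safe
    fix a b show "sw t (\<delta> (a + b)) \<beta> = sw t (\<delta> a) \<beta> + sw t (\<delta> b) \<beta>"
      unfolding 1 unfolding x tcls_plus by (simp add: sw_tcls[OF t b] lin_add[OF lin_ext_lin[OF t]])
  next
    fix c a show "sw t (\<delta> (r c a)) \<beta> = t c (sw t (\<delta> a) \<beta>)"
      unfolding 2 unfolding x tcls_scale by (simp add: sw_tcls[OF t b] lin_scale[OF lin_ext_lin[OF t]])
  qed
qed

text \<open>A trilinear map kills the relations divided out in \<open>tcls3\<close>, so equal
  classes have equal values.\<close>

lemma sw_coassoc:
  assumes c: "coassociative sA sH \<Delta> \<delta>" and t: "vector_space t"
    and F: "\<And>y z. lin sA t (\<lambda>x. F x y z)" "\<And>x z. lin sH t (\<lambda>y. F x y z)" "\<And>x y. lin sH t (\<lambda>z. F x y z)"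
  shows "sw t (\<delta> a) (\<lambda>b h. sw t (\<delta> b) (\<lambda>b0 b1. F b0 b1 h)) = sw t (\<delta> a) (\<lambda>b h. sw t (\<Delta> h) (\<lambda>h1 h2. F b h1 h2))"
proof -
  let ?F = "\<lambda>(x, y, z). F x y z"
  let ?l = "lin_ext fscale (\<lambda>(b, h). lin_ext fscale (\<lambda>(b0, b1). gen (b0, b1, h)) (rep (\<delta> b))) (rep (\<delta> a))"
  let ?r = "lin_ext fscale (\<lambda>(b, h). lin_ext fscale (\<lambda>(h1, h2). gen (b, h1, h2)) (rep (\<Delta> h))) (rep (\<delta> a))"
  have "?l - ?r \<in> module.span fscale (
     (\<Union>v. \<Union>w. lin_rels (type_space sA) (\<lambda>u. gen (u, v, w))) \<union>
     (\<Union>u. \<Union>w. lin_rels (type_space sH) (\<lambda>v. gen (u, v, w))) \<union>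
     (\<Union>u. \<Union>v. lin_rels (type_space sH) (\<lambda>w. gen (u, v, w))))"
    using c unfolding coassociative_def tcls3_def coset_eq_iff[OF vs_fscale] by (simp add: type_space_def)
  then have "lin_ext t ?F (?l - ?r) = 0"
  proof (rule lin_span_zero[OF vs_fscale lin_ext_lin[OF t] t, rotated])
    fix y assume "y \<in>
     (\<Union>v. \<Union>w. lin_rels (type_space sA) (\<lambda>u. gen (u, v, w))) \<union>
     (\<Union>u. \<Union>w. lin_rels (type_space sH) (\<lambda>v. gen (u, v, w))) \<union>
     (\<Union>u. \<Union>v. lin_rels (type_space sH) (\<lambda>w. gen (u, v, w)))"
    then show "lin_ext t ?F y = 0"
      by (elim UnE UN_E; elim lin_rels_zero[OF lin_ext_lin[OF t], rotated]) (use F t in simp_all)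
  qed
  then have "lin_ext t ?F ?l = lin_ext t ?F ?r"
    by (simp add: lin_diff[OF lin_ext_lin[OF t]])
  then show ?thesis
    by (simp add: sw_def lin_ext_lin_ext[OF t] case_prod_unfold t)
qed

lemma sw_mult:
  assumes d: "algebra_map_into_tensor sA sH \<delta>" and t: "vector_space t" and b: "bil sA sH t \<beta>"
  shows "sw t (\<delta> (a * b)) \<beta> = sw t (\<delta> a) (\<lambda>a0 a1. sw t (\<delta> b) (\<lambda>b0 b1. \<beta> (a0 * b0) (a1 * b1)))"
proof -
  have "\<delta> (a * b) = tcls (type_space sA) (type_space sH) (tmult (rep (\<delta> a)) (rep (\<delta> b)))"
    using d by (simp add: algebra_map_into_tensor_def)
  then show ?thesis
    by (simp only: sw_tcls[OF t b]) (simp add: tmult_def lin_ext_lin_ext[OF t] sw_def case_prod_unfold t)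
qed

section \<open>Sweedler calculus\<close>

lemma sw_swap:
  assumes "vector_space t"
  shows "sw t X (\<lambda>x y. sw t Y (\<lambda>u v. F x y u v)) = sw t Y (\<lambda>u v. sw t X (\<lambda>x y. F x y u v))"
proof -
  interpret vector_space t by fact
  show ?thesis
    unfolding sw_def lin_ext_def case_prod_unfold scale_sum_right
    by (subst sum.swap) (simp add: mult.commute)
qed

lemma lin_mult_left [lin_intros]: "k_algebra s \<Longrightarrow> lin r s g \<Longrightarrow> lin r s (\<lambda>z. g z * c)"
  and lin_mult_right [lin_intros]: "k_algebra s \<Longrightarrow> lin r s g \<Longrightarrow> lin r s (\<lambda>z. c * g z)"
  by (auto simp: k_algebra_def lin_def algebra_simps)

lemma lin_mult_left_field [lin_intros]: "lin r (*) g \<Longrightarrow> lin r (*) (\<lambda>z. g z * (c :: 'k::field))"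
  and lin_mult_right_field [lin_intros]: "lin r (*) g \<Longrightarrow> lin r (*) (\<lambda>z. (c :: 'k::field) * g z)"
  by (auto simp: lin_def algebra_simps)

lemma tcls_rep: "tcls V W (rep (tcls V W x)) = tcls V W x"
  unfolding tcls_def tensor_rels_def coset_eq_iff[OF vs_fscale] by (rule rep_coset[OF vs_fscale])

section \<open>Sweedler rules for Hopf algebras, comodule algebras and cleaving maps\<close>

locale hopf =
  fixes H :: "('k::field, 'h::{ring, monoid_mult}) hopf"
  assumes hopf: "hopf_algebra H"
begin

abbreviation "sH \<equiv> hscale H"
abbreviation "\<epsilon> \<equiv> counit H"
abbreviation "S \<equiv> antipode H"
abbreviation "D t h \<beta> \<equiv> sw t (comult H h) \<beta>"

lemma k_algebra_H [lin_intros]: "k_algebra sH" and vs_H [lin_intros]: "vector_space sH"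
  using hopf by (auto simp: hopf_algebra_def k_algebra_def)

lemmas lin_scaleH [lin_intros] = lin_scale_left[OF vs_H] lin_scale_right[OF vs_H]

lemma lin_counit: "lin sH (*) \<epsilon>" and lin_antipode: "lin sH sH S"
  using hopf by (auto simp: hopf_algebra_def linear_iff_lin)

lemmas lin_counit' [lin_intros] = lin_comp[OF lin_counit]
lemmas lin_antipode' [lin_intros] = lin_comp[OF lin_antipode]

lemma alg_map: "algebra_map_into_tensor sH sH (comult H)"
  using hopf by (auto simp: hopf_algebra_def)

lemma D_lin: "vector_space t \<Longrightarrow> bil sH sH t \<beta> \<Longrightarrow> lin sH t (\<lambda>h. D t h \<beta>)"
  by (rule sw_lin) (use alg_map in \<open>auto simp: algebra_map_into_tensor_def\<close>)

lemma D_lin' [lin_intros]: "vector_space t \<Longrightarrow> (\<And>y. lin sH t (\<lambda>x. \<beta> x y)) \<Longrightarrow> (\<And>x. lin sH t (\<lambda>y. \<beta> x y))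
   \<Longrightarrow> lin r sH g \<Longrightarrow> lin r t (\<lambda>h. D t (g h) \<beta>)"
  by (rule lin_comp[OF D_lin]) (auto simp: bil_def)

lemma D_coassoc:
  assumes "vector_space t"
    and "\<And>y z. lin sH t (\<lambda>x. F x y z)" "\<And>x z. lin sH t (\<lambda>y. F x y z)" "\<And>x y. lin sH t (\<lambda>z. F x y z)"
  shows "D t h (\<lambda>x z. D t x (\<lambda>u v. F u v z)) = D t h (\<lambda>x z. D t z (\<lambda>u v. F x u v))"
  by (rule sw_coassoc[OF _ assms]) (use hopf in \<open>auto simp: hopf_algebra_def\<close>)

lemma D_mult:
  assumes "vector_space t" "\<And>y. lin sH t (\<lambda>x. \<beta> x y)" "\<And>x. lin sH t (\<lambda>y. \<beta> x y)"
  shows "D t (g * h) \<beta> = D t g (\<lambda>g1 g2. D t h (\<lambda>h1 h2. \<beta> (g1 * h1) (g2 * h2)))"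
  by (rule sw_mult[OF alg_map assms(1)]) (use assms in \<open>auto simp: bil_def\<close>)

lemma D_one:
  assumes "vector_space t" "\<And>y. lin sH t (\<lambda>x. \<beta> x y)" "\<And>x. lin sH t (\<lambda>y. \<beta> x y)"
  shows "D t 1 \<beta> = \<beta> 1 1"
proof -
  have "comult H 1 = tcls (hspace H) (hspace H) (gen (1, 1))"
    using alg_map by (simp add: algebra_map_into_tensor_def)
  moreover have "bil sH sH t \<beta>" using assms by (simp add: bil_def)
  ultimately show ?thesis by (simp add: sw_tcls assms)
qed

lemma counit_one: "\<epsilon> 1 = 1" and counit_mult: "\<epsilon> (x * y) = \<epsilon> x * \<epsilon> y"
  using hopf by (auto simp: hopf_algebra_def)

lemma D_counit_left:
  assumes "lin sH t g" shows "D t h (\<lambda>x y. t (\<epsilon> x) (g y)) = g h"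
proof -
  have "D sH h (\<lambda>x y. sH (\<epsilon> x) y) = h" using hopf by (auto simp: hopf_algebra_def sw_def)
  then show ?thesis using lin_sw[OF assms, of "comult H h" "\<lambda>x y. sH (\<epsilon> x) y"] by (simp add: lin_scale[OF assms])
qed

lemma D_counit_right:
  assumes "lin sH t g" shows "D t h (\<lambda>x y. t (\<epsilon> y) (g x)) = g h"
proof -
  have "D sH h (\<lambda>x y. sH (\<epsilon> y) x) = h" using hopf by (auto simp: hopf_algebra_def sw_def)
  then show ?thesis using lin_sw[OF assms, of "comult H h" "\<lambda>x y. sH (\<epsilon> y) x"] by (simp add: lin_scale[OF assms])
qed

lemma D_antipode_left:
  assumes "lin sH t g" shows "D t h (\<lambda>x y. g (S x * y)) = t (\<epsilon> h) (g 1)"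
proof -
  have "D sH h (\<lambda>x y. S x * y) = sH (\<epsilon> h) 1" using hopf by (auto simp: hopf_algebra_def convolution_def sw_def)
  then show ?thesis using lin_sw[OF assms, of "comult H h" "\<lambda>x y. S x * y"] by (simp add: lin_scale[OF assms])
qed

lemma D_antipode_right:
  assumes "lin sH t g" shows "D t h (\<lambda>x y. g (x * S y)) = t (\<epsilon> h) (g 1)"
proof -
  have "D sH h (\<lambda>x y. x * S y) = sH (\<epsilon> h) 1" using hopf by (auto simp: hopf_algebra_def convolution_def sw_def)
  then show ?thesis using lin_sw[OF assms, of "comult H h" "\<lambda>x y. x * S y"] by (simp add: lin_scale[OF assms])
qed

end

locale comod = hopf H for H :: "('k::field, 'h::{ring, monoid_mult}) hopf" +
  fixes A :: "('k, 'h, 'a::{ring, monoid_mult}) comod_alg"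
  assumes comod: "comodule_algebra H A"
begin

abbreviation "sA \<equiv> ascale A"
abbreviation "C t a \<beta> \<equiv> sw t (coact A a) \<beta>"

lemma k_algebra_A [lin_intros]: "k_algebra sA" and vs_A [lin_intros]: "vector_space sA"
  using comod by (auto simp: comodule_algebra_def k_algebra_def)

lemmas lin_scaleA [lin_intros] = lin_scale_left[OF vs_A] lin_scale_right[OF vs_A]

lemma alg_mapA: "algebra_map_into_tensor sA sH (coact A)"
  using comod by (auto simp: comodule_algebra_def)

lemma C_lin: "vector_space t \<Longrightarrow> bil sA sH t \<beta> \<Longrightarrow> lin sA t (\<lambda>h. C t h \<beta>)"
  by (rule sw_lin) (use alg_mapA in \<open>auto simp: algebra_map_into_tensor_def\<close>)

lemma C_lin' [lin_intros]: "vector_space t \<Longrightarrow> (\<And>y. lin sA t (\<lambda>x. \<beta> x y)) \<Longrightarrow> (\<And>x. lin sH t (\<lambda>y. \<beta> x y))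
   \<Longrightarrow> lin r sA g \<Longrightarrow> lin r t (\<lambda>h. C t (g h) \<beta>)"
  by (rule lin_comp[OF C_lin]) (auto simp: bil_def)

lemma C_coassoc:
  assumes "vector_space t"
    and "\<And>y z. lin sA t (\<lambda>x. F x y z)" "\<And>x z. lin sH t (\<lambda>y. F x y z)" "\<And>x y. lin sH t (\<lambda>z. F x y z)"
  shows "C t a (\<lambda>x z. C t x (\<lambda>u v. F u v z)) = C t a (\<lambda>x z. D t z (\<lambda>u v. F x u v))"
  by (rule sw_coassoc[OF _ assms]) (use comod in \<open>auto simp: comodule_algebra_def\<close>)

lemma C_mult:
  assumes "vector_space t" "\<And>y. lin sA t (\<lambda>x. \<beta> x y)" "\<And>x. lin sH t (\<lambda>y. \<beta> x y)"
  shows "C t (a * b) \<beta> = C t a (\<lambda>a0 a1. C t b (\<lambda>b0 b1. \<beta> (a0 * b0) (a1 * b1)))"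
  by (rule sw_mult[OF alg_mapA assms(1)]) (use assms in \<open>auto simp: bil_def\<close>)

lemma C_one:
  assumes "vector_space t" "\<And>y. lin sA t (\<lambda>x. \<beta> x y)" "\<And>x. lin sH t (\<lambda>y. \<beta> x y)"
  shows "C t 1 \<beta> = \<beta> 1 1"
proof -
  have "coact A 1 = tcls (aspace A) (hspace H) (gen (1, 1))"
    using alg_mapA by (simp add: algebra_map_into_tensor_def)
  moreover have "bil sA sH t \<beta>" using assms by (simp add: bil_def)
  ultimately show ?thesis by (simp add: sw_tcls assms)
qed

lemma C_counit:
  assumes "lin sA t g" shows "C t a (\<lambda>x y. t (\<epsilon> y) (g x)) = g a"
proof -
  have "C sA a (\<lambda>x y. sA (\<epsilon> y) x) = a" using comod by (auto simp: comodule_algebra_def sw_def)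
  then show ?thesis using lin_sw[OF assms, of "coact A a" "\<lambda>x y. sA (\<epsilon> y) x"] by (simp add: lin_scale[OF assms])
qed

end

text \<open>H is a comodule algebra over itself by comultiplication. All notions for A thereby exist
  for H under the prefix \<open>self\<close>; in particular \<open>self.coinv I\<close> is the K of
  the overview.\<close>

sublocale hopf \<subseteq> self: comod H "\<lparr>ascale = hscale H, coact = comult H\<rparr>"
  rewrites "ascale \<lparr>ascale = hscale H, coact = comult H\<rparr> = hscale H"
    and "coact \<lparr>ascale = hscale H, coact = comult H\<rparr> = comult H"
proof -
  show "comod H \<lparr>ascale = hscale H, coact = comult H\<rparr>"
    using hopf by unfold_locales (auto simp: comodule_algebra_def hopf_algebra_def)
qed simp_all

locale cleft = comod H A for H :: "('k::field, 'h::{ring, monoid_mult}) hopf"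
    and A :: "('k, 'h, 'a::{ring, monoid_mult}) comod_alg" +
  fixes \<gamma> \<gamma>' :: "'h \<Rightarrow> 'a"
  assumes colin: "comodule_map H A \<gamma>"
    and lin_gamma': "lin sH sA \<gamma>'"
    and conv_right: "\<And>h. convolution H sA \<gamma> \<gamma>' h = sA (\<epsilon> h) 1"
    and conv_left: "\<And>h. convolution H sA \<gamma>' \<gamma> h = sA (\<epsilon> h) 1"
begin

lemma lin_gamma: "lin sH sA \<gamma>"
  using colin by (simp add: comodule_map_def linear_iff_lin)

text \<open>Not in \<open>lin_intros\<close>: for \<open>\<gamma> = id\<close> (the instance \<open>self\<close> below) the first rule would loop.\<close>

lemmas lin_gamma_comp = lin_comp[OF lin_gamma] lin_comp[OF lin_gamma']

lemma C_gamma: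
  assumes "vector_space t" "\<And>y. lin sA t (\<lambda>x. \<beta> x y)" "\<And>x. lin sH t (\<lambda>y. \<beta> x y)"
  shows "C t (\<gamma> h) \<beta> = D t h (\<lambda>x y. \<beta> (\<gamma> x) y)"
proof -
  have "coact A (\<gamma> h) = tcls (aspace A) (hspace H) (lin_ext fscale (\<lambda>(x, y). gen (\<gamma> x, y)) (rep (comult H h)))"
    using colin by (simp add: comodule_map_def)
  moreover have "bil sA sH t \<beta>" using assms by (simp add: bil_def)
  ultimately show ?thesis using assms(1)
    by (simp add: sw_tcls assms lin_ext_lin_ext case_prod_unfold) (simp add: sw_def case_prod_unfold)
qed

lemma D_gamma_gamma':
  assumes "lin sA t g" shows "D t h (\<lambda>x y. g (\<gamma> x * \<gamma>' y)) = t (\<epsilon> h) (g 1)"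
proof -
  have "D sA h (\<lambda>x y. \<gamma> x * \<gamma>' y) = sA (\<epsilon> h) 1" using conv_right by (auto simp: convolution_def sw_def)
  then show ?thesis using lin_sw[OF assms, of "comult H h" "\<lambda>x y. \<gamma> x * \<gamma>' y"] by (simp add: lin_scale[OF assms])
qed

lemma D_gamma'_gamma:
  assumes "lin sA t g" shows "D t h (\<lambda>x y. g (\<gamma>' x * \<gamma> y)) = t (\<epsilon> h) (g 1)"
proof -
  have "D sA h (\<lambda>x y. \<gamma>' x * \<gamma> y) = sA (\<epsilon> h) 1" using conv_left by (auto simp: convolution_def sw_def)
  then show ?thesis using lin_sw[OF assms, of "comult H h" "\<lambda>x y. \<gamma>' x * \<gamma> y"] by (simp add: lin_scale[OF assms])
qed

text \<open>Both sides are convolution inverses of \<open>\<delta> \<circ> \<gamma>\<close>; \<open>P 1 h\<close> is the right-hand side.\<close>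

lemma C_gamma':
  assumes t: "vector_space t" and b: "\<And>y. lin sA t (\<lambda>x. \<beta> x y)" "\<And>x. lin sH t (\<lambda>y. \<beta> x y)"
  shows "C t (\<gamma>' h) \<beta> = D t h (\<lambda>x y. \<beta> (\<gamma>' y) (S x))"
proof -
  note [lin_intros] = lin_gamma_comp t lin_comp[OF b(1)] lin_comp[OF b(2)]
  \<comment> \<open>\<open>P c r\<close> evaluates \<beta> on \<delta>(c) times
    \<open>\<gamma>'(r_2) \<otimes> S(r_1)\<close>.\<close>
  define P where "P c r = D t r (\<lambda>h4 h5. C t c (\<lambda>c0 c1. \<beta> (c0 * \<gamma>' h5) (c1 * S h4)))" for c r
  have P1: "lin sA t (\<lambda>c. P c r)" for r unfolding P_def by (intro lin_intros)
  have P2: "lin sH t (\<lambda>r. P c r)" for c unfolding P_def by (intro lin_intros)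
  note [lin_intros] = lin_comp[OF P1] lin_comp[OF P2]
  \<comment> \<open>The candidate is a right inverse: in
    \<open>\<gamma>(y_1) \<gamma>'(y_4) \<otimes> y_2 S(y_3)\<close> the antipode cancels
    \<open>y_2\<close> against \<open>y_3\<close>, and then \<gamma> cancels against
    \<gamma>'.\<close>
  have inner: "D t y (\<lambda>z r. P (a * \<gamma> z) r) = t (\<epsilon> y) (C t a \<beta>)" for a y
  proof -
    have "P (a * \<gamma> z) r =
        C t a (\<lambda>a0 a1. D t z (\<lambda>z1 z2. D t r (\<lambda>h4 h5. \<beta> (a0 * (\<gamma> z1 * \<gamma>' h5)) (a1 * (z2 * S h4)))))" for z r
    proof -
      have "P (a * \<gamma> z) r =
        D t r (\<lambda>h4 h5. C t a (\<lambda>a0 a1. D t z (\<lambda>z1 z2. \<beta> (a0 * (\<gamma> z1 * \<gamma>' h5)) (a1 * (z2 * S h4)))))"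
        unfolding P_def by (simp add: C_mult C_gamma lin_intros mult.assoc)
      also have "\<dots> = C t a (\<lambda>a0 a1. D t r (\<lambda>h4 h5. D t z (\<lambda>z1 z2. \<beta> (a0 * (\<gamma> z1 * \<gamma>' h5)) (a1 * (z2 * S h4)))))"
        by (rule sw_swap[OF t])
      also have "\<dots> = C t a (\<lambda>a0 a1. D t z (\<lambda>z1 z2. D t r (\<lambda>h4 h5. \<beta> (a0 * (\<gamma> z1 * \<gamma>' h5)) (a1 * (z2 * S h4)))))"
        by (simp only: sw_swap[OF t, of "comult H r" "comult H z"])
      finally show ?thesis .
    qed
    then have "D t y (\<lambda>z r. P (a * \<gamma> z) r) = C t a (\<lambda>a0 a1. D t y (\<lambda>z r.
         D t z (\<lambda>z1 z2. D t r (\<lambda>h4 h5. \<beta> (a0 * (\<gamma> z1 * \<gamma>' h5)) (a1 * (z2 * S h4))))))"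
      by (simp only: sw_swap[OF t, of "coact A a" "comult H y"])
    also have "\<dots> = C t a (\<lambda>a0 a1. D t y (\<lambda>z1 y'.
         D t y' (\<lambda>q h5. D t q (\<lambda>z2 h4. \<beta> (a0 * (\<gamma> z1 * \<gamma>' h5)) (a1 * (z2 * S h4))))))"
      by (simp add: D_coassoc lin_intros)
    also have "\<dots> = C t a (\<lambda>a0 a1. D t y (\<lambda>z1 y'. \<beta> (a0 * (\<gamma> z1 * \<gamma>' y')) a1))"
      by (simp add: D_antipode_right[where g = "\<lambda>u. \<beta> _ (_ * u)"]
          D_counit_left[where t = t] lin_intros)
    also have "\<dots> = t (\<epsilon> y) (C t a \<beta>)"
      by (simp add: D_gamma_gamma'[where g = "\<lambda>u. \<beta> (_ * u) _"] lin_intros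
         lin_sw[OF lin_scale_right[OF t lin_id], symmetric])
    finally show ?thesis .
  qed
  \<comment> \<open>Uniqueness of inverses: insert a counit, replace it by \<open>inner\<close>, and
    let the left inverse \<open>\<delta> \<circ> \<gamma>'\<close> absorb
    \<open>\<delta> \<circ> \<gamma>\<close>.\<close>
  have "C t (\<gamma>' h) \<beta> = D t h (\<lambda>x y. t (\<epsilon> y) (C t (\<gamma>' x) \<beta>))"
    by (simp add: D_counit_right[where t = t] lin_intros b)
  also have "\<dots> = D t h (\<lambda>x y. D t y (\<lambda>z r. P (\<gamma>' x * \<gamma> z) r))" by (simp add: inner)
  also have "\<dots> = D t h (\<lambda>x r. D t x (\<lambda>x z. P (\<gamma>' x * \<gamma> z) r))"
    by (simp add: D_coassoc lin_intros)
  also have "\<dots> = D t h (\<lambda>x r. t (\<epsilon> x) (P 1 r))"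
    by (simp add: D_gamma'_gamma[OF P1])
  also have "\<dots> = P 1 h" by (rule D_counit_left[OF P2])
  also have "\<dots> = D t h (\<lambda>x y. \<beta> (\<gamma>' y) (S x))"
    unfolding P_def by (simp add: C_one lin_intros)
  finally show ?thesis .
qed

end

text \<open>The identity of H is a cleaving map with convolution inverse S. Thus
  \<open>C_gamma'\<close> specialises to \<open>D_antipode\<close>, the anti-comultiplicativity of
  the antipode.\<close>

sublocale hopf \<subseteq> self: cleft H "\<lparr>ascale = hscale H, coact = comult H\<rparr>" "\<lambda>x. x" S
  rewrites "ascale \<lparr>ascale = hscale H, coact = comult H\<rparr> = hscale H"
    and "coact \<lparr>ascale = hscale H, coact = comult H\<rparr> = comult H"
proof -
  have "comult H h = tcls (hspace H) (hspace H) (rep (comult H h))" for h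
  proof -
    obtain x where x: "comult H h = tcls (hspace H) (hspace H) x"
      using alg_map carrier_tensor_type_space[of "comult H h" "hscale H" "hscale H"]
      by (auto simp: algebra_map_into_tensor_def klinear_def type_space_def)
    show ?thesis unfolding x by (rule tcls_rep[symmetric])
  qed
  moreover have "(\<lambda>(x, y). gen (x, y)) = (gen :: 'b \<times> 'b \<Rightarrow> _)" by auto
  ultimately have "comult H h = tcls (hspace H) (hspace H) (lin_ext fscale (\<lambda>(x, y). gen (x, y)) (rep (comult H h)))" for h
    unfolding \<open>(\<lambda>(x, y). gen (x, y)) = gen\<close> lin_ext_gen_id by blast
  then show "cleft H \<lparr>ascale = hscale H, coact = comult H\<rparr> (\<lambda>x. x) S"
    using hopf lin_antipode
    by unfold_locales (simp_all add: comodule_map_def linear_iff_lin vs_H lin_id hopf_algebra_def id_def)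
qed simp_all

lemmas (in hopf) D_antipode = self.C_gamma'

section \<open>Coinvariants and their augmentation ideals\<close>

text \<open>An element of \<open>A \<otimes> H\<close> all of whose slices lie in \<open>V\<close> lies in \<open>A \<otimes> V\<close>.\<close>

lemma slices_zero:
  assumes A: "vector_space sA" and H: "vector_space sH" and b: "bil sA sH t \<beta>" and t: "vector_space t"
    and x: "\<And>f. lin sA (*) f \<Longrightarrow> lin_ext sH (\<lambda>(b, h). sH (f b) h) x \<in> V"
    and V: "\<And>a v. v \<in> V \<Longrightarrow> \<beta> a v = 0"
  shows "lin_ext t (\<lambda>(a, h). \<beta> a h) x = 0"
proof -
  interpret A: vector_space sA by fact
  interpret H: vector_space sH by fact
  interpret t: vector_space t by fact
  \<comment> \<open>Expanding the first factor in a basis of A writes the value as a sum of terms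
    \<open>\<beta> v w\<close>, where w is the slice by the coordinate functional of v.\<close>
  obtain B where B0: "A.independent B" "UNIV \<subseteq> A.span B"
    by (rule A.maximal_independent_subset[of UNIV])
  then have B: "A.independent B" "A.span B = UNIV" by auto
  define f where "f v a = A.representation B a v" for v a
  have f: "lin sA (*) (f v)" for v
    using A.linear_representation[OF B] by (simp add: f_def[abs_def] linear_iff_lin)
  define T where "T = (\<Union>p\<in>Poly_Mapping.keys x. {v. f v (fst p) \<noteq> 0})"
  have T: "finite T" unfolding T_def f_def by (intro finite_UN_I finite_keys A.finite_representation)
  have dec: "fst p = (\<Sum>v\<in>T. sA (f v (fst p)) v)" if p: "p \<in> Poly_Mapping.keys x" for p
  proof -
    have "fst p = (\<Sum>v\<in>{v. f v (fst p) \<noteq> 0}. sA (f v (fst p)) v)"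
      unfolding f_def by (rule A.sum_nonzero_representation_eq[symmetric]) (use B in auto)
    also have "\<dots> = (\<Sum>v\<in>T. sA (f v (fst p)) v)"
      by (rule sum.mono_neutral_left) (use T p in \<open>unfold T_def, auto\<close>)
    finally show ?thesis .
  qed
  have "lin_ext t (\<lambda>(a, h). \<beta> a h) x =
      (\<Sum>p\<in>Poly_Mapping.keys x. t (Poly_Mapping.lookup x p) (\<Sum>v\<in>T. t (f v (fst p)) (\<beta> v (snd p))))"
    unfolding lin_ext_def case_prod_unfold
  proof (rule sum.cong[OF refl])
    fix p assume p: "p \<in> Poly_Mapping.keys x"
    have "\<beta> (fst p) (snd p) = (\<Sum>v\<in>T. t (f v (fst p)) (\<beta> v (snd p)))"
      by (subst dec[OF p]) (simp add: lin_sum[OF bilD1[OF b]] lin_scale[OF bilD1[OF b]])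
    then show "t (Poly_Mapping.lookup x p) (\<beta> (fst p) (snd p)) =
      t (Poly_Mapping.lookup x p) (\<Sum>v\<in>T. t (f v (fst p)) (\<beta> v (snd p)))" by simp
  qed
  also have "\<dots> = (\<Sum>v\<in>T. \<Sum>p\<in>Poly_Mapping.keys x. t (Poly_Mapping.lookup x p) (t (f v (fst p)) (\<beta> v (snd p))))"
    unfolding t.scale_sum_right by (rule sum.swap)
  also have "\<dots> = (\<Sum>v\<in>T. \<beta> v (lin_ext sH (\<lambda>(b, h). sH (f v b) h) x))"
    unfolding lin_ext_def case_prod_unfold lin_sum[OF bilD2[OF b]] by (simp add: lin_scale[OF bilD2[OF b]])
  also have "\<dots> = 0" using x[OF f] V by simp
  finally show ?thesis .
qed

lemma sw_zero: "vector_space t \<Longrightarrow> sw t X (\<lambda>x y. 0) = 0"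
proof -
  assume "vector_space t"
  then interpret vector_space t .
  show ?thesis by (simp add: sw_def lin_ext_def)
qed

context comod
begin

definition slice :: "('a \<Rightarrow> 'k) \<Rightarrow> 'a \<Rightarrow> 'h" where
  "slice f a = C sH a (\<lambda>b h. sH (f b) h)"

text \<open>The coinvariants over H/I, tested by slicing with functionals on A.
  \<open>coinvariants_quot_eq\<close> identifies them with the tensor definition; in this form I may
  be any set, and inclusion of \<open>aug X\<close> in I is adjoint to inclusion of X in
  \<open>coinv I\<close> by definition.\<close>

definition coinv :: "'h set \<Rightarrow> 'a set" where
  "coinv I = {a. \<forall>f. lin sA (*) f \<longrightarrow> slice f a - sH (f a) 1 \<in> I}"

lemma lin_slice: "lin sA (*) f \<Longrightarrow> lin sA sH (slice f)"
  unfolding slice_def[abs_def] by (rule C_lin'[OF vs_H lin_scale_left[OF vs_H] lin_scale_right[OF vs_H lin_id] lin_id])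

text \<open>The working rule for coinvariants: under a form that vanishes on I, \<delta>(a) may be
  replaced by \<open>a \<otimes> 1\<close>, because all slices of the difference lie in I.\<close>

lemma coinv_eval:
  assumes t: "vector_space t" and b: "\<And>y. lin sA t (\<lambda>x. \<beta> x y)" "\<And>x. lin sH t (\<lambda>y. \<beta> x y)"
    and a: "a \<in> coinv I" and I: "\<And>b i. i \<in> I \<Longrightarrow> \<beta> b i = 0"
  shows "C t a \<beta> = \<beta> a 1"
proof -
  have "lin_ext t (\<lambda>(a, h). \<beta> a h) (rep (coact A a) - gen (a, 1)) = 0"
  proof (rule slices_zero[OF vs_A vs_H _ t _ I])
    show "bil sA sH t \<beta>" using b by (rule bilI)
    fix f assume "lin sA (*) f"
    then have "slice f a - sH (f a) 1 \<in> I" using a by (simp add: coinv_def)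
    then show "lin_ext sH (\<lambda>(b, h). sH (f b) h) (rep (coact A a) - gen (a, 1)) \<in> I"
      by (simp add: lin_diff[OF lin_ext_lin[OF vs_H]] vs_H slice_def sw_def)
  qed
  then show ?thesis by (simp add: lin_diff[OF lin_ext_lin[OF t]] t sw_def)
qed

lemma lin_form_slice: "lin sH (*) u \<Longrightarrow> u (slice f a) = C (*) a (\<lambda>b h. f b * u h)"
  unfolding slice_def by (simp only: lin_sw[of sH "(*)" u] lin_scale[of sH "(*)" u])

lemma counit_slice: "lin sA (*) f \<Longrightarrow> \<epsilon> (slice f a) = f a"
  unfolding lin_form_slice[OF lin_counit] using C_counit[of "(*)" f a] by (simp add: mult.commute)

definition aug :: "'a set \<Rightarrow> 'h set" where
  "aug X = {slice f c - sH (f c) 1 | f c. lin sA (*) f \<and> c \<in> X}"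

lemma aug_subset_iff: "aug X \<subseteq> I \<longleftrightarrow> X \<subseteq> coinv I"
  by (auto simp: aug_def coinv_def)

definition aug_ideal :: "'a set \<Rightarrow> 'h set" where
  "aug_ideal X = module.span sH {v * h | v h. v \<in> aug X}"

lemma counit_aug: "v \<in> aug X \<Longrightarrow> \<epsilon> v = 0"
  by (auto simp: aug_def lin_diff[OF lin_counit] counit_slice lin_scale[OF lin_counit] counit_one)

text \<open>The slices of \<open>\<delta> (c)\<close> for \<open>c \<in> X\<close> span a left coideal, for any set \<open>X\<close>.\<close>

lemma D_aug:
  assumes v: "v \<in> aug X" and b: "bil sH sH (*) \<beta>"
    and z: "\<And>v h. v \<in> aug X \<Longrightarrow> \<beta> v h = 0" "\<And>v h. v \<in> aug X \<Longrightarrow> \<beta> h v = 0"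
  shows "D (*) v \<beta> = 0"
proof -
  note [lin_intros] = lin_comp[OF bilD1[OF b]] lin_comp[OF bilD2[OF b]]
  obtain f c where v_eq: "v = slice f c - sH (f c) 1" and f: "lin sA (*) f" and c: "c \<in> X"
    using v by (auto simp: aug_def)
  note [lin_intros] = lin_comp[OF f]
  have l: "lin sH (*) (\<lambda>h. D (*) h \<beta>)" by (intro lin_intros)
  have "D (*) (slice f c) \<beta> = C (*) c (\<lambda>b h. D (*) h (\<lambda>u v. f b * \<beta> u v))"
    by (simp add: lin_form_slice[OF l] lin_sw[OF lin_mult_right_field[OF lin_id]])
  also have "\<dots> = C (*) c (\<lambda>b h. C (*) b (\<lambda>u v. f u * \<beta> v h))"
    by (simp add: C_coassoc lin_intros)
  \<comment> \<open>X lies in \<open>coinv (aug X)\<close> by definition, so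
    \<open>coinv_eval\<close> applies with \<open>aug X\<close> itself in the role of I.\<close>
  also have "\<dots> = C (*) c (\<lambda>u v. f u * \<beta> v 1)"
    by (rule coinv_eval[where I = "aug X"]) (use c in \<open>auto simp: lin_intros z aug_def coinv_def sw_zero[OF vs_field]\<close>)
  also have "\<dots> = \<beta> (slice f c) 1"
    by (rule lin_form_slice[OF bilD1[OF b], symmetric])
  also have "\<dots> = \<beta> v 1 + f c * \<beta> 1 1"
    by (simp add: v_eq lin_diff[OF bilD1[OF b]] lin_scale[OF bilD1[OF b]])
  also have "\<dots> = f c * \<beta> 1 1" using z(1)[OF v] by simp
  finally show ?thesis
    by (simp add: v_eq lin_diff[OF l] lin_scale[OF l] D_one lin_intros)
qed

end

context hopf
begin

text \<open>The annihilator of \<open>I \<otimes> H + H \<otimes> I\<close> consists of the bilinear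
  forms vanishing as soon as one argument lies in I. Testing \<Delta>(i) on them avoids exhibiting
  representatives.\<close>

lemma coideal_iff:
  assumes I: "module.subspace sH I"
  shows "coideal H I \<longleftrightarrow> (\<forall>i\<in>I. \<epsilon> i = 0) \<and> (\<forall>i\<in>I. \<forall>\<beta>. bil sH sH (*) \<beta> \<longrightarrow>
     (\<forall>i\<in>I. \<forall>h. \<beta> i h = 0 \<and> \<beta> h i = 0) \<longrightarrow> D (*) i \<beta> = 0)"
proof -
  interpret F: vector_space "fscale :: 'k \<Rightarrow> ('h \<times> 'h \<Rightarrow>\<^sub>0 'k) \<Rightarrow> _" by (rule vs_fscale)
  let ?G = "(gen :: 'h \<times> 'h \<Rightarrow> 'h \<times> 'h \<Rightarrow>\<^sub>0 'k) ` (I \<times> UNIV \<union> UNIV \<times> I)"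
  let ?T = "tcls (hspace H) (hspace H)" and ?R = "bilin_rels (hspace H) (hspace H)"
  have "comult H i \<in> ?T ` F.span ?G \<longleftrightarrow> (\<forall>\<beta>. bil sH sH (*) \<beta> \<longrightarrow>
     (\<forall>i\<in>I. \<forall>h. \<beta> i h = 0 \<and> \<beta> h i = 0) \<longrightarrow> D (*) i \<beta> = 0)" (is "?L \<longleftrightarrow> ?P") for i
  proof
    assume ?L
    then obtain x where x: "comult H i = ?T x" "x \<in> F.span ?G" by blast
    show ?P
    proof safe
      fix \<beta> assume b: "bil sH sH (*) \<beta>" and z: "\<forall>i\<in>I. \<forall>h. \<beta> i h = 0 \<and> \<beta> h i = 0"
      have "form \<beta> x = 0"
        by (rule lin_span_zero[OF vs_fscale lin_ext_lin[OF vs_field] vs_field _ x(2)]) (use z in \<open>auto simp: lin_ext_gen[OF vs_field]\<close>)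
      then show "D (*) i \<beta> = 0" by (simp add: x sw_tcls[OF vs_field b])
    qed
  next
    assume P: ?P
    let ?x = "rep (comult H i)"
    \<comment> \<open>A functional killing both sets is a bilinear form, by the relations, and
      vanishes if one argument is in I; so P applies to it.\<close>
    have "?x \<in> F.span (?G \<union> ?R)"
      unfolding span_iff_functionals[OF vs_fscale]
    proof safe
      fix u :: "_ \<Rightarrow> 'k" assume u: "lin fscale (*) u" "\<forall>y\<in>?G \<union> ?R. u y = 0"
      have "bil sH sH (*) (\<lambda>x y. u (gen (x, y)))"
        by (rule bil_gen[OF u(1)]) (use u(2) in blast)
      with P u(2) have "D (*) i (\<lambda>x y. u (gen (x, y))) = 0" by fastforce
      moreover have "u ?x = D (*) i (\<lambda>x y. u (gen (x, y)))"
        using lin_lin_ext[OF u(1), of gen ?x] by (simp add: lin_ext_gen_id sw_def case_prod_unfold)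
      ultimately show "u ?x = 0" by simp
    qed
    then obtain w r where wr: "?x = w + r" "w \<in> F.span ?G" "r \<in> F.span ?R"
      unfolding F.span_Un by blast
    then have "?T ?x = ?T w"
      unfolding tcls_def tensor_rels_def coset_eq_iff[OF vs_fscale] by simp
    moreover have "comult H i = ?T ?x"
    proof -
      obtain x where x: "comult H i = ?T x"
        using alg_map carrier_tensor_type_space[of "comult H i" "hscale H" "hscale H"]
        by (auto simp: algebra_map_into_tensor_def klinear_def type_space_def)
      show ?thesis unfolding x by (rule tcls_rep[symmetric])
    qed
    ultimately show ?L using wr(2) by auto
  qed
  then show ?thesis unfolding coideal_def using I by auto
qed

lemma right_ideal_span:
  "right_ideal H (module.span sH {v * h | v h. v \<in> V})"
proof -
  interpret vector_space sH by (rule vs_H)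
  let ?J = "span {v * h | v h. v \<in> V}"
  have "i * g \<in> ?J" if "i \<in> ?J" for i g
  proof -
    have "lin sH sH (\<lambda>i. i * g)" by (intro lin_intros)
    then have "subspace {i. i * g \<in> ?J}"
      unfolding subspace_def using span_zero span_add span_scale
      by (simp add: lin_zero[of sH sH "\<lambda>i. i * g"] lin_add[of sH sH "\<lambda>i. i * g"] lin_scale[of sH sH "\<lambda>i. i * g"])
    moreover have "{v * h | v h. v \<in> V} \<subseteq> {i. i * g \<in> ?J}"
      by (force intro: span_base simp: mult.assoc)
    ultimately show ?thesis using that span_minimal by blast
  qed
  then show ?thesis by (auto simp: right_ideal_def)
qed

text \<open>By multiplicativity of \<Delta>, freezing h turns a test form for \<open>v h\<close>
  into a test form for v, which vanishes on V since all products \<open>v h\<close> lie in the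
  span.\<close>

lemma coideal_span:
  assumes e: "\<And>v. v \<in> V \<Longrightarrow> \<epsilon> v = 0"
    and V: "\<And>v \<beta>. v \<in> V \<Longrightarrow> bil sH sH (*) \<beta> \<Longrightarrow> (\<And>v h. v \<in> V \<Longrightarrow> \<beta> v h = 0) \<Longrightarrow>
       (\<And>v h. v \<in> V \<Longrightarrow> \<beta> h v = 0) \<Longrightarrow> D (*) v \<beta> = 0"
  shows "coideal H (module.span sH {v * h | v h. v \<in> V})"
proof -
  interpret vector_space sH by (rule vs_H)
  let ?J = "span {v * h | v h. v \<in> V}"
  have "\<epsilon> i = 0" if "i \<in> ?J" for i
    by (rule lin_span_zero[OF vs_H lin_counit vs_field _ that]) (auto simp: counit_mult e)
  moreover have "D (*) i \<beta> = 0" if i: "i \<in> ?J" and b: "bil sH sH (*) \<beta>" and z: "\<forall>i\<in>?J. \<forall>h. \<beta> i h = 0 \<and> \<beta> h i = 0" for i \<beta>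
  proof (rule lin_span_zero[OF vs_H _ vs_field _ i])
    note [lin_intros] = lin_comp[OF bilD1[OF b]] lin_comp[OF bilD2[OF b]]
    show "lin sH (*) (\<lambda>i. D (*) i \<beta>)" by (intro lin_intros)
    fix y assume "y \<in> {v * h | v h. v \<in> V}"
    then obtain v h where y: "y = v * h" and v: "v \<in> V" by blast
    have "D (*) y \<beta> = D (*) v (\<lambda>v1 v2. D (*) h (\<lambda>h1 h2. \<beta> (v1 * h1) (v2 * h2)))"
      unfolding y by (rule D_mult) (intro lin_intros)+
    also have "\<dots> = 0"
    proof (rule V[OF v])
      show "bil sH sH (*) (\<lambda>v1 v2. D (*) h (\<lambda>h1 h2. \<beta> (v1 * h1) (v2 * h2)))"
        by (rule bilI; intro lin_intros)
      fix v x assume "v \<in> V"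
      then have "v * h \<in> ?J" for h by (blast intro: span_base)
      then show "D (*) h (\<lambda>h1 h2. \<beta> (v * h1) (x * h2)) = 0" "D (*) h (\<lambda>h1 h2. \<beta> (x * h1) (v * h2)) = 0"
        using z by (auto simp: sw_zero[OF vs_field])
    qed
    finally show "D (*) y \<beta> = 0" .
  qed
  ultimately show ?thesis by (subst coideal_iff) auto
qed

end

lemma (in comod) coideal_aug_ideal: "coideal H (aug_ideal X)" and right_ideal_aug_ideal: "right_ideal H (aug_ideal X)"
  unfolding aug_ideal_def by (rule coideal_span counit_aug D_aug right_ideal_span; assumption?)+

lemma (in comod) aug_ideal_subset_iff:
  assumes "right_ideal H I" shows "aug_ideal X \<subseteq> I \<longleftrightarrow> X \<subseteq> coinv I"
proof -
  interpret vector_space sH by (rule vs_H)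
  have "aug_ideal X \<subseteq> I" if "aug X \<subseteq> I"
    unfolding aug_ideal_def by (rule span_minimal) (use that assms in \<open>auto simp: right_ideal_def\<close>)
  moreover have "aug X \<subseteq> aug_ideal X"
    unfolding aug_ideal_def by (force intro: span_base exI[of _ 1])
  ultimately show ?thesis unfolding aug_subset_iff[symmetric] by blast
qed

text \<open>The coactions of a and b are replaced in turn by \<open>a \<otimes> 1\<close> and
  \<open>b \<otimes> 1\<close>. The first replacement takes place under right multiplication by
  \<open>b_1\<close>, which is why I has to be a right ideal.\<close>

lemma (in comod) coinv_form_mult:
  assumes "right_ideal H I" "a \<in> coinv I" "b \<in> coinv I"
  shows "a * b \<in> coinv I"
  unfolding coinv_def
proof safe
  interpret vector_space sH by (rule vs_H)
  fix f assume f: "lin sA (*) f"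
  note [lin_intros] = lin_comp[OF f]
  have I: "span I = I" using assms(1) by (simp add: right_ideal_def)
  have "slice f (a * b) - sH (f (a * b)) 1 \<in> span I"
    unfolding span_iff_functionals[OF vs_H]
  proof safe
    fix u :: "'h \<Rightarrow> 'k" assume u: "lin sH (*) u" "\<forall>y\<in>I. u y = 0"
    note [lin_intros] = lin_comp[OF u(1)]
    have "u (slice f (a * b)) = C (*) a (\<lambda>a0 a1. C (*) b (\<lambda>b0 b1. f (a0 * b0) * u (a1 * b1)))"
      unfolding lin_form_slice[OF u(1)] by (rule C_mult) (intro lin_intros)+
    also have "\<dots> = C (*) b (\<lambda>b0 b1. f (a * b0) * u (1 * b1))"
      by (rule coinv_eval[OF _ _ _ assms(2)])
         (use assms(1) u(2) in \<open>auto simp: lin_intros right_ideal_def sw_zero[OF vs_field]\<close>)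
    also have "\<dots> = f (a * b) * u (1 * 1)"
      by (rule coinv_eval[OF _ _ _ assms(3)]) (use u(2) in \<open>auto simp: lin_intros\<close>)
    finally show "u (slice f (a * b) - sH (f (a * b)) 1) = 0"
      by (simp add: lin_diff[OF u(1)] lin_scale[OF u(1)])
  qed
  then show "slice f (a * b) - sH (f (a * b)) 1 \<in> I" unfolding I .
qed

lemma (in comod) coinv_sub_alg:
  assumes I: "right_ideal H I"
  shows "coinv I \<in> sub_alg H A"
proof -
  interpret vector_space sH by (rule vs_H)
  interpret A: vector_space sA by (rule vs_A)
  have s: "subspace I" using I by (simp add: right_ideal_def)
  have "A.subspace (coinv I)"
    unfolding A.subspace_def
  proof (intro conjI ballI allI)
    show "0 \<in> coinv I"
      using subspace_0[OF s] by (auto simp: coinv_def lin_zero[OF lin_slice] lin_zero)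
    fix a b c assume a: "a \<in> coinv I"
    show "sA c a \<in> coinv I" unfolding coinv_def
    proof safe
      fix f assume f: "lin sA (*) f"
      have "slice f (sA c a) - sH (f (sA c a)) 1 = sH c (slice f a - sH (f a) 1)"
        by (simp add: lin_scale[OF lin_slice[OF f]] lin_scale[OF f] scale_right_diff_distrib)
      also have "\<dots> \<in> I" using a f s by (auto simp: coinv_def intro: subspace_scale)
      finally show "slice f (sA c a) - sH (f (sA c a)) 1 \<in> I" .
    qed
    assume b: "b \<in> coinv I"
    show "a + b \<in> coinv I" unfolding coinv_def
    proof safe
      fix f assume f: "lin sA (*) f"
      have "slice f (a + b) - sH (f (a + b)) 1 = (slice f a - sH (f a) 1) + (slice f b - sH (f b) 1)"
        by (simp add: lin_add[OF lin_slice[OF f]] lin_add[OF f] scale_left_distrib)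
      also have "\<dots> \<in> I" using a b f s by (auto simp: coinv_def intro: subspace_add)
      finally show "slice f (a + b) - sH (f (a + b)) 1 \<in> I" .
    qed
  qed
  moreover have "1 \<in> coinv I"
  proof -
    have "slice f 1 = sH (f 1) 1" if f: "lin sA (*) f" for f
      unfolding slice_def by (rule C_one) (intro lin_intros f lin_comp[OF f])+
    then show ?thesis using subspace_0[OF s] by (auto simp: coinv_def)
  qed
  moreover have "coinvariants H A \<subseteq> coinv I"
  proof
    fix a assume a: "a \<in> coinvariants H A"
    have "slice f a = sH (f a) 1" if f: "lin sA (*) f" for f
    proof -
      have "bil sA sH sH (\<lambda>b h. sH (f b) h)" by (rule bilI; intro lin_intros f)
      then show ?thesis using a by (simp add: slice_def coinvariants_def sw_tcls vs_H)
    qed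
    then show "a \<in> coinv I" using subspace_0[OF s] by (auto simp: coinv_def)
  qed
  ultimately show ?thesis using coinv_form_mult[OF I] by (auto simp: sub_alg_def)
qed

section \<open>Quotient spaces and balanced forms\<close>

lemma coset_eq_iff_functionals:
  assumes "vector_space s"
  shows "x +o module.span s S = y +o module.span s S \<longleftrightarrow>
    (\<forall>u :: _ \<Rightarrow> 'k::field. lin s (*) u \<and> (\<forall>z\<in>S. u z = 0) \<longrightarrow> u x = u y)"
  unfolding coset_eq_iff[OF assms] span_iff_functionals[OF assms]
proof (intro iff_allI imp_cong refl)
  fix u :: "_ \<Rightarrow> 'k" assume u: "lin s (*) u \<and> (\<forall>z\<in>S. u z = 0)"
  then have "u (x - y) = u x - u y" by (intro lin_diff) blast
  then show "u (x - y) = 0 \<longleftrightarrow> u x = u y" by simp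
qed

lemma tcls_eq_iff:
  "tcls V W x = tcls V W y \<longleftrightarrow>
    (\<forall>u :: _ \<Rightarrow> 'k::field. lin fscale (*) u \<and> (\<forall>z\<in>bilin_rels V W. u z = 0) \<longrightarrow> u x = u y)"
  unfolding tcls_def tensor_rels_def by (rule coset_eq_iff_functionals[OF vs_fscale])

lemma form_of_functional: "lin fscale (*) u \<Longrightarrow> lin_ext (*) (\<lambda>(a, b). u (gen (a, b))) x = u x"
  using lin_lin_ext[of fscale "(*)" u gen x] by (simp add: lin_ext_gen_id case_prod_unfold)

definition balanced :: "'a::semigroup_mult set \<Rightarrow> ('a \<Rightarrow> 'a \<Rightarrow> 'w) \<Rightarrow> bool" where
  "balanced X \<mu> \<longleftrightarrow> (\<forall>a b. \<forall>c\<in>X. \<mu> (a * c) b = \<mu> a (c * b))"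

definition tcls_over :: "('k::field \<Rightarrow> 'a \<Rightarrow> 'a) \<Rightarrow> 'a::{ring, monoid_mult} set \<Rightarrow> ('a \<times> 'a \<Rightarrow>\<^sub>0 'k) \<Rightarrow> ('a \<times> 'a \<Rightarrow>\<^sub>0 'k) set" where
  "tcls_over s X x = x +o module.span fscale (bilin_rels (type_space s) (type_space s) \<union>
     {gen (a * c, b) - gen (a, c * b) | a b c. c \<in> X})"

lemma carrier_tensor_over: "carrier (tensor_over s X) = range (tcls_over s X)"
  by (simp add: tensor_over_def quot_def tcls_over_def)

lemma tcls_over_rep: "tcls_over s X (rep (tcls_over s X x)) = tcls_over s X x"
  unfolding tcls_over_def coset_eq_iff[OF vs_fscale] by (rule rep_coset[OF vs_fscale])

text \<open>Universal property of the tensor product over a subalgebra: its functionals are the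
  balanced bilinear forms.\<close>

lemma tcls_over_eq_iff:
  fixes s :: "'k::field \<Rightarrow> 'a::{ring, monoid_mult} \<Rightarrow> 'a"
  shows "tcls_over s X x = tcls_over s X y \<longleftrightarrow>
    (\<forall>\<mu>. bil s s (*) \<mu> \<and> balanced X \<mu> \<longrightarrow>
       form \<mu> x = form \<mu> y)" (is "?L \<longleftrightarrow> ?R")
proof -
  let ?B = "{gen (a * c, b) - gen (a, c * b) | a b c. c \<in> X} :: (_ \<Rightarrow>\<^sub>0 'k) set"
  let ?S = "bilin_rels (type_space s) (type_space s) \<union> ?B"
  have L: "?L \<longleftrightarrow> (\<forall>u :: _ \<Rightarrow> 'k. lin fscale (*) u \<and> (\<forall>z\<in>?S. u z = 0) \<longrightarrow> u x = u y)"
    unfolding tcls_over_def by (rule coset_eq_iff_functionals[OF vs_fscale])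
  show ?thesis
  proof
    assume l: ?L
    show ?R
    proof safe
      fix \<mu> assume m: "bil s s (*) \<mu>" "balanced X \<mu>"
      let ?u = "form \<mu>"
      have u: "lin fscale (*) ?u" by (rule lin_ext_lin[OF vs_field])
      have "?u z = 0" if "z \<in> bilin_rels (type_space s) (type_space s)" for z
        by (rule bil_rels_zero[OF vs_field m(1)])
           (use that module.span_base[OF module_iff_vector_space[THEN iffD2, OF vs_fscale]] in blast)
      moreover have "?u z = 0" if "z \<in> ?B" for z
        using that m(2) by (auto simp: lin_diff[OF u] lin_ext_gen[OF vs_field] balanced_def)
      ultimately show "?u x = ?u y" using l[unfolded L] u by blast
    qed
  next
    assume r: ?R
    show ?L unfolding L
    proof safe
      fix u :: "_ \<Rightarrow> 'k" assume u: "lin fscale (*) u" and z: "\<forall>z\<in>?S. u z = 0"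
      have "bil s s (*) (\<lambda>a b. u (gen (a, b)))" by (rule bil_gen[OF u]) (use z in blast)
      moreover have "balanced X (\<lambda>a b. u (gen (a, b)))"
        unfolding balanced_def
      proof (intro allI ballI)
        fix a b c assume "c \<in> X"
        then have "gen (a * c, b) - gen (a, c * b) \<in> ?S" by blast
        with z have "u (gen (a * c, b) - gen (a, c * b)) = 0" by blast
        then show "u (gen (a * c, b)) = u (gen (a, c * b))" by (simp add: lin_diff[OF u])
      qed
      ultimately show "u x = u y" using r by (auto simp: form_of_functional[OF u])
    qed
  qed
qed

section \<open>Cosets in H/I and forms on the tensor product of A with H/I\<close>

context hopf
begin

lemma subspace_coset_eq_iff:
  assumes I: "module.subspace sH I" shows "x +o I = y +o I \<longleftrightarrow> x - y \<in> I"
proof -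
  interpret vector_space sH by (rule vs_H)
  have sI: "span I = I" using I by simp
  show ?thesis using coset_eq_iff[OF vs_H, of x I y] unfolding sI .
qed

lemma mem_coset: "h \<in> v +o I \<longleftrightarrow> h - (v :: 'h) \<in> I"
proof
  assume "h - v \<in> I"
  then show "h \<in> v +o I" unfolding elt_set_plus_def by (intro CollectI bexI[of _ "h - v"]) simp_all
qed (auto simp: elt_set_plus_def)

lemma carrier_quotient_by: "carrier (quotient_by H I) = range (\<lambda>h. h +o I)"
  by (simp add: quotient_by_def quot_def)

lemma proj_quotient_by:
  assumes I: "module.subspace sH I" shows "proj (quotient_by H I) h = h +o I"
  unfolding proj_def carrier_quotient_by
proof (rule the_equality)
  interpret vector_space sH by (rule vs_H)
  have "h \<in> h +o I" unfolding mem_coset using subspace_0[OF I] by simp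
  then show "h +o I \<in> range (\<lambda>h. h +o I) \<and> h \<in> h +o I" by blast
  fix Y assume "Y \<in> range (\<lambda>h. h +o I) \<and> h \<in> Y"
  then obtain v where v: "Y = v +o I" "h \<in> Y" by blast
  have "h - v \<in> I" using v(2) unfolding v(1) mem_coset .
  then show "Y = h +o I" unfolding v(1) subspace_coset_eq_iff[OF I, symmetric] by (rule sym)
qed

text \<open>The quotient remembers its ideal as the coset of 0, so statements about
  \<open>quot_gen H\<close> transfer to ideals.\<close>

lemma quotient_by_inject:
  assumes "module.subspace sH I" "module.subspace sH I'" "quotient_by H I = quotient_by H I'"
  shows "I = I'"
proof -
  have "0 +o I = 0 +o I'"
    unfolding proj_quotient_by[OF assms(1), symmetric] proj_quotient_by[OF assms(2), symmetric] assms(3) ..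
  then show ?thesis by (simp only: set_zero_plus)
qed

end

context comod
begin

abbreviation "push I x \<equiv> lin_ext fscale (\<lambda>(b, h). gen (b, proj (quotient_by H I) h)) x"

text \<open>Bilinear forms on A and H/I correspond to bilinear forms on A and H that vanish when the
  second argument is in I.\<close>

lemma tcls_push_eq_iff:
  assumes I: "module.subspace sH I"
  shows "tcls (aspace A) (quotient_by H I) (push I x) = tcls (aspace A) (quotient_by H I) (push I y) \<longleftrightarrow>
    (\<forall>\<beta>. bil sA sH (*) \<beta> \<and> (\<forall>a. \<forall>i\<in>I. \<beta> a i = 0) \<longrightarrow>
       form \<beta> x = form \<beta> y)" (is "?L \<longleftrightarrow> ?R")
proof
  interpret vector_space sH by (rule vs_H)
  have sI: "span I = I" using I by simp
  note plus = coset_plus[OF vs_H, of _ I, unfolded sI] and scale = coset_scale[OF vs_H, of _ _ I, unfolded sI]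
  let ?Q = "quotient_by H I"
  assume l: ?L
  show ?R
  proof safe
    fix \<beta> assume b: "bil sA sH (*) \<beta>" and z: "\<forall>a. \<forall>i\<in>I. \<beta> a i = 0"
    \<comment> \<open>The form induced on cosets; \<open>r\<close> shows that the chosen
      representative does not matter.\<close>
    let ?u = "lin_ext (*) (\<lambda>(a, X). \<beta> a (rep X))"
    have r: "\<beta> a (rep (h +o I)) = \<beta> a h" for a h
    proof -
      have "\<beta> a (rep (h +o I) - h) = 0" using z rep_coset[OF vs_H, of h I] unfolding sI by blast
      then show ?thesis by (simp add: lin_diff[OF bilD2[OF b]])
    qed
    have u: "lin fscale (*) ?u" by (rule lin_ext_lin[OF vs_field])
    have "?u w = 0" if "w \<in> bilin_rels (aspace A) ?Q" for w
      using that unfolding bilin_rels_def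
    proof (elim UnE UN_E)
      fix X assume "w \<in> lin_rels (aspace A) (\<lambda>v. gen (v, X))"
      then show "?u w = 0"
        by (rule lin_rels_zero[OF u, rotated]) (simp add: lin_ext_gen[OF vs_field] bilD1[OF b])
    next
      fix v assume "w \<in> lin_rels ?Q (\<lambda>X. gen (v, X))"
      then consider h h' where "w = gen (v, vadd ?Q (h +o I) (h' +o I)) - gen (v, h +o I) - gen (v, h' +o I)"
        | c h where "w = gen (v, vscale ?Q c (h +o I)) - fscale c (gen (v, h +o I))"
        unfolding lin_rels_def carrier_quotient_by by blast
      then show "?u w = 0"
      proof cases
        case 1
        have "vadd ?Q (h +o I) (h' +o I) = (h + h') +o I" by (simp add: quotient_by_def quot_def plus)
        then show ?thesis
          unfolding 1 by (simp add: lin_diff[OF u] lin_ext_gen[OF vs_field] r lin_add[OF bilD2[OF b]])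
      next
        case 2
        have "vscale ?Q c (h +o I) = sH c h +o I" by (simp add: quotient_by_def quot_def scale)
        then show ?thesis
          unfolding 2 by (simp add: lin_diff[OF u] lin_scale[OF u] lin_ext_gen[OF vs_field] r lin_scale[OF bilD2[OF b]])
      qed
    qed
    with l u have "?u (push I x) = ?u (push I y)" unfolding tcls_eq_iff by blast
    then show "form \<beta> x = form \<beta> y"
      by (simp add: lin_ext_lin_ext[OF vs_field] case_prod_unfold lin_ext_gen[OF vs_field] proj_quotient_by[OF I] r)
  qed
next
  interpret vector_space sH by (rule vs_H)
  have sI: "span I = I" using I by simp
  note plus = coset_plus[OF vs_H, of _ I, unfolded sI] and scale = coset_scale[OF vs_H, of _ _ I, unfolded sI]
  let ?Q = "quotient_by H I"
  assume r: ?R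
  show ?L unfolding tcls_eq_iff
  proof safe
    fix u :: "_ \<Rightarrow> 'k" assume u: "lin fscale (*) u" and z: "\<forall>w\<in>bilin_rels (aspace A) ?Q. u w = 0"
    define \<beta> where "\<beta> a h = u (gen (a, h +o I))" for a h
    have 1: "u (gen (v + v', h +o I) - gen (v, h +o I) - gen (v', h +o I)) = 0"
        "u (gen (sA c v, h +o I) - fscale c (gen (v, h +o I))) = 0" for v v' c h
      by (rule z[rule_format]; force simp: bilin_rels_def lin_rels_def type_space_def carrier_quotient_by)+
    have lr: "lin_rels ?Q (\<lambda>X. gen (a, X)) \<subseteq> bilin_rels (aspace A) ?Q" for a
      by (auto simp: bilin_rels_def type_space_def)
    have 2: "u (gen (a, (h + h') +o I) - gen (a, h +o I) - gen (a, h' +o I)) = 0" for a h h'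
    proof (intro z[rule_format] subsetD[OF lr])
      have *: "(h + h') +o I = vadd ?Q (h +o I) (h' +o I)" by (simp add: quotient_by_def quot_def plus)
      show "gen (a, (h + h') +o I) - gen (a, h +o I) - gen (a, h' +o I) \<in> lin_rels ?Q (\<lambda>X. gen (a, X))"
        unfolding lin_rels_def carrier_quotient_by * by blast
    qed
    have 3: "u (gen (a, sH c h +o I) - fscale c (gen (a, h +o I))) = 0" for a h c
    proof (intro z[rule_format] subsetD[OF lr])
      have *: "sH c h +o I = vscale ?Q c (h +o I)" by (simp add: quotient_by_def quot_def scale)
      show "gen (a, sH c h +o I) - fscale c (gen (a, h +o I)) \<in> lin_rels ?Q (\<lambda>X. gen (a, X))"
        unfolding lin_rels_def carrier_quotient_by * by blast
    qed
    have b: "bil sA sH (*) \<beta>"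
      using 1 2 3 unfolding \<beta>_def
      by (intro bilI) (simp_all add: lin_def lin_diff[OF u] lin_add[OF u] lin_scale[OF u] algebra_simps)
    have "\<beta> a i = 0" if "i \<in> I" for a i
    proof -
      have "i +o I = 0 +o I" using subspace_coset_eq_iff[OF I, of i 0] that by simp
      then have "\<beta> a i = \<beta> a 0" by (simp add: \<beta>_def)
      then show ?thesis by (simp add: lin_zero[OF bilD2[OF b]])
    qed
    with r b have "form \<beta> x = form \<beta> y" by blast
    then show "u (push I x) = u (push I y)"
      by (simp add: lin_lin_ext[OF u] case_prod_unfold \<beta>_def proj_quotient_by[OF I])
  qed
qed

text \<open>For elements of \<open>coinv I\<close> every form vanishing on I sees \<delta>(a) as
  \<open>a \<otimes> 1\<close>, by \<open>coinv_eval\<close>; conversely the product forms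
  \<open>f b * u h\<close>, with u vanishing on I, already detect membership.\<close>

lemma coinvariants_quot_eq:
  assumes I: "module.subspace sH I"
  shows "coinvariants_quot A (quotient_by H I) = coinv I"
proof -
  interpret vector_space sH by (rule vs_H)
  have sI: "span I = I" using I by simp
  have "gen (a, proj (quotient_by H I) 1) = push I (gen (a, 1) :: 'a \<times> 'h \<Rightarrow>\<^sub>0 'k)" for a
    by (simp add: lin_ext_gen[OF vs_fscale])
  then have "a \<in> coinvariants_quot A (quotient_by H I) \<longleftrightarrow>
     (\<forall>\<beta>. bil sA sH (*) \<beta> \<and> (\<forall>a. \<forall>i\<in>I. \<beta> a i = 0) \<longrightarrow> C (*) a \<beta> = \<beta> a 1)" for a
    using tcls_push_eq_iff[OF I, of "rep (coact A a)" "gen (a, 1)"]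
    by (simp add: coinvariants_quot_def sw_def lin_ext_gen[OF vs_field])
  moreover have "a \<in> coinv I \<longleftrightarrow>
     (\<forall>\<beta>. bil sA sH (*) \<beta> \<and> (\<forall>a. \<forall>i\<in>I. \<beta> a i = 0) \<longrightarrow> C (*) a \<beta> = \<beta> a 1)" (is "_ \<longleftrightarrow> ?P") for a
  proof
    assume "a \<in> coinv I"
    then show ?P by (auto intro!: coinv_eval[of "(*)" _ a I] simp: vs_field bil_def)
  next
    assume P: ?P
    show "a \<in> coinv I" unfolding coinv_def
    proof safe
      fix f assume f: "lin sA (*) f"
      have "slice f a - sH (f a) 1 \<in> span I"
        unfolding span_iff_functionals[OF vs_H]
      proof safe
        fix u :: "'h \<Rightarrow> 'k" assume u: "lin sH (*) u" "\<forall>y\<in>I. u y = 0"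
        have "bil sA sH (*) (\<lambda>b h. f b * u h)" by (rule bilI; intro lin_intros f u)
        then have "C (*) a (\<lambda>b h. f b * u h) = f a * u 1" using P u(2) by auto
        then show "u (slice f a - sH (f a) 1) = 0"
          by (simp add: lin_diff[OF u(1)] lin_scale[OF u(1)] lin_form_slice[OF u(1)])
      qed
      then show "slice f a - sH (f a) 1 \<in> I" unfolding sI .
    qed
  qed
  ultimately show ?thesis by blast
qed

text \<open>By coassociativity, slicing a slice by g is slicing once by
  \<open>f' b = f(b_0) g(b_1)\<close>. In effect \<delta> maps \<open>coinv I\<close> into
  \<open>A \<otimes> K\<close> with \<open>K = self.coinv I\<close>.\<close>

lemma slice_mem_self_coinv:
  assumes a: "a \<in> coinv I" and f: "lin sA (*) f"
  shows "slice f a \<in> self.coinv I"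
  unfolding self.coinv_def
proof safe
  fix g :: "'h \<Rightarrow> 'k" assume g: "lin sH (*) g"
  note [lin_intros] = lin_comp[OF f] lin_comp[OF g]
  define f' where "f' b = C (*) b (\<lambda>b0 b1. f b0 * g b1)" for b
  have f': "lin sA (*) f'" unfolding f'_def by (intro lin_intros)
  have l: "lin sH sH (self.slice g)" by (rule self.lin_slice[OF g])
  have "self.slice g (slice f a) = C sH a (\<lambda>b h. D sH h (\<lambda>u v. sH (f b * g u) v))"
  proof -
    interpret vector_space sH by (rule vs_H)
    show ?thesis unfolding slice_def lin_sw[OF l] lin_scale[OF l]
      by (simp add: self.slice_def lin_sw[OF lin_scale_right[OF vs_H lin_id]])
  qed
  also have "\<dots> = C sH a (\<lambda>b h. C sH b (\<lambda>u v. sH (f u * g v) h))"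
    by (simp add: C_coassoc lin_intros)
  also have "\<dots> = slice f' a"
    unfolding slice_def f'_def lin_sw[of "(*)" sH "\<lambda>c. sH c h" for h, OF lin_scale_left[OF vs_H lin_id]] ..
  finally have "self.slice g (slice f a) = slice f' a" .
  moreover have "g (slice f a) = f' a" unfolding f'_def by (rule lin_form_slice[OF g])
  ultimately show "self.slice g (slice f a) - sH (g (slice f a)) 1 \<in> I"
    using a f' by (simp add: coinv_def)
qed

end

definition (in hopf) coinv_ideal :: "'h set \<Rightarrow> 'h set" where
  "coinv_ideal I = module.span sH {(k - sH (\<epsilon> k) 1) * h | k h. k \<in> self.coinv I}"

text \<open>A slice k of a coinvariant lies in \<open>self.coinv I\<close>, and
  \<open>\<epsilon> k\<close> is exactly the scalar subtracted in \<open>aug\<close>.\<close>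

lemma (in comod) aug_ideal_coinv_subset: "aug_ideal (coinv I) \<subseteq> coinv_ideal I"
proof -
  interpret vector_space sH by (rule vs_H)
  have "v \<in> {k - sH (\<epsilon> k) 1 | k. k \<in> self.coinv I}" if v: "v \<in> aug (coinv I)" for v
  proof -
    obtain f c where v: "v = slice f c - sH (f c) 1" and f: "lin sA (*) f" and c: "c \<in> coinv I"
      using v by (auto simp: aug_def)
    show ?thesis unfolding v counit_slice[OF f, of c, symmetric]
      using slice_mem_self_coinv[OF c f] by blast
  qed
  then show ?thesis unfolding aug_ideal_def coinv_ideal_def by (intro span_mono) fastforce
qed

section \<open>The canonical map of a cleft extension\<close>

context comod
begin

text \<open>The canonical map to \<open>A \<otimes> H\<close> on representatives, before anything is
  divided out; the canonical maps for all quotients H/I factor through it.\<close>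

definition can :: "('a \<times> 'a \<Rightarrow>\<^sub>0 'k) \<Rightarrow> ('a \<times> 'h \<Rightarrow>\<^sub>0 'k)" where
  "can x = lin_ext fscale (\<lambda>(a, b). lin_ext fscale (\<lambda>(b0, b1). gen (a * b0, b1)) (rep (coact A b))) x"

lemma canonical_map_eq: "canonical_map A (quotient_by H I) X = tcls (aspace A) (quotient_by H I) (push I (can (rep X)))"
proof -
  have "lin_ext fscale (\<lambda>(a, b). lin_ext fscale (\<lambda>(b0, b1). gen (a * b0, proj (quotient_by H I) b1)) (rep (coact A b))) (rep X) =
     push I (can (rep X))"
    unfolding can_def by (simp add: lin_ext_lin_ext[OF vs_fscale] case_prod_unfold lin_ext_gen[OF vs_fscale])
  then show ?thesis by (simp add: canonical_map_def)
qed

lemma form_can: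
  "form \<beta> (can x) = lin_ext (*) (\<lambda>(a, b). C (*) b (\<lambda>b0 b1. \<beta> (a * b0) b1)) x"
  unfolding can_def sw_def by (simp add: lin_ext_lin_ext[OF vs_field] case_prod_unfold lin_ext_gen[OF vs_field])

text \<open>Dual form of the fact that the canonical map is well defined on the tensor product over
  \<open>coinv I\<close>.\<close>

lemma balanced_can_form:
  assumes I: "right_ideal H I" and b: "bil sA sH (*) \<beta>" and z: "\<forall>a. \<forall>i\<in>I. \<beta> a i = 0"
  shows "bil sA sA (*) (\<lambda>a b. C (*) b (\<lambda>b0 b1. \<beta> (a * b0) b1))"
    and "balanced (coinv I) (\<lambda>a b. C (*) b (\<lambda>b0 b1. \<beta> (a * b0) b1))"
proof -
  note [lin_intros] = lin_comp[OF bilD1[OF b]] lin_comp[OF bilD2[OF b]]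
  show "bil sA sA (*) (\<lambda>a b. C (*) b (\<lambda>b0 b1. \<beta> (a * b0) b1))"
    by (rule bilI; intro lin_intros)
  show "balanced (coinv I) (\<lambda>a b. C (*) b (\<lambda>b0 b1. \<beta> (a * b0) b1))"
    unfolding balanced_def
  proof (intro allI ballI)
    fix a b c assume c: "c \<in> coinv I"
    have "C (*) (c * b) (\<lambda>b0 b1. \<beta> (a * b0) b1) =
       C (*) c (\<lambda>c0 c1. C (*) b (\<lambda>b0 b1. \<beta> (a * (c0 * b0)) (c1 * b1)))"
      by (simp add: C_mult lin_intros)
    also have "\<dots> = C (*) b (\<lambda>b0 b1. \<beta> (a * (c * b0)) (1 * b1))"
      by (rule coinv_eval[OF _ _ _ c])
         (use I z in \<open>auto simp: lin_intros right_ideal_def sw_zero[OF vs_field]\<close>)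
    finally show "C (*) b (\<lambda>b0 b1. \<beta> (a * c * b0) b1) = C (*) (c * b) (\<lambda>b0 b1. \<beta> (a * b0) b1)"
      by (simp add: mult.assoc)
  qed
qed

lemma canonical_map_tcls_over:
  assumes I: "right_ideal H I"
  shows "canonical_map A (quotient_by H I) (tcls_over sA (coinv I) x) = tcls (aspace A) (quotient_by H I) (push I (can x))"
proof -
  have s: "module.subspace sH I" using I by (simp add: right_ideal_def)
  show ?thesis
    unfolding canonical_map_eq tcls_push_eq_iff[OF s] form_can
    using tcls_over_rep[of sA "coinv I" x] balanced_can_form[OF I]
    unfolding tcls_over_eq_iff by blast
qed

end

section \<open>The inverse of the canonical map built from a cleaving map\<close>

context cleft
begin

definition kappa :: "'a \<Rightarrow> 'h \<Rightarrow> ('a \<times> 'a \<Rightarrow>\<^sub>0 'k)" where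
  "kappa a h = lin_ext fscale (\<lambda>(x, y). gen (a * \<gamma>' x, \<gamma> y)) (rep (comult H h))"

lemma form_kappa: "form \<mu> (kappa a h) = D (*) h (\<lambda>x y. \<mu> (a * \<gamma>' x) (\<gamma> y))"
  unfolding kappa_def sw_def by (simp add: lin_ext_lin_ext[OF vs_field] case_prod_unfold lin_ext_gen[OF vs_field])

text \<open>\<open>\<gamma>'(h_1) \<gamma>(h_2) \<otimes> h_3\<close> collapses to
  \<open>1 \<otimes> h\<close>. This happens already in \<open>A \<otimes> H\<close>, so it yields
  surjectivity for every quotient of H.\<close>

lemma form_can_kappa:
  assumes b: "bil sA sH (*) \<beta>"
  shows "form \<beta> (can (kappa a h)) = \<beta> a h"
proof -
  note [lin_intros] = lin_gamma_comp lin_comp[OF bilD1[OF b]] lin_comp[OF bilD2[OF b]] bilD1[OF b] bilD2[OF b]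
  have "form \<beta> (can (kappa a h)) =
     D (*) h (\<lambda>x y. D (*) y (\<lambda>u v. \<beta> (a * (\<gamma>' x * \<gamma> u)) v))"
    unfolding form_can form_kappa by (simp add: C_gamma lin_intros mult.assoc)
  also have "\<dots> = D (*) h (\<lambda>x v. D (*) x (\<lambda>x u. \<beta> (a * (\<gamma>' x * \<gamma> u)) v))"
    by (simp add: D_coassoc lin_intros)
  also have "\<dots> = D (*) h (\<lambda>x v. \<epsilon> x * \<beta> a v)"
    by (simp add: D_gamma'_gamma[where g = "\<lambda>z. \<beta> (_ * z) _"] lin_intros)
  also have "\<dots> = \<beta> a h" by (rule D_counit_left[OF bilD2[OF b]])
  finally show ?thesis .
qed

text \<open>The canonical image \<open>1 \<otimes> i\<close> of \<open>kappa 1 i\<close> is zero in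
  \<open>A \<otimes> H/I\<close>, so by injectivity \<open>kappa 1 i\<close> vanishes over
  \<open>coinv I\<close>. As \<open>coinv I \<subseteq> coinv J\<close> for
  \<open>J = aug_ideal (coinv I)\<close>, the canonical map for H/J is defined on the same tensor
  product; hence \<open>1 \<otimes> i\<close> is also zero in \<open>A \<otimes> H/J\<close>, which
  puts i into J.\<close>

lemma ideal_subset_of_inj:
  assumes nz: "(UNIV :: 'a set) \<noteq> {0}" and I: "right_ideal H I"
    and inj: "inj_on (canonical_map A (quotient_by H I)) (range (tcls_over sA (coinv I)))"
  shows "I \<subseteq> aug_ideal (coinv I)"
proof
  interpret vector_space sH by (rule vs_H)
  interpret A: vector_space sA by (rule vs_A)
  have s: "subspace I" using I by (simp add: right_ideal_def)
  fix i assume i: "i \<in> I"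
  \<comment> \<open>Here A being nonzero enters: a functional with \<open>f 1 = 1\<close> strips the
    first factor from \<open>1 \<otimes> i\<close>.\<close>
  have "(1 :: 'a) \<noteq> 0" using nz by (metis UNIV_eq_I insertI1 mult_1 mult_zero_left singletonI)
  then have "(1 :: 'a) \<notin> A.span {}" by simp
  from separating_functional[OF vs_A this]
  obtain f :: "'a \<Rightarrow> 'k" where f: "lin sA (*) f" "f 1 = 1" by metis
  have "canonical_map A (quotient_by H I) (tcls_over sA (coinv I) (kappa 1 i)) =
        canonical_map A (quotient_by H I) (tcls_over sA (coinv I) 0)"
    unfolding canonical_map_tcls_over[OF I] tcls_push_eq_iff[OF s]
  proof (intro allI impI, elim conjE)
    fix \<beta> assume b: "bil sA sH (*) \<beta>" and z: "\<forall>a. \<forall>i\<in>I. \<beta> a i = 0"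
    have "form \<beta> (can 0) = (0::'k)" by (simp add: can_def lin_ext_def)
    then show "form \<beta> (can (kappa 1 i)) = form \<beta> (can 0)"
      unfolding form_can_kappa[OF b] using z i by simp
  qed
  with inj have "tcls_over sA (coinv I) (kappa 1 i) = tcls_over sA (coinv I) 0"
    by (blast dest: inj_onD)
  then have mu: "D (*) i (\<lambda>x y. \<mu> (1 * \<gamma>' x) (\<gamma> y)) = 0" if "bil sA sA (*) \<mu>" "balanced (coinv I) \<mu>" for \<mu>
    unfolding tcls_over_eq_iff form_kappa using that by (auto simp: lin_ext_def)
  have "i \<in> span (aug_ideal (coinv I))"
    unfolding span_iff_functionals[OF vs_H]
  proof (intro allI impI, elim conjE)
    fix g :: "'h \<Rightarrow> 'k" assume g: "lin sH (*) g" and g0: "\<forall>y\<in>aug_ideal (coinv I). g y = 0"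
    note [lin_intros] = lin_gamma_comp lin_comp[OF f(1)] lin_comp[OF g]
    have b: "bil sA sH (*) (\<lambda>a h. f a * g h)" by (rule bilI; intro lin_intros f g)
    have sub: "coinv I \<subseteq> coinv (aug_ideal (coinv I))" using aug_ideal_subset_iff[OF right_ideal_aug_ideal] by blast
    have "balanced (coinv (aug_ideal (coinv I))) (\<lambda>a b. C (*) b (\<lambda>b0 b1. f (a * b0) * g b1))"
      by (rule balanced_can_form(2)[OF right_ideal_aug_ideal b]) (use g0 in auto)
    then have "balanced (coinv I) (\<lambda>a b. C (*) b (\<lambda>b0 b1. f (a * b0) * g b1))"
      using sub unfolding balanced_def by blast
    moreover have "bil sA sA (*) (\<lambda>a b. C (*) b (\<lambda>b0 b1. f (a * b0) * g b1))"
      using balanced_can_form(1)[OF right_ideal_aug_ideal b] g0 by auto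
    ultimately have "D (*) i (\<lambda>x y. C (*) (\<gamma> y) (\<lambda>b0 b1. f (1 * \<gamma>' x * b0) * g b1)) = 0"
      by (rule mu[rotated])
    moreover have "D (*) i (\<lambda>x y. C (*) (\<gamma> y) (\<lambda>b0 b1. f (1 * \<gamma>' x * b0) * g b1)) = f 1 * g i"
      using form_can_kappa[OF b, of 1 i] unfolding form_can form_kappa .
    ultimately show "g i = 0" using f(2) by simp
  qed
  moreover have "subspace (aug_ideal (coinv I))" using right_ideal_aug_ideal by (simp add: right_ideal_def)
  then have "span (aug_ideal (coinv I)) = aug_ideal (coinv I)" by simp
  ultimately show "i \<in> aug_ideal (coinv I)" by simp
qed

text \<open>It splits every b as the sum of \<open>proj_coinv(b_0) \<gamma>(b_1)\<close>, a
  coinvariant times a value of \<gamma>.\<close>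

definition proj_coinv :: "'a \<Rightarrow> 'a" where
  "proj_coinv b = C sA b (\<lambda>z u. z * \<gamma>' u)"

lemma lin_proj_coinv: "lin sA sA proj_coinv"
  unfolding proj_coinv_def[abs_def] by (intro lin_intros lin_gamma_comp)

text \<open>The coaction of \<open>b_0 \<gamma>'(b_1)\<close> is
  \<open>b_0 \<gamma>'(b_3) \<otimes> b_1 S(b_2)\<close>, where the antipode reduces the second
  factor to 1. The element is thus coinvariant over H itself, hence over every H/I.\<close>

lemma proj_coinv_mem:
  assumes I: "module.subspace sH I" shows "proj_coinv b \<in> coinv I"
  unfolding coinv_def
proof safe
  interpret vector_space sH by (rule vs_H)
  fix f assume f: "lin sA (*) f"
  note [lin_intros] = lin_gamma_comp lin_comp[OF f] f
  have "slice f (proj_coinv b) = C sH b (\<lambda>z u. slice f (z * \<gamma>' u))"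
    unfolding proj_coinv_def by (rule lin_sw[OF lin_slice[OF f]])
  also have "\<dots> = C sH b (\<lambda>z u. C sH z (\<lambda>z0 z1. D sH u (\<lambda>u1 u2. sH (f (z0 * \<gamma>' u2)) (z1 * S u1))))"
    unfolding slice_def by (simp add: C_mult C_gamma' lin_intros)
  also have "\<dots> = C sH b (\<lambda>z0 w. D sH w (\<lambda>z1 u. D sH u (\<lambda>u1 u2. sH (f (z0 * \<gamma>' u2)) (z1 * S u1))))"
    by (simp add: C_coassoc lin_intros)
  also have "\<dots> = C sH b (\<lambda>z0 w. D sH w (\<lambda>x u2. D sH x (\<lambda>z1 u1. sH (f (z0 * \<gamma>' u2)) (z1 * S u1))))"
    by (simp add: D_coassoc lin_intros)
  also have "\<dots> = C sH b (\<lambda>z0 w. D sH w (\<lambda>x u2. sH (\<epsilon> x) (sH (f (z0 * \<gamma>' u2)) 1)))"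
    by (simp only: D_antipode_right[where g = "\<lambda>v. sH (f (_ * \<gamma>' _)) v", OF lin_scale_right[OF vs_H lin_id]])
  also have "\<dots> = C sH b (\<lambda>z0 w. sH (f (z0 * \<gamma>' w)) 1)"
    by (simp add: D_counit_left[where t = sH] lin_intros del: scale_scale)
  also have "\<dots> = sH (f (proj_coinv b)) 1"
    unfolding proj_coinv_def lin_sw[OF f]
    by (rule lin_sw[of "(*)" sH "\<lambda>c. sH c 1", OF lin_scale_left[OF vs_H lin_id], symmetric])
  finally show "slice f (proj_coinv b) - sH (f (proj_coinv b)) 1 \<in> I"
    using subspace_0[OF I] by simp
qed

text \<open>Dual form of \<open>\<kappa> \<circ> can\<close> being the identity over
  \<open>coinv I\<close>: the coinvariant \<open>proj_coinv(y_0)\<close> crosses the tensor sign and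
  recombines with \<gamma> to y.\<close>

lemma can_section:
  assumes I: "module.subspace sH I" and m: "bil sA sA (*) \<mu>" and bal: "balanced (coinv I) \<mu>"
  shows "C (*) y (\<lambda>y0 y1. D (*) y1 (\<lambda>u v. \<mu> (x * y0 * \<gamma>' u) (\<gamma> v))) = \<mu> x y"
proof -
  note [lin_intros] = lin_gamma_comp lin_comp[OF bilD1[OF m]] lin_comp[OF bilD2[OF m]] bilD1[OF m] bilD2[OF m]
    lin_comp[OF lin_proj_coinv]
  have "C (*) y (\<lambda>y0 y1. D (*) y1 (\<lambda>u v. \<mu> (x * y0 * \<gamma>' u) (\<gamma> v))) =
    C (*) y (\<lambda>y0 v. C (*) y0 (\<lambda>z u. \<mu> (x * (z * \<gamma>' u)) (\<gamma> v)))"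
    by (simp add: C_coassoc lin_intros mult.assoc)
  also have "\<dots> = C (*) y (\<lambda>y0 v. \<mu> (x * proj_coinv y0) (\<gamma> v))"
    unfolding proj_coinv_def
    by (subst lin_sw[of sA "(*)" "\<lambda>z. \<mu> (x * z) (\<gamma> v)" for v, OF lin_comp[OF bilD1[OF m]]]) (intro lin_intros | rule refl)+
  also have "\<dots> = C (*) y (\<lambda>y0 v. \<mu> x (proj_coinv y0 * \<gamma> v))"
    using bal proj_coinv_mem[OF I] by (simp add: balanced_def)
  also have "\<dots> = C (*) y (\<lambda>y0 v. C (*) y0 (\<lambda>z u. \<mu> x (z * (\<gamma>' u * \<gamma> v))))"
    unfolding proj_coinv_def mult.assoc[symmetric]
    by (subst lin_sw[of sA "(*)" "\<lambda>z. \<mu> x (z * \<gamma> v)" for v, OF lin_comp[OF bilD2[OF m]]]) (intro lin_intros | rule refl)+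
  also have "\<dots> = C (*) y (\<lambda>z w. D (*) w (\<lambda>u v. \<mu> x (z * (\<gamma>' u * \<gamma> v))))"
    by (simp add: C_coassoc lin_intros)
  also have "\<dots> = C (*) y (\<lambda>z w. \<epsilon> w * \<mu> x z)"
    by (simp add: D_gamma'_gamma[where g = "\<lambda>v. \<mu> x (_ * v)"] lin_intros)
  also have "\<dots> = \<mu> x y" by (rule C_counit[OF bilD2[OF m]])
  finally show ?thesis .
qed

lemma gamma_mem_coinv:
  assumes k: "k \<in> self.coinv I" shows "\<gamma> k \<in> coinv I"
  unfolding coinv_def
proof safe
  fix f assume f: "lin sA (*) f"
  have l: "lin sH (*) (\<lambda>x. f (\<gamma> x))" by (rule lin_comp[OF f lin_gamma])
  have "slice f (\<gamma> k) = self.slice (\<lambda>x. f (\<gamma> x)) k"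
    unfolding slice_def self.slice_def by (simp add: C_gamma lin_intros f)
  then show "slice f (\<gamma> k) - sH (f (\<gamma> k)) 1 \<in> I"
    using k[unfolded self.coinv_def] l by simp blast
qed

text \<open>\<open>\<kappa>\<close> inverts the canonical map of \<open>A\<close> over \<open>H\<close>. It descends to \<open>H / I\<close> because
  \<open>a \<otimes> k h\<close> is the image of \<open>a \<gamma>' (h\<^sub>1) \<gamma>' (k\<^sub>1) \<otimes> \<gamma> (k\<^sub>2) \<gamma> (h\<^sub>2)\<close>, and \<open>\<gamma> (k\<^sub>2)\<close> can be moved across the
  balanced tensor product.\<close>

lemma kappa_form_vanishes:
  assumes I: "module.subspace sH I" and m: "bil sA sA (*) \<mu>" and bal: "balanced (coinv I) \<mu>"
    and i: "i \<in> coinv_ideal I"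
  shows "D (*) i (\<lambda>x y. \<mu> (a * \<gamma>' x) (\<gamma> y)) = 0"
proof -
  note [lin_intros] = lin_gamma_comp lin_comp[OF bilD1[OF m]] lin_comp[OF bilD2[OF m]] bilD1[OF m] bilD2[OF m]
  define G where "G a h = D (*) h (\<lambda>x y. \<mu> (a * \<gamma>' x) (\<gamma> y))" for a h
  have G1: "lin sA (*) (\<lambda>a. G a h)" for h unfolding G_def by (intro lin_intros)
  have G2: "lin sH (*) (G a)" for a unfolding G_def by (intro lin_intros)
  note [lin_intros] = lin_gamma_comp lin_comp[OF G1] lin_comp[OF G2] G1 G2
  \<comment> \<open>\<open>G\<close> is \<mu> pulled back along \<kappa>; this recovers \<mu> from G
    evaluated on canonical images.\<close>
  have sec: "C (*) y (\<lambda>y0 y1. G (x * y0) y1) = \<mu> x y" for x y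
    unfolding G_def by (rule can_section[OF I m bal])
  have Gmult: "G a (k * h) = \<epsilon> k * G a h" if k: "k \<in> self.coinv I" for k h
  proof -
    \<comment> \<open>After expanding \<mu> by \<open>sec\<close>,
      \<open>\<gamma>'(k_1) \<gamma>(k_2)\<close> cancels first; this brings
      \<open>\<gamma>'(h_1)\<close> next to \<open>\<gamma>(h_2)\<close>, which cancel in
      turn.\<close>
    have "D (*) h (\<lambda>h1 h2. D (*) k (\<lambda>k1 k2. \<mu> (a * \<gamma>' h1 * \<gamma>' k1) (\<gamma> k2 * \<gamma> h2))) =
      D (*) h (\<lambda>h1 h2. D (*) k (\<lambda>k1 k2. D (*) k2 (\<lambda>k2 k3. D (*) h2 (\<lambda>h2 h3.
        G (a * \<gamma>' h1 * (\<gamma>' k1 * \<gamma> k2) * \<gamma> h2) (k3 * h3)))))"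
      unfolding sec[symmetric] by (simp add: C_mult C_gamma lin_intros mult.assoc)
    also have "\<dots> = D (*) h (\<lambda>h1 h2. D (*) k (\<lambda>x k3. D (*) x (\<lambda>k1 k2. D (*) h2 (\<lambda>h2 h3.
        G (a * \<gamma>' h1 * (\<gamma>' k1 * \<gamma> k2) * \<gamma> h2) (k3 * h3)))))"
      by (simp add: D_coassoc lin_intros)
    also have "\<dots> = D (*) h (\<lambda>h1 h2. D (*) k (\<lambda>x k3. \<epsilon> x * D (*) h2 (\<lambda>h2 h3.
        G (a * \<gamma>' h1 * 1 * \<gamma> h2) (k3 * h3))))"
      by (subst D_gamma'_gamma[where g = "\<lambda>v. D (*) _ (\<lambda>h2 h3. G (a * \<gamma>' _ * v * \<gamma> h2) (_ * h3))"]) (intro lin_intros | rule refl)+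
    also have "\<dots> = D (*) h (\<lambda>h1 h2. D (*) h2 (\<lambda>h2 h3. G (a * (\<gamma>' h1 * \<gamma> h2)) (k * h3)))"
      by (simp add: D_counit_left[where t = "(*)"] lin_intros mult.assoc)
    also have "\<dots> = D (*) h (\<lambda>x h3. D (*) x (\<lambda>h1 h2. G (a * (\<gamma>' h1 * \<gamma> h2)) (k * h3)))"
      by (simp add: D_coassoc lin_intros)
    also have "\<dots> = D (*) h (\<lambda>x h3. \<epsilon> x * G a (k * h3))"
      by (simp add: D_gamma'_gamma[where g = "\<lambda>v. G (a * v) (k * _)"] lin_intros)
    also have "\<dots> = G a (k * h)"
      by (simp add: D_counit_left[where t = "(*)"] lin_intros)
    finally have 1: "D (*) h (\<lambda>h1 h2. D (*) k (\<lambda>k1 k2. \<mu> (a * \<gamma>' h1 * \<gamma>' k1) (\<gamma> k2 * \<gamma> h2))) = G a (k * h)" .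
    have 2: "D (*) k (\<lambda>k1 k2. \<mu> (a * \<gamma>' h1 * \<gamma>' k1) (\<gamma> k2 * \<gamma> h2)) = \<epsilon> k * \<mu> (a * \<gamma>' h1) (\<gamma> h2)" for h1 h2
    proof -
      let ?b = "\<lambda>k1 k2. \<mu> (a * \<gamma>' h1 * \<gamma>' k1) (\<gamma> k2 * \<gamma> h2) - \<mu> (a * \<gamma>' h1 * (\<gamma>' k1 * \<gamma> k2)) (\<gamma> h2)"
      \<comment> \<open>All slices of \<Delta>(k) lie in \<open>self.coinv I\<close>;
        \<open>slices_zero\<close> therefore allows \<open>k_2\<close> to be treated as an element
        of it.\<close>
      have "form ?b (rep (comult H k)) = 0"
      proof (rule slices_zero[OF vs_H vs_H _ vs_field])
        show "bil sH sH (*) ?b" by (rule bilI; intro lin_intros)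
        show "lin_ext sH (\<lambda>(b, h). sH (f b) h) (rep (comult H k)) \<in> self.coinv I" if "lin sH (*) f" for f
          using self.slice_mem_self_coinv[OF k that] by (simp add: self.slice_def sw_def)
        show "?b x v = 0" if "v \<in> self.coinv I" for x v
          using bal gamma_mem_coinv[OF that] by (simp add: balanced_def mult.assoc[symmetric])
      qed
      then have "D (*) k (\<lambda>k1 k2. \<mu> (a * \<gamma>' h1 * \<gamma>' k1) (\<gamma> k2 * \<gamma> h2)) =
         D (*) k (\<lambda>k1 k2. \<mu> (a * \<gamma>' h1 * (\<gamma>' k1 * \<gamma> k2)) (\<gamma> h2))"
        by (simp add: sw_def lin_ext_def case_prod_unfold right_diff_distrib sum_subtractf)
      also have "\<dots> = \<epsilon> k * \<mu> (a * \<gamma>' h1) (\<gamma> h2)"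
        by (simp add: D_gamma'_gamma[where g = "\<lambda>v. \<mu> (_ * v) _"] lin_intros)
      finally show ?thesis .
    qed
    have "G a (k * h) = D (*) h (\<lambda>h1 h2. \<epsilon> k * \<mu> (a * \<gamma>' h1) (\<gamma> h2))"
      using 1 unfolding 2 by (rule sym)
    also have "\<dots> = \<epsilon> k * G a h" unfolding G_def
      by (rule lin_sw[OF lin_mult_right_field[OF lin_id], symmetric])
    finally show ?thesis .
  qed
  have "G a i = 0"
  proof (rule lin_span_zero[OF vs_H G2 vs_field _ i[unfolded coinv_ideal_def]])
    interpret vector_space sH by (rule vs_H)
    fix y assume "y \<in> {(k - sH (\<epsilon> k) 1) * h | k h. k \<in> self.coinv I}"
    then obtain k h where y: "y = (k - sH (\<epsilon> k) 1) * h" and k: "k \<in> self.coinv I" by blast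
    have "y = k * h - sH (\<epsilon> k) h"
      using k_algebra_H by (simp add: y left_diff_distrib k_algebra_def)
    then show "G a y = 0" by (simp add: lin_diff[OF G2] lin_scale[OF G2] Gmult[OF k])
  qed
  then show ?thesis by (simp add: G_def)
qed

text \<open>Injectivity: for balanced \<mu> the form \<open>\<mu> \<circ> \<kappa>\<close> vanishes
  on I, so it is a test form on \<open>A \<otimes> H/I\<close>, and \<open>can_section\<close>
  recovers \<mu> from it. Surjectivity is \<open>form_can_kappa\<close> after lifting cosets to
  H.\<close>

lemma Galois_of_subset:
  assumes I: "right_ideal H I" and sub: "I \<subseteq> coinv_ideal I"
  shows "bij_betw (canonical_map A (quotient_by H I)) (range (tcls_over sA (coinv I)))
     (carrier (tensor (aspace A) (quotient_by H I)))"
  unfolding bij_betw_def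
proof
  have s: "module.subspace sH I" using I by (simp add: right_ideal_def)
  show "inj_on (canonical_map A (quotient_by H I)) (range (tcls_over sA (coinv I)))"
  proof (rule inj_onI, elim imageE, hypsubst)
    fix x y assume eq: "canonical_map A (quotient_by H I) (tcls_over sA (coinv I) x) =
      canonical_map A (quotient_by H I) (tcls_over sA (coinv I) y)"
    show "tcls_over sA (coinv I) x = tcls_over sA (coinv I) y"
      unfolding tcls_over_eq_iff
    proof (intro allI impI, elim conjE)
      fix \<mu> assume m: "bil sA sA (*) \<mu>" and bal: "balanced (coinv I) \<mu>"
      note [lin_intros] = lin_gamma_comp lin_comp[OF bilD1[OF m]] lin_comp[OF bilD2[OF m]]
      let ?\<beta> = "\<lambda>a h. D (*) h (\<lambda>x y. \<mu> (a * \<gamma>' x) (\<gamma> y))"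
      have "bil sA sH (*) ?\<beta>" by (rule bilI; intro lin_intros)
      moreover have "\<forall>a. \<forall>i\<in>I. ?\<beta> a i = 0"
        using kappa_form_vanishes[OF s m bal] sub by blast
      ultimately have "form ?\<beta> (can x) = form ?\<beta> (can y)"
        using eq unfolding canonical_map_tcls_over[OF I] tcls_push_eq_iff[OF s] by blast
      then show "form \<mu> x = form \<mu> y"
        unfolding form_can can_section[OF s m bal] .
    qed
  qed
  show "canonical_map A (quotient_by H I) ` range (tcls_over sA (coinv I)) = carrier (tensor (aspace A) (quotient_by H I))"
  proof (intro equalityI subsetI)
    fix Y assume "Y \<in> canonical_map A (quotient_by H I) ` range (tcls_over sA (coinv I))"
    then obtain x where Y: "Y = tcls (aspace A) (quotient_by H I) (push I x)"
      unfolding canonical_map_eq by blast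
    have k: "Poly_Mapping.keys (push I x) \<subseteq> UNIV \<times> carrier (quotient_by H I)"
    proof -
      have "Poly_Mapping.keys (push I x) \<subseteq> (\<Union>p\<in>Poly_Mapping.keys x.
          Poly_Mapping.keys (fscale (Poly_Mapping.lookup x p) (gen (fst p, proj (quotient_by H I) (snd p)) :: _ \<Rightarrow>\<^sub>0 'k)))"
        unfolding lin_ext_def case_prod_unfold by (rule Poly_Mapping.keys_sum)
      also have "\<dots> \<subseteq> UNIV \<times> carrier (quotient_by H I)"
        by (auto simp: in_keys_iff lookup_single when_def proj_quotient_by[OF s] carrier_quotient_by split: if_splits)
      finally show ?thesis .
    qed
    then show "Y \<in> carrier (tensor (aspace A) (quotient_by H I))"
      unfolding Y tensor_def quot_def tcls_def by (auto simp: type_space_def)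
  next
    fix Y assume "Y \<in> carrier (tensor (aspace A) (quotient_by H I))"
    then obtain y where y: "Poly_Mapping.keys y \<subseteq> UNIV \<times> carrier (quotient_by H I)"
        and Y: "Y = tcls (aspace A) (quotient_by H I) y"
      by (auto simp: tensor_def quot_def tcls_def type_space_def)
    define r where "r X = (SOME h. X = h +o I)" for X
    have r: "proj (quotient_by H I) (r X) = X" if "X \<in> carrier (quotient_by H I)" for X
    proof -
      have "\<exists>h. X = h +o I" using that unfolding carrier_quotient_by by blast
      then have "X = r X +o I" unfolding r_def by (rule someI_ex)
      then show ?thesis unfolding proj_quotient_by[OF s] by (rule sym)
    qed
    define z :: "'a \<times> 'h \<Rightarrow>\<^sub>0 'k" where "z = lin_ext fscale (\<lambda>(a, X). gen (a, r X)) y"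
    have "push I z = lin_ext fscale gen y"
      unfolding z_def lin_ext_lin_ext[OF vs_fscale]
    proof (rule lin_ext_cong)
      fix p assume "p \<in> Poly_Mapping.keys y"
      then have "snd p \<in> carrier (quotient_by H I)" using y by auto
      from r[OF this] show "push I (case p of (a, X) \<Rightarrow> gen (a, r X)) = gen p"
        by (simp add: case_prod_unfold lin_ext_gen[OF vs_fscale])
    qed
    then have pz: "push I z = y" by (simp add: lin_ext_gen_id)
    define x where "x = lin_ext fscale (\<lambda>(a, h). kappa a h) z"
    have "tcls (aspace A) (quotient_by H I) (push I (can x)) = tcls (aspace A) (quotient_by H I) (push I z)"
      unfolding tcls_push_eq_iff[OF s]
    proof (intro allI impI, elim conjE)
      fix \<beta> assume b: "bil sA sH (*) \<beta>"
      have "form \<beta> (can x) =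
         lin_ext (*) (\<lambda>p. form \<beta> (can (kappa (fst p) (snd p)))) z"
        unfolding x_def form_can lin_ext_lin_ext[OF vs_field] by (simp only: case_prod_unfold)
      also have "\<dots> = form \<beta> z"
        unfolding form_can_kappa[OF b] by (simp only: case_prod_unfold)
      finally show "form \<beta> (can x) = form \<beta> z" .
    qed
    then have "canonical_map A (quotient_by H I) (tcls_over sA (coinv I) x) = Y"
      unfolding canonical_map_tcls_over[OF I] pz Y .
    then show "Y \<in> canonical_map A (quotient_by H I) ` range (tcls_over sA (coinv I))" by blast
  qed
qed

text \<open>One cycle gives both claims: \<open>I \<subseteq> aug_ideal (coinv I)\<close> implies
  \<open>I \<subseteq> coinv_ideal I\<close>, hence bijectivity, hence injectivity, hence the first
  inclusion again.\<close>

lemma Galois_iff: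
  assumes nz: "(UNIV :: 'a set) \<noteq> {0}" and I: "right_ideal H I"
  shows "is_Galois A (quotient_by H I) \<longleftrightarrow> I \<subseteq> aug_ideal (coinv I)"
    and "I \<subseteq> coinv_ideal I \<Longrightarrow> I \<subseteq> aug_ideal (coinv I)"
proof -
  have s: "module.subspace sH I" using I by (simp add: right_ideal_def)
  note * = ideal_subset_of_inj[OF nz I] Galois_of_subset[OF I] aug_ideal_coinv_subset[of I]
  show "is_Galois A (quotient_by H I) \<longleftrightarrow> I \<subseteq> aug_ideal (coinv I)"
    unfolding is_Galois_def coinvariants_quot_eq[OF s] carrier_tensor_over
    using * unfolding bij_betw_def by blast
  show "I \<subseteq> coinv_ideal I \<Longrightarrow> I \<subseteq> aug_ideal (coinv I)"
    using * unfolding bij_betw_def by blast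
qed

end

section \<open>The Galois connection\<close>

context comod
begin

lemma quot_gen_cases:
  assumes "Q \<in> quot_gen H"
  obtains I where "Q = quotient_by H I" "coideal H I" "right_ideal H I"
  using assms by (auto simp: quot_gen_def)

lemma subspace_right_ideal: "right_ideal H I \<Longrightarrow> module.subspace sH I"
  by (simp add: right_ideal_def)

text \<open>The order is defined through some pair of ideals; \<open>quotient_by_inject\<close>
  shows that they are the given ones.\<close>

lemma quot_gen_le_iff:
  assumes I: "coideal H I" "right_ideal H I" and I': "coideal H I'" "right_ideal H I'"
  shows "le (quot_gen_order H) (quotient_by H I') (quotient_by H I) \<longleftrightarrow> I \<subseteq> I'"
proof
  assume "le (quot_gen_order H) (quotient_by H I') (quotient_by H I)"
  then obtain K K' where K: "right_ideal H K" "right_ideal H K'"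
      "quotient_by H I = quotient_by H K" "quotient_by H I' = quotient_by H K'" "K \<subseteq> K'"
    by (auto simp: quot_gen_order_def)
  then have "I = K" "I' = K'" using I I' by (metis subspace_right_ideal quotient_by_inject)+
  then show "I \<subseteq> I'" using K(5) by simp
qed (use assms in \<open>auto simp: quot_gen_order_def\<close>)

lemma partial_order_quot_gen: "partial_order (quot_gen_order H)"
proof -
  have e: "eq (quot_gen_order H) = (=)" and c: "carrier (quot_gen_order H) = quot_gen H"
    by (simp_all add: quot_gen_order_def)
  show ?thesis
  proof (unfold_locales; (unfold e c)?)
    fix x assume "x \<in> quot_gen H"
    then show "le (quot_gen_order H) x x" by (elim quot_gen_cases) (simp add: quot_gen_le_iff)
  next
    fix x y assume xy: "le (quot_gen_order H) x y" "le (quot_gen_order H) y x" "x \<in> quot_gen H" "y \<in> quot_gen H"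
    from xy(3) obtain I where "x = quotient_by H I" "coideal H I" "right_ideal H I" by (rule quot_gen_cases)
    moreover from xy(4) obtain I' where "y = quotient_by H I'" "coideal H I'" "right_ideal H I'" by (rule quot_gen_cases)
    ultimately show "x = y" using xy(1,2) by (simp add: quot_gen_le_iff)
  next
    fix x y z assume xy: "le (quot_gen_order H) x y" "le (quot_gen_order H) y z" "x \<in> quot_gen H" "y \<in> quot_gen H" "z \<in> quot_gen H"
    from xy(3) obtain I where "x = quotient_by H I" "coideal H I" "right_ideal H I" by (rule quot_gen_cases)
    moreover from xy(4) obtain I' where "y = quotient_by H I'" "coideal H I'" "right_ideal H I'" by (rule quot_gen_cases)
    moreover from xy(5) obtain K where "z = quotient_by H K" "coideal H K" "right_ideal H K" by (rule quot_gen_cases)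
    ultimately show "le (quot_gen_order H) x z" using xy(1,2) by (auto simp: quot_gen_le_iff)
  qed auto
qed

lemma phi_eq: "right_ideal H I \<Longrightarrow> phi A (quotient_by H I) = coinv I"
  by (rule coinvariants_quot_eq[OF subspace_right_ideal])

lemma aug_ideal_mem_quot_gen: "quotient_by H (aug_ideal X) \<in> quot_gen H"
  using coideal_aug_ideal right_ideal_aug_ideal by (auto simp: quot_gen_def)

text \<open>The supremum is attained: the quotient by \<open>aug_ideal X\<close> belongs to the set
  and bounds it.\<close>

lemma psi_eq: "psi H A X = quotient_by H (aug_ideal X)"
proof -
  let ?L = "quot_gen_order H" and ?S = "{Q \<in> quot_gen H. X \<subseteq> phi A Q}"
  interpret partial_order ?L by (rule partial_order_quot_gen)
  have c: "carrier ?L = quot_gen H" by (simp add: quot_gen_order_def)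
  have le: "le ?L Q (quotient_by H (aug_ideal X))" if Q: "Q \<in> ?S" for Q
  proof -
    obtain I where I: "Q = quotient_by H I" "coideal H I" "right_ideal H I"
      using Q by (auto elim: quot_gen_cases)
    then have "aug_ideal X \<subseteq> I" using Q aug_ideal_subset_iff[OF I(3)] phi_eq[OF I(3)] by simp
    then show ?thesis unfolding I(1) using I coideal_aug_ideal right_ideal_aug_ideal by (simp add: quot_gen_le_iff)
  qed
  have mem: "quotient_by H (aug_ideal X) \<in> ?S"
    using aug_ideal_mem_quot_gen phi_eq[OF right_ideal_aug_ideal] aug_ideal_subset_iff[OF right_ideal_aug_ideal] by blast
  have "least ?L (quotient_by H (aug_ideal X)) (Upper ?L ?S)"
    unfolding least_def Upper_def c using le mem aug_ideal_mem_quot_gen by auto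
  then show ?thesis
    unfolding psi_def sup_def using least_unique by (blast intro: some_equality)
qed

lemma galois_connection_quot_sub: "galois_connection (quot_sub_connection H A)"
proof -
  have po: "partial_order (sub_alg_order H A)"
    by unfold_locales (auto simp: sub_alg_order_def)
  have cl: "phi A Q \<in> sub_alg H A" if "Q \<in> quot_gen H" for Q
    using that phi_eq coinv_sub_alg by (auto elim!: quot_gen_cases)
  show ?thesis
  proof (intro galois_connection.intro connection.intro galois_connection_axioms.intro)
    show "partial_order (orderA (quot_sub_connection H A))"
      by (simp add: quot_sub_connection_def partial_order_quot_gen)
    show "partial_order (orderB (quot_sub_connection H A))"
      by (simp add: quot_sub_connection_def dual_order_iff po)
    show "lower (quot_sub_connection H A) \<in> carrier (orderA (quot_sub_connection H A)) \<rightarrow> carrier (orderB (quot_sub_connection H A))"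
      using cl by (auto simp: quot_sub_connection_def quot_gen_order_def sub_alg_order_def)
    show "upper (quot_sub_connection H A) \<in> carrier (orderB (quot_sub_connection H A)) \<rightarrow> carrier (orderA (quot_sub_connection H A))"
      using aug_ideal_mem_quot_gen by (auto simp: quot_sub_connection_def quot_gen_order_def sub_alg_order_def psi_eq)
    fix Q X assume "Q \<in> carrier (orderA (quot_sub_connection H A))"
    then obtain I where I: "Q = quotient_by H I" "coideal H I" "right_ideal H I"
      by (auto simp: quot_sub_connection_def quot_gen_order_def elim: quot_gen_cases)
    have "X \<subseteq> phi A Q \<longleftrightarrow> le (quot_gen_order H) Q (psi H A X)"
      unfolding psi_eq I(1) phi_eq[OF I(3)] quot_gen_le_iff[OF coideal_aug_ideal right_ideal_aug_ideal I(2,3)]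
      by (rule aug_ideal_subset_iff[OF I(3), symmetric])
    then show "le (orderB (quot_sub_connection H A)) (lower (quot_sub_connection H A) Q) X \<longleftrightarrow>
       le (orderA (quot_sub_connection H A)) Q (upper (quot_sub_connection H A) X)"
      by (simp add: quot_sub_connection_def sub_alg_order_def)
  qed
qed

lemma closed_iff:
  assumes I: "coideal H I" "right_ideal H I"
  shows "psi H A (phi A (quotient_by H I)) = quotient_by H I \<longleftrightarrow> I \<subseteq> aug_ideal (coinv I)"
proof -
  have "aug_ideal (coinv I) \<subseteq> I" using aug_ideal_subset_iff[OF I(2)] by blast
  moreover have "quotient_by H (aug_ideal (coinv I)) = quotient_by H I \<longleftrightarrow> aug_ideal (coinv I) = I"
    using quotient_by_inject subspace_right_ideal right_ideal_aug_ideal I(2) by metis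
  ultimately show ?thesis unfolding phi_eq[OF I(2)] psi_eq by blast
qed

end

section \<open>Dimensions of finitely generated subspaces\<close>

context vector_space
begin

lemma subspace_span_eq: "subspace V \<Longrightarrow> span V = V"
  by simp

lemma finite_independent_in_span:
  assumes "finite F" "V \<subseteq> span F" "b \<subseteq> V" "independent b"
  shows "finite b"
  using independent_span_bound[of F b] assms by blast

text \<open>Stated relative to a finite spanning set because the function space
  \<open>'h \<Rightarrow> 'h\<close>, used later to model \<open>H \<otimes> H\<close>, need not be
  finite dimensional as a whole.\<close>

lemma dim_mono_span:
  assumes F: "finite F" "V \<subseteq> span F" and U: "U \<subseteq> V"
  shows "dim U \<le> dim V"
proof -
  obtain b where b: "b \<subseteq> U" "independent b" "U \<subseteq> span b"
    by (rule maximal_independent_subset)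
  have "b \<subseteq> V" using b U by blast
  then obtain c where c: "b \<subseteq> c" "c \<subseteq> V" "independent c" "V \<subseteq> span c"
    by (rule maximal_independent_subset_extend[OF _ b(2)])
  have "finite c" using finite_independent_in_span[OF F c(2,3)] .
  then show ?thesis
    using basis_card_eq_dim[OF b(1,3,2)] basis_card_eq_dim[OF c(2,4,3)] card_mono[OF _ c(1)] by simp
qed

lemma dim_eq_span_subset:
  assumes F: "finite F" "V \<subseteq> span F" and U: "U \<subseteq> V" "subspace U" "dim V \<le> dim U"
  shows "V = U"
proof -
  obtain b where b: "b \<subseteq> U" "independent b" "U \<subseteq> span b"
    by (rule maximal_independent_subset)
  have "b \<subseteq> V" using b U by blast
  then obtain c where c: "b \<subseteq> c" "c \<subseteq> V" "independent c" "V \<subseteq> span c"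
    by (rule maximal_independent_subset_extend[OF _ b(2)])
  have fc: "finite c" using finite_independent_in_span[OF F c(2,3)] .
  then have "card c \<le> card b"
    using basis_card_eq_dim[OF b(1,3,2)] basis_card_eq_dim[OF c(2,4,3)] U(3) by simp
  then have "b = c" using card_seteq[OF fc c(1)] by simp
  then have "V \<subseteq> span U" using c(4) span_mono[OF b(1)] by blast
  then show ?thesis using U by (auto simp: subspace_span_eq)
qed

text \<open>Projection along a complement of I; it plays the part of the quotient map by I without
  leaving the type.\<close>

lemma exists_linear_with_kernel:
  assumes I: "subspace I"
  obtains p where "lin scale scale p" "\<And>x. p x = 0 \<longleftrightarrow> x \<in> I"
proof -
  interpret pr: vector_space_pair scale scale by unfold_locales
  obtain b where b: "b \<subseteq> I" "independent b" "I \<subseteq> span b"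
    by (rule maximal_independent_subset)
  obtain c where c: "b \<subseteq> c" "c \<subseteq> UNIV" "independent c" "UNIV \<subseteq> span c"
    by (rule maximal_independent_subset_extend[OF subset_UNIV b(2)])
  obtain p where "Vector_Spaces.linear scale scale p" and p: "\<forall>x\<in>c. p x = (if x \<in> b then 0 else x)"
    using pr.linear_independent_extend[OF c(3), of "\<lambda>x. if x \<in> b then 0 else x"] by blast
  then have l: "lin scale scale p" by (simp add: linear_iff_lin)
  have vs: "vector_space scale" by unfold_locales
  have p0: "p x = 0" if "x \<in> span b" for x
    by (rule lin_span_zero[OF vs l vs _ that]) (use p c(1) in auto)
  have p1: "p x - x = 0" if "x \<in> span (c - b)" for x
    by (rule lin_span_zero[OF vs lin_sub[OF vs l lin_id] vs _ that]) (use p in auto)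
  have "x \<in> I" if "p x = 0" for x
  proof -
    have "x \<in> span (b \<union> (c - b))" using c by (auto simp: Un_absorb1)
    then obtain y z where x: "x = y + z" "y \<in> span b" "z \<in> span (c - b)" unfolding span_Un by blast
    then have "z = 0" using that p0 p1 by (simp add: lin_add[OF l])
    then show ?thesis using x b span_mono[OF b(1)] I by (auto simp: subspace_span_eq)
  qed
  moreover have "p x = 0" if "x \<in> I" for x using p0 that b(3) by blast
  ultimately show ?thesis using that l by blast
qed

end

lemma rank_nullity:
  assumes s: "vector_space s" and t: "vector_space t" and f: "lin s t f"
    and V: "module.subspace s V" "finite F" "V \<subseteq> module.span s F"
  shows "vector_space.dim s V = vector_space.dim s {v \<in> V. f v = 0} + vector_space.dim t (f ` V)"
proof -
  interpret s: vector_space s by fact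
  interpret t: vector_space t by fact
  interpret pr: vector_space_pair s t by unfold_locales
  have l: "Vector_Spaces.linear s t f" using assms by (simp add: linear_iff_lin)
  let ?N = "{v \<in> V. f v = 0}"
  obtain b where b: "b \<subseteq> ?N" "s.independent b" "?N \<subseteq> s.span b"
    by (rule s.maximal_independent_subset)
  have "b \<subseteq> V" using b by blast
  then obtain c where c: "b \<subseteq> c" "c \<subseteq> V" "s.independent c" "V \<subseteq> s.span c"
    by (rule s.maximal_independent_subset_extend[OF _ b(2)])
  have fc: "finite c" using s.finite_independent_in_span[OF V(2,3) c(2,3)] .
  have dsj: "x = 0" if "x \<in> s.span (c - b)" "x \<in> s.span b" for x
  proof -
    have ic: "s.independent (c - b)" using c(3) s.independent_mono by blast
    have 1: "s.representation c x = s.representation b x"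
      by (rule s.representation_extend[OF c(3) that(2) c(1)])
    have 2: "s.representation c x = s.representation (c - b) x"
      by (rule s.representation_extend[OF c(3) that(1)]) blast
    have z: "s.representation c x y = 0" for y
      using s.representation_ne_zero[of b x y] s.representation_ne_zero[of "c - b" x y] 1 2 by fastforce
    have "x \<in> s.span c" using that(2) s.span_mono[OF c(1)] by blast
    from s.sum_nonzero_representation_eq[OF c(3) this] show "x = 0" using z by simp
  qed
  have inj: "inj_on f (s.span (c - b))"
  proof (rule inj_onI)
    fix x y assume xy: "x \<in> s.span (c - b)" "y \<in> s.span (c - b)" "f x = f y"
    have d: "x - y \<in> s.span (c - b)" using xy s.span_diff by blast
    have "s.span (c - b) \<subseteq> V" by (rule s.span_minimal[OF _ V(1)]) (use c in blast)
    then have "x - y \<in> ?N" using d xy(3) by (auto simp: lin_diff[OF f])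
    then have "x - y = 0" using dsj[OF d] b(3) by blast
    then show "x = y" by simp
  qed
  have ind: "t.independent (f ` (c - b))"
    by (rule pr.linear_independent_injective_image[OF l _ inj]) (use c(3) s.independent_mono in blast)
  have im: "f ` V \<subseteq> t.span (f ` (c - b))"
  proof safe
    fix v assume "v \<in> V"
    then have "v \<in> s.span (b \<union> (c - b))" using c by (auto simp: Un_absorb1)
    then obtain y z where v: "v = y + z" "y \<in> s.span b" "z \<in> s.span (c - b)" unfolding s.span_Un by blast
    have "f y = 0" by (rule lin_span_zero[OF s f t _ v(2)]) (use b in blast)
    then have "f v = f z" by (simp add: v lin_add[OF f])
    also have "\<dots> \<in> t.span (f ` (c - b))" using v(3) pr.linear_span_image[OF l, of "c - b"] by blast
    finally show "f v \<in> t.span (f ` (c - b))" .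
  qed
  have "card c = card b + card (c - b)"
    using fc c(1) by (metis card_Diff_subset card_mono finite_subset le_add_diff_inverse)
  moreover have "card (f ` (c - b)) = card (c - b)"
    by (rule card_image) (use inj s.span_superset inj_on_subset in blast)
  ultimately show ?thesis
    using s.basis_card_eq_dim[OF b(1,3,2)] s.basis_card_eq_dim[OF c(2,4,3)]
      t.basis_card_eq_dim[OF _ im ind] c by auto
qed

lemma dim_image_inj:
  assumes s: "vector_space s" and t: "vector_space t" and f: "lin s t f"
    and V: "module.subspace s V" "finite F" "V \<subseteq> module.span s F" and inj: "\<And>v. v \<in> V \<Longrightarrow> f v = 0 \<Longrightarrow> v = 0"
  shows "vector_space.dim t (f ` V) = vector_space.dim s V"
proof -
  interpret s: vector_space s by fact
  have "{v \<in> V. f v = 0} = {0}" using inj s.subspace_0[OF V(1)] lin_zero[OF f] by auto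
  moreover have "s.dim {0} = 0" using s.basis_card_eq_dim[of "{}" "{0}"] by (simp add: s.dependent_def)
  ultimately show ?thesis using rank_nullity[OF s t f V] by simp
qed

lemma lin_image_subspace:
  assumes s: "vector_space s" and t: "vector_space t" and f: "lin s t f" and V: "module.subspace s V"
  shows "module.subspace t (f ` V)"
proof -
  interpret s: vector_space s by fact
  interpret t: vector_space t by fact
  interpret pr: vector_space_pair s t by unfold_locales
  show ?thesis by (rule pr.linear_subspace_image) (use assms in \<open>simp_all add: linear_iff_lin\<close>)
qed

section \<open>Direct powers of a vector space, modelled by functions supported on an index
  set\<close>

definition fscl :: "('k \<Rightarrow> 'v \<Rightarrow> 'v) \<Rightarrow> 'k \<Rightarrow> ('i \<Rightarrow> 'v) \<Rightarrow> 'i \<Rightarrow> 'v" where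
  "fscl s c v = (\<lambda>t. s c (v t))"

lemma vs_fscl: "vector_space s \<Longrightarrow> vector_space (fscl s)"
proof -
  assume "vector_space s"
  then interpret vector_space s .
  show ?thesis by unfold_locales (auto simp: fscl_def fun_eq_iff algebra_simps)
qed

definition supported :: "'i set \<Rightarrow> 'v::zero set \<Rightarrow> ('i \<Rightarrow> 'v) set" where
  "supported B X = {v. (\<forall>t. v t \<in> X) \<and> (\<forall>t. t \<notin> B \<longrightarrow> v t = 0)}"

definition fsingle :: "'i \<Rightarrow> 'v::zero \<Rightarrow> 'i \<Rightarrow> 'v" where
  "fsingle t x = (\<lambda>s. if s = t then x else 0)"

lemma lin_fsingle: assumes "vector_space s" shows "lin s (fscl s) (fsingle t)"
proof -
  interpret vector_space s by fact
  show ?thesis by (auto simp: lin_def fsingle_def fscl_def fun_eq_iff)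
qed

lemma lin_eval: "lin (fscl s) s (\<lambda>v. v t)"
  by (auto simp: lin_def fscl_def)

lemma supported_decompose:
  assumes "finite B" "v \<in> supported B X" shows "v = (\<Sum>t\<in>B. fsingle t (v t))"
proof
  fix s
  have "(\<Sum>t\<in>B. fsingle t (v t)) s = (\<Sum>t\<in>B. fsingle t (v t) s)"
    by (induction B rule: infinite_finite_induct) auto
  also have "\<dots> = v s" using assms by (auto simp: fsingle_def supported_def)
  finally show "v s = (\<Sum>t\<in>B. fsingle t (v t)) s" by simp
qed

lemma supported_subspace:
  fixes s :: "'k::field \<Rightarrow> 'v::ab_group_add \<Rightarrow> 'v" and B :: "'i set"
  assumes "vector_space s" "module.subspace s X" shows "module.subspace (fscl s) (supported B X)"
proof -
  interpret s: vector_space s by fact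
  interpret f: vector_space "fscl s :: 'k \<Rightarrow> ('i \<Rightarrow> 'v) \<Rightarrow> 'i \<Rightarrow> 'v" by (rule vs_fscl) fact
  show ?thesis unfolding f.subspace_def
    using s.subspace_0[OF assms(2)] s.subspace_add[OF assms(2)] s.subspace_scale[OF assms(2)]
    by (auto simp: supported_def fscl_def)
qed

lemma supported_fin_dim:
  fixes s :: "'k::field \<Rightarrow> 'v::ab_group_add \<Rightarrow> 'v" and B :: "'i set"
  assumes s: "vector_space s" and B: "finite B" and F: "finite F" "X \<subseteq> module.span s F"
  shows "supported B X \<subseteq> module.span (fscl s) (\<Union>t\<in>B. fsingle t ` F)"
proof
  interpret s: vector_space s by fact
  interpret f: vector_space "fscl s :: 'k \<Rightarrow> ('i \<Rightarrow> 'v) \<Rightarrow> 'i \<Rightarrow> 'v" by (rule vs_fscl) fact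
  interpret pr: vector_space_pair s "fscl s :: 'k \<Rightarrow> ('i \<Rightarrow> 'v) \<Rightarrow> 'i \<Rightarrow> 'v" by unfold_locales
  fix v assume v: "v \<in> supported B X"
  have "fsingle t (v t) \<in> f.span (\<Union>t\<in>B. fsingle t ` F)" if t: "t \<in> B" for t
  proof -
    have l: "Vector_Spaces.linear s (fscl s) (fsingle t)"
      using lin_fsingle[OF s, of t] s f.vector_space_axioms by (simp add: linear_iff_lin)
    have "v t \<in> s.span F" using v F(2) by (auto simp: supported_def)
    then have "fsingle t (v t) \<in> f.span (fsingle t ` F)"
      using pr.linear_span_image[OF l, of F] by blast
    then show ?thesis using f.span_mono[of "fsingle t ` F" "\<Union>t\<in>B. fsingle t ` F"] t by blast
  qed
  then have "(\<Sum>t\<in>B. fsingle t (v t)) \<in> f.span (\<Union>t\<in>B. fsingle t ` F)" by (rule f.span_sum)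
  then show "v \<in> f.span (\<Union>t\<in>B. fsingle t ` F)" using supported_decompose[OF B v] by simp
qed

lemma dim_supported:
  fixes s :: "'k::field \<Rightarrow> 'v::ab_group_add \<Rightarrow> 'v" and B :: "'i set"
  assumes s: "vector_space s" and B: "finite B" and F: "finite F" "X \<subseteq> module.span s F"
    and X: "module.subspace s X"
  shows "vector_space.dim (fscl s) (supported B X) = card B * vector_space.dim s X"
  using B
proof (induction B rule: finite_induct)
  interpret s: vector_space s by fact
  interpret f: vector_space "fscl s :: 'k \<Rightarrow> ('i \<Rightarrow> 'v) \<Rightarrow> 'i \<Rightarrow> 'v" by (rule vs_fscl) fact
  case empty
  have "supported {} X = ({0} :: ('i \<Rightarrow> 'v) set)" using s.subspace_0[OF X] by (auto simp: supported_def fun_eq_iff)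
  moreover have "f.dim {0} = 0" using f.basis_card_eq_dim[of "{}" "{0}"] by (simp add: f.dependent_def)
  ultimately show ?case by simp
next
  interpret s: vector_space s by fact
  case (insert b B)
  have "vector_space.dim (fscl s) (supported (insert b B) X) =
     vector_space.dim (fscl s) {v \<in> supported (insert b B) X. v b = 0} +
     vector_space.dim s ((\<lambda>v. v b) ` supported (insert b B) X)"
    by (rule rank_nullity[OF vs_fscl[OF s] s lin_eval supported_subspace[OF s X] _ supported_fin_dim[OF s _ F]])
       (use F insert in auto)
  moreover have "{v \<in> supported (insert b B) X. v b = 0} = supported B X"
    using insert by (auto simp: supported_def)
  moreover have "(\<lambda>v. v b) ` supported (insert b B) X = X"
  proof safe
    fix x assume "x \<in> X"
    then have "fsingle b x \<in> supported (insert b B) X"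
      using s.subspace_0[OF X] by (auto simp: supported_def fsingle_def)
    moreover have "x = fsingle b x b" by (simp add: fsingle_def)
    ultimately show "x \<in> (\<lambda>v. v b) ` supported (insert b B) X" by blast
  qed (auto simp: supported_def)
  ultimately show ?case using insert by simp
qed

section \<open>Convolution identities\<close>

lemma sw_sum:
  assumes "vector_space t" shows "sw t X (\<lambda>x y. \<Sum>i\<in>J. f i x y) = (\<Sum>i\<in>J. sw t X (f i))"
proof -
  interpret vector_space t by fact
  show ?thesis unfolding sw_def lin_ext_def case_prod_unfold scale_sum_right by (rule sum.swap)
qed

lemma sw_mem:
  assumes "vector_space t" "module.subspace t V" "\<And>x y. \<beta> x y \<in> V" shows "sw t X \<beta> \<in> V"
proof -
  interpret vector_space t by fact
  show ?thesis unfolding sw_def lin_ext_def case_prod_unfold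
    using assms(2,3) by (intro subspace_sum subspace_scale) auto
qed

context hopf
begin

abbreviation "R \<equiv> self.slice"

definition L :: "('h \<Rightarrow> 'k) \<Rightarrow> 'h \<Rightarrow> 'h" where
  "L u y = D sH y (\<lambda>b h. sH (u h) b)"

text \<open>The slices of \<open>S(y_1) \<otimes> y_2\<close> by functionals on the second
  factor.\<close>

definition \<sigma> :: "('h \<Rightarrow> 'k) \<Rightarrow> 'h \<Rightarrow> 'h" where
  "\<sigma> u y = S (L u y)"

lemma R_eq: "R u y = D sH y (\<lambda>b h. sH (u b) h)"
  by (rule self.slice_def)

lemma lin_L: "lin sH (*) u \<Longrightarrow> lin sH sH (L u)"
  unfolding L_def[abs_def] by (rule D_lin'[OF vs_H lin_scale_right[OF vs_H lin_id] lin_scale_left[OF vs_H] lin_id])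

lemma lin_L' [lin_intros]: "lin sH (*) u \<Longrightarrow> lin r sH g \<Longrightarrow> lin r sH (\<lambda>z. L u (g z))"
  by (rule lin_comp[OF lin_L])

lemma lin_R' [lin_intros]: "lin sH (*) u \<Longrightarrow> lin r sH g \<Longrightarrow> lin r sH (\<lambda>z. R u (g z))"
  by (rule lin_comp[OF self.lin_slice])

lemma lin_sigma: "lin sH (*) u \<Longrightarrow> lin sH sH (\<sigma> u)"
  unfolding \<sigma>_def[abs_def] by (rule lin_comp[OF lin_antipode lin_L])

lemma form_L: "lin sH (*) u \<Longrightarrow> u (L w y) = D (*) y (\<lambda>b h. w h * u b)"
  unfolding L_def by (simp only: lin_sw[of sH "(*)" u] lin_scale[of sH "(*)" u])

lemma counit_L: "lin sH (*) u \<Longrightarrow> \<epsilon> (L u y) = u y"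
  unfolding form_L[OF lin_counit] using D_counit_left[of "(*)" u y] by (simp add: mult.commute)

lemma counit_antipode: "\<epsilon> (S h) = \<epsilon> h"
proof -
  have "\<epsilon> (S h) = D (*) h (\<lambda>x y. \<epsilon> y * \<epsilon> (S x))"
    by (rule D_counit_right[of "(*)" "\<lambda>x. \<epsilon> (S x)", symmetric]) (intro lin_intros)
  also have "\<dots> = D (*) h (\<lambda>x y. \<epsilon> (S x * y))" by (simp add: counit_mult mult.commute)
  also have "\<dots> = \<epsilon> h" by (simp add: D_antipode_left[OF lin_counit] counit_one)
  finally show ?thesis .
qed

lemma counit_sigma: "lin sH (*) u \<Longrightarrow> \<epsilon> (\<sigma> u y) = u y"
  by (simp add: \<sigma>_def counit_antipode counit_L)

lemma R_one: "lin sH (*) d \<Longrightarrow> R d 1 = sH (d 1) 1"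
  unfolding R_eq by (rule D_one) (simp_all add: lin_intros)

lemma R_L: assumes d: "lin sH (*) d" and f: "lin sH (*) f" shows "R d (L f y) = L f (R d y)"
proof -
  interpret vector_space sH by (rule vs_H)
  note [lin_intros] = d f
  have "R d (L f y) = D sH y (\<lambda>b h. sH (f h) (R d b))"
    unfolding L_def lin_sw[OF self.lin_slice[OF d]] lin_scale[OF self.lin_slice[OF d]] ..
  also have "\<dots> = D sH y (\<lambda>b h. D sH b (\<lambda>x z. sH (f h) (sH (d x) z)))"
    unfolding R_eq lin_sw[OF lin_scale_right[OF vs_H lin_id]] ..
  also have "\<dots> = D sH y (\<lambda>x w. D sH w (\<lambda>z h. sH (f h) (sH (d x) z)))"
    by (simp add: D_coassoc lin_intros del: scale_scale)
  also have "\<dots> = D sH y (\<lambda>x w. D sH w (\<lambda>z h. sH (d x) (sH (f h) z)))"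
    by (simp add: mult.commute)
  also have "\<dots> = D sH y (\<lambda>x w. sH (d x) (L f w))"
    unfolding L_def lin_sw[OF lin_scale_right[OF vs_H lin_id]] ..
  also have "\<dots> = L f (R d y)"
    unfolding R_eq lin_sw[OF lin_L[OF f]] lin_scale[OF lin_L[OF f]] ..
  finally show ?thesis .
qed

text \<open>Sliced form of \<open>\<Delta>(S(y_1)) \<otimes> y_2 = S(y_2) \<otimes> S(y_1) \<otimes>
  y_3\<close>.\<close>

lemma L_sigma: assumes f: "lin sH (*) f" and u: "lin sH (*) u"
  shows "L f (\<sigma> u y) = \<sigma> u (R (\<lambda>x. f (S x)) y)"
proof -
  interpret vector_space sH by (rule vs_H)
  note [lin_intros] = f u lin_comp[OF f] lin_comp[OF u]
  have l: "lin sH sH (\<lambda>z. L f (S z))" by (rule lin_comp[OF lin_L[OF f] lin_antipode])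
  have "L f (\<sigma> u y) = D sH y (\<lambda>b h. sH (u h) (L f (S b)))"
    unfolding \<sigma>_def L_def[of u] lin_sw[OF l] lin_scale[OF l] ..
  also have "\<dots> = D sH y (\<lambda>b h. D sH b (\<lambda>x z. sH (u h) (sH (f (S x)) (S z))))"
    unfolding L_def by (simp add: D_antipode lin_intros lin_sw[OF lin_scale_right[OF vs_H lin_id]] del: scale_scale)
  also have "\<dots> = D sH y (\<lambda>x w. D sH w (\<lambda>z h. sH (u h) (sH (f (S x)) (S z))))"
    by (simp add: D_coassoc lin_intros del: scale_scale)
  also have "\<dots> = D sH y (\<lambda>x w. D sH w (\<lambda>z h. sH (f (S x)) (sH (u h) (S z))))"
    by (simp add: mult.commute)
  also have "\<dots> = D sH y (\<lambda>x w. sH (f (S x)) (\<sigma> u w))"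
    unfolding \<sigma>_def L_def lin_sw[OF lin_antipode] lin_scale[OF lin_antipode] lin_sw[OF lin_scale_right[OF vs_H lin_id]] ..
  also have "\<dots> = \<sigma> u (R (\<lambda>x. f (S x)) y)"
    unfolding R_eq lin_sw[OF lin_sigma[OF u]] lin_scale[OF lin_sigma[OF u]] ..
  finally show ?thesis .
qed

text \<open>Sliced form of \<open>y_1 S(y_2) \<otimes> y_3 = 1 \<otimes> y\<close>; it makes
  \<open>untwist\<close> undo \<open>twist\<close>.\<close>

lemma conv_antipode_L:
  assumes u: "lin sH (*) u" shows "D sH y (\<lambda>x z. x * \<sigma> u z) = sH (u y) 1"
proof -
  interpret vector_space sH by (rule vs_H)
  note [lin_intros] = u
  have "D sH y (\<lambda>x z. x * \<sigma> u z) = D sH y (\<lambda>x z. D sH z (\<lambda>b h. sH (u h) (x * S b)))"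
    unfolding \<sigma>_def L_def lin_sw[OF lin_antipode] lin_scale[OF lin_antipode]
      lin_sw[OF lin_mult_right[OF k_algebra_H lin_id]] lin_scale[OF lin_mult_right[OF k_algebra_H lin_id]] ..
  also have "\<dots> = D sH y (\<lambda>x h. D sH x (\<lambda>x b. sH (u h) (x * S b)))"
    by (simp add: D_coassoc lin_intros)
  also have "\<dots> = D sH y (\<lambda>x h. sH (\<epsilon> x) (sH (u h) 1))"
    unfolding D_antipode_right[where g = "\<lambda>w. sH (u h) w" for h, OF lin_scale_right[OF vs_H lin_id]] ..
  also have "\<dots> = sH (u y) 1"
    by (rule D_counit_left[of sH "\<lambda>h. sH (u h) 1"]) (intro lin_intros)
  finally show ?thesis .
qed

lemma conv_antipode_L':
  assumes u: "lin sH (*) u" shows "D sH y (\<lambda>x z. S x * L u z) = sH (u y) 1"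
proof -
  interpret vector_space sH by (rule vs_H)
  note [lin_intros] = u
  have "D sH y (\<lambda>x z. S x * L u z) = D sH y (\<lambda>x z. D sH z (\<lambda>b h. sH (u h) (S x * b)))"
    unfolding L_def lin_sw[OF lin_mult_right[OF k_algebra_H lin_id]] lin_scale[OF lin_mult_right[OF k_algebra_H lin_id]] ..
  also have "\<dots> = D sH y (\<lambda>x h. D sH x (\<lambda>x b. sH (u h) (S x * b)))"
    by (simp add: D_coassoc lin_intros)
  also have "\<dots> = D sH y (\<lambda>x h. sH (\<epsilon> x) (sH (u h) 1))"
    unfolding D_antipode_left[where g = "\<lambda>w. sH (u h) w" for h, OF lin_scale_right[OF vs_H lin_id]] ..
  also have "\<dots> = sH (u y) 1"
    by (rule D_counit_left[of sH "\<lambda>h. sH (u h) 1"]) (intro lin_intros)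
  finally show ?thesis .
qed

lemma R_mult:
  assumes d: "lin sH (*) d" shows "R d (x * y) = D sH y (\<lambda>b1 b2. R (\<lambda>q. d (q * b1)) x * b2)"
proof -
  note [lin_intros] = lin_comp[OF d]
  have "R d (x * y) = D sH x (\<lambda>x1 x2. D sH y (\<lambda>y1 y2. sH (d (x1 * y1)) (x2 * y2)))"
    unfolding R_eq by (rule D_mult) (intro lin_intros)+
  also have "\<dots> = D sH y (\<lambda>y1 y2. D sH x (\<lambda>x1 x2. sH (d (x1 * y1)) (x2 * y2)))"
    by (rule sw_swap[OF vs_H])
  also have "\<dots> = D sH y (\<lambda>b1 b2. R (\<lambda>q. d (q * b1)) x * b2)"
    unfolding R_eq lin_sw[OF lin_mult_left[OF k_algebra_H lin_id]] lin_scale[OF lin_mult_left[OF k_algebra_H lin_id]] ..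
  finally show ?thesis .
qed

text \<open>Sliced colinearity of \<open>x \<otimes> y \<mapsto> x y_1 \<otimes> y_2\<close>: the
  diagonal coaction turns into the coaction on the first factor.\<close>

lemma R_mult_L:
  assumes d: "lin sH (*) d" and u: "lin sH (*) u"
  shows "R d (x * L u y) = D sH y (\<lambda>b w. R (\<lambda>q. d (q * b)) x * L u w)"
proof -
  note [lin_intros] = lin_comp[OF d] lin_comp[OF u] u d
  have lR: "lin sH sH (\<lambda>b. R (\<lambda>q. d (q * b)) x)" unfolding R_eq by (intro lin_intros)
  note [lin_intros] = lin_comp[OF lR]
  have l: "lin sH sH (\<lambda>z. R d (x * z))" by (intro lin_intros)
  have "R d (x * L u y) = D sH y (\<lambda>b h. sH (u h) (R d (x * b)))"
    unfolding L_def lin_sw[OF l] lin_scale[OF l] ..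
  also have "\<dots> = D sH y (\<lambda>b h. D sH b (\<lambda>b1 b2. sH (u h) (R (\<lambda>q. d (q * b1)) x * b2)))"
    unfolding R_mult[OF d] lin_sw[OF lin_scale_right[OF vs_H lin_id]] ..
  also have "\<dots> = D sH y (\<lambda>b1 w. D sH w (\<lambda>b2 h. sH (u h) (R (\<lambda>q. d (q * b1)) x * b2)))"
    by (simp add: D_coassoc lin_intros)
  also have "\<dots> = D sH y (\<lambda>b w. R (\<lambda>q. d (q * b)) x * L u w)"
    unfolding L_def lin_sw[OF lin_mult_right[OF k_algebra_H lin_id]] lin_scale[OF lin_mult_right[OF k_algebra_H lin_id]] ..
  finally show ?thesis .
qed

lemma L_mult_antipode:
  assumes u: "lin sH (*) u"
  shows "L u (h * S a) = D sH h (\<lambda>h1 h2. D sH a (\<lambda>a1 a2. sH (u (h2 * S a1)) (h1 * S a2)))"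
proof -
  note [lin_intros] = lin_comp[OF u]
  show ?thesis unfolding L_def by (simp add: D_mult D_antipode lin_intros)
qed

text \<open>The identity behind \<open>sigma_cotwist\<close>, where \<open>e\<close> is a coordinate functional.\<close>

lemma sigma_twist:
  assumes u: "lin sH (*) u" and e: "lin sH (*) e"
  shows "D sH y (\<lambda>b h. D sH t (\<lambda>a c. sH (u c) (S b * L e (h * S a)))) =
    D sH t (\<lambda>x z. sH (e (y * S x)) (\<sigma> u z))"
proof -
  interpret vector_space sH by (rule vs_H)
  note [lin_intros] = lin_comp[OF u] lin_comp[OF e] u e
  define Q where "Q g h = D sH t (\<lambda>a c. D sH a (\<lambda>a1 a2. sH (u c) (sH (e (h * S a1)) (g * S a2))))" for g h
  have Q1: "lin sH sH (\<lambda>g. Q g h)" for h unfolding Q_def by (intro lin_intros)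
  have Q2: "lin sH sH (\<lambda>h. Q g h)" for g unfolding Q_def by (intro lin_intros)
  note [lin_intros] = lin_comp[OF Q1] lin_comp[OF Q2]
  have "D sH t (\<lambda>a c. sH (u c) (S b * L e (h * S a))) = D sH h (\<lambda>h1 h2. Q (S b * h1) h2)" for b h
  proof -
    have "D sH t (\<lambda>a c. sH (u c) (S b * L e (h * S a))) =
       D sH t (\<lambda>a c. D sH h (\<lambda>h1 h2. D sH a (\<lambda>a1 a2. sH (u c) (sH (e (h2 * S a1)) (S b * h1 * S a2)))))"
      unfolding L_mult_antipode[OF e]
      unfolding lin_sw[OF lin_mult_right[OF k_algebra_H lin_id]] lin_scale[OF lin_mult_right[OF k_algebra_H lin_id]]
      unfolding lin_sw[OF lin_scale_right[OF vs_H lin_id]] mult.assoc ..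
    also have "\<dots> = D sH h (\<lambda>h1 h2. Q (S b * h1) h2)"
      unfolding Q_def by (rule sw_swap[OF vs_H])
    finally show ?thesis .
  qed
  then have "D sH y (\<lambda>b h. D sH t (\<lambda>a c. sH (u c) (S b * L e (h * S a)))) =
      D sH y (\<lambda>b h. D sH h (\<lambda>h1 h2. Q (S b * h1) h2))" by simp
  also have "\<dots> = D sH y (\<lambda>x h2. D sH x (\<lambda>b h1. Q (S b * h1) h2))"
    by (simp add: D_coassoc lin_intros)
  also have "\<dots> = D sH y (\<lambda>x h2. sH (\<epsilon> x) (Q 1 h2))"
    unfolding D_antipode_left[OF Q1] ..
  also have "\<dots> = Q 1 y" by (rule D_counit_left[OF Q2])
  also have "\<dots> = D sH t (\<lambda>x z. D sH z (\<lambda>b c. sH (u c) (sH (e (y * S x)) (S b))))"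
    unfolding Q_def by (simp add: D_coassoc lin_intros del: scale_scale)
  also have "\<dots> = D sH t (\<lambda>x z. D sH z (\<lambda>b c. sH (e (y * S x)) (sH (u c) (S b))))"
    by (simp add: mult.commute)
  also have "\<dots> = D sH t (\<lambda>x z. sH (e (y * S x)) (\<sigma> u z))"
    unfolding \<sigma>_def L_def lin_sw[OF lin_antipode] lin_scale[OF lin_antipode] lin_sw[OF lin_scale_right[OF vs_H lin_id]] ..
  finally show ?thesis .
qed

end

section \<open>Finite-dimensional Hopf algebras\<close>

locale fin_hopf = hopf H for H :: "('k::field, 'h::{ring, monoid_mult}) hopf" +
  fixes B :: "'h set"
  assumes fin: "finite_dimensional_vector_space (hscale H) B"

sublocale fin_hopf \<subseteq> V: finite_dimensional_vector_space "hscale H" B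
  by (rule fin)

sublocale fin_hopf \<subseteq> F: vector_space "fscl (hscale H) :: 'k \<Rightarrow> ('h \<Rightarrow> 'h) \<Rightarrow> 'h \<Rightarrow> 'h"
  by (rule vs_fscl[OF vs_H])

context fin_hopf
begin

lemmas vs_F = F.vector_space_axioms

abbreviation "sF \<equiv> (fscl sH :: 'k \<Rightarrow> ('h \<Rightarrow> 'h) \<Rightarrow> 'h \<Rightarrow> 'h)"

definition e :: "'h \<Rightarrow> 'h \<Rightarrow> 'k" where
  "e t y = V.representation B y t"

lemma lin_e: "lin sH (*) (e t)"
  using V.linear_representation[OF V.independent_Basis V.span_Basis, of t]
  by (simp add: e_def[abs_def] linear_iff_lin)

lemmas lin_e' [lin_intros] = lin_e lin_comp[OF lin_e]

lemma sum_coords: "(\<Sum>s\<in>B. sH (e s z) s) = z"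
  unfolding e_def
  by (rule V.sum_representation_eq[OF V.independent_Basis _ V.finite_Basis subset_refl]) (simp add: V.span_Basis)

lemma e_basis: "t \<in> B \<Longrightarrow> e s t = (if s = t then 1 else 0)"
  unfolding e_def by (simp add: V.representation_basis[OF V.independent_Basis])

lemma e_outside: "t \<notin> B \<Longrightarrow> e t y = 0"
  unfolding e_def using V.representation_ne_zero by blast

text \<open>The tensor with terms \<open>L (e t) y \<otimes> t\<close> is \<Delta>(y) with its
  second leg expanded in the basis.\<close>

lemma sum_L_coords:
  assumes b: "bil sH sH sH \<beta>"
  shows "(\<Sum>t\<in>B. \<beta> (L (e t) y) t) = D sH y \<beta>"
proof -
  have "(\<Sum>t\<in>B. \<beta> (L (e t) y) t) = (\<Sum>t\<in>B. D sH y (\<lambda>b h. sH (e t h) (\<beta> b t)))"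
    unfolding L_def lin_sw[OF bilD1[OF b]] lin_scale[OF bilD1[OF b]] ..
  also have "\<dots> = D sH y (\<lambda>b h. \<Sum>t\<in>B. sH (e t h) (\<beta> b t))"
    by (rule sw_sum[OF vs_H, symmetric])
  also have "\<dots> = D sH y (\<lambda>b h. \<beta> b (\<Sum>t\<in>B. sH (e t h) t))"
    unfolding lin_sum[OF bilD2[OF b]] lin_scale[OF bilD2[OF b]] ..
  finally show ?thesis unfolding sum_coords .
qed

text \<open>A function \<open>v\<close> supported on the basis \<open>B\<close> stands for the tensor with terms \<open>v t \<otimes> t\<close> (\<open>t \<in> B\<close>) in \<open>H \<otimes> H\<close>.\<close>

abbreviation "full \<equiv> (supported B UNIV :: ('h \<Rightarrow> 'h) set)"

lemma fin_H: "X \<subseteq> V.span B"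
  by (simp add: V.span_Basis)

definition full_gens :: "('h \<Rightarrow> 'h) set" where "full_gens = (\<Union>t\<in>B. fsingle t ` B)"

lemma finite_full_gens: "finite full_gens"
  unfolding full_gens_def by (simp add: V.finite_Basis)

lemma fin_F: "M \<subseteq> full \<Longrightarrow> M \<subseteq> F.span full_gens"
  using supported_fin_dim[OF vs_H V.finite_Basis V.finite_Basis fin_H, of UNIV] unfolding full_gens_def by blast

lemma supported_mono: "X \<subseteq> Y \<Longrightarrow> supported B X \<subseteq> supported B Y"
  by (auto simp: supported_def)

lemma dim_supp: "V.subspace X \<Longrightarrow> F.dim (supported B X) = card B * V.dim X"
  by (rule dim_supported[OF vs_H V.finite_Basis V.finite_Basis fin_H])

definition ft :: "(('h \<Rightarrow> 'h) \<Rightarrow> 'k) \<Rightarrow> 'h \<Rightarrow> 'h \<Rightarrow> 'k" where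
  "ft f t h = f (fsingle t h)"

lemma lin_ft: "lin sF (*) f \<Longrightarrow> lin sH (*) (ft f t)"
  unfolding ft_def[abs_def] by (rule lin_comp[OF _ lin_fsingle[OF vs_H]])

lemma functional_decompose:
  assumes "lin sF (*) f" "v \<in> full" shows "f v = (\<Sum>t\<in>B. ft f t (v t))"
  using lin_sum[OF assms(1), of "\<lambda>t. fsingle t (v t)" B] supported_decompose[OF V.finite_Basis assms(2)]
  by (simp add: ft_def)

text \<open>A comodule map into H is determined by its composite with \<epsilon>, and any functional
  occurs; \<open>phiF f\<close> is the comodule map belonging to f.\<close>

definition phiF :: "(('h \<Rightarrow> 'h) \<Rightarrow> 'k) \<Rightarrow> ('h \<Rightarrow> 'h) \<Rightarrow> 'h" where
  "phiF f v = (\<Sum>t\<in>B. L (ft f t) (v t))"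

text \<open>The companion of \<open>phiF f\<close> on the elements y that encode coinvariants as
  \<open>S(y_1) \<otimes> y_2\<close>; see \<open>phiF_sigma\<close>.\<close>

definition PhiF :: "(('h \<Rightarrow> 'h) \<Rightarrow> 'k) \<Rightarrow> ('h \<Rightarrow> 'h) \<Rightarrow> 'h" where
  "PhiF f y = (\<Sum>t\<in>B. R (\<lambda>x. ft f t (S x)) (y t))"

lemma lin_phiF: "lin sF (*) f \<Longrightarrow> lin sF sH (phiF f)"
  unfolding phiF_def[abs_def] by (intro lin_sumI vs_H lin_comp[OF lin_L] lin_ft lin_eval)

lemma lin_PhiF: "lin sF (*) f \<Longrightarrow> lin sF sH (PhiF f)"
  unfolding PhiF_def[abs_def]
  by (intro lin_sumI vs_H lin_comp[OF self.lin_slice] lin_comp[OF lin_ft lin_antipode] lin_eval)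

lemma counit_phiF:
  assumes f: "lin sF (*) f" and v: "v \<in> full" shows "\<epsilon> (phiF f v) = f v"
  unfolding phiF_def lin_sum[OF lin_counit] counit_L[OF lin_ft[OF f]] functional_decompose[OF f v] ..

lemma map_full: "lin sH sH g \<Longrightarrow> v \<in> full \<Longrightarrow> (\<lambda>t. g (v t)) \<in> full"
  by (auto simp: supported_def lin_zero)

lemma form_phiF:
  assumes f: "lin sF (*) f" and d: "lin sH (*) d" and v: "v \<in> full"
  shows "d (phiF f v) = f (\<lambda>t. R d (v t))"
proof -
  have "ft f t (R d x) = d (L (ft f t) x)" for t x
    unfolding self.lin_form_slice[OF lin_ft[OF f]] form_L[OF d] by (simp add: mult.commute)
  then show ?thesis
    unfolding phiF_def lin_sum[OF d] functional_decompose[OF f map_full[OF self.lin_slice[OF d] v]] by simp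
qed

lemma R_phiF:
  assumes f: "lin sF (*) f" and d: "lin sH (*) d"
  shows "R d (phiF f v) = phiF f (\<lambda>t. R d (v t))"
  unfolding phiF_def lin_sum[OF self.lin_slice[OF d]] R_L[OF d lin_ft[OF f]] ..

lemma phiF_sigma:
  assumes f: "lin sF (*) f" and u: "lin sH (*) u"
  shows "phiF f (\<lambda>t. \<sigma> u (y t)) = \<sigma> u (PhiF f y)"
  unfolding phiF_def PhiF_def lin_sum[OF lin_sigma[OF u]] L_sigma[OF lin_ft[OF f] u] ..

text \<open>\<open>q \<otimes> h \<mapsto> q h\<^sub>1 \<otimes> h\<^sub>2\<close>, which trivialises the diagonal coaction on the second factor.\<close>

definition twist :: "('h \<Rightarrow> 'h) \<Rightarrow> 'h \<Rightarrow> 'h" where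
  "twist v = (\<lambda>s. \<Sum>t\<in>B. v t * L (e s) t)"

text \<open>This is \<open>q \<otimes> h \<mapsto> q S(h_1) \<otimes> h_2\<close>.\<close>

definition untwist :: "('h \<Rightarrow> 'h) \<Rightarrow> 'h \<Rightarrow> 'h" where
  "untwist w = (\<lambda>s. \<Sum>t\<in>B. w t * \<sigma> (e s) t)"

lemma L_e_outside: "s \<notin> B \<Longrightarrow> L (e s) t = 0"
  using sw_zero[OF vs_H] by (simp add: L_def e_outside)

lemma lin_twist: "lin sF sF twist"
  using k_algebra_H by (auto simp: lin_def twist_def fscl_def fun_eq_iff sum.distrib algebra_simps k_algebra_def V.scale_sum_right)

lemma twist_full: "twist v \<in> full"
  by (simp add: supported_def twist_def L_e_outside)

lemma untwist_twist: assumes v: "v \<in> full" shows "untwist (twist v) = v"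
proof
  fix s
  have "untwist (twist v) s = (\<Sum>t\<in>B. \<Sum>r\<in>B. v r * (L (e t) r * \<sigma> (e s) t))"
    by (simp add: untwist_def twist_def sum_distrib_right mult.assoc)
  also have "\<dots> = (\<Sum>r\<in>B. v r * (\<Sum>t\<in>B. L (e t) r * \<sigma> (e s) t))"
    by (subst sum.swap) (simp add: sum_distrib_left)
  also have "\<dots> = (\<Sum>r\<in>B. v r * sH (e s r) 1)"
  proof (rule sum.cong[OF refl])
    fix r
    have "bil sH sH sH (\<lambda>x z. x * \<sigma> (e s) z)"
      by (rule bilI; intro lin_intros lin_comp[OF lin_sigma])
    from sum_L_coords[OF this, of r]
    show "v r * (\<Sum>t\<in>B. L (e t) r * \<sigma> (e s) t) = v r * sH (e s r) 1"
      by (simp add: conv_antipode_L[OF lin_e])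
  qed
  also have "\<dots> = (\<Sum>r\<in>B. if r = s then v s else 0)"
    by (rule sum.cong) (use k_algebra_H in \<open>auto simp: e_basis k_algebra_def\<close>)
  also have "\<dots> = v s" using v V.finite_Basis by (auto simp: supported_def)
  finally show "untwist (twist v) s = v s" .
qed

lemma twist_inj: "v \<in> full \<Longrightarrow> twist v = 0 \<Longrightarrow> v = 0"
  using untwist_twist[of v] by (auto simp: untwist_def)

text \<open>\<open>y \<otimes> t \<mapsto> y S(t\<^sub>1) \<otimes> t\<^sub>2\<close>; here the first factor of the image is expanded in \<open>B\<close>.\<close>

definition cotwist :: "('h \<Rightarrow> 'h) \<Rightarrow> 'h \<Rightarrow> 'h" where
  "cotwist w = (\<lambda>s. \<Sum>t\<in>B. D sH t (\<lambda>x z. sH (e s (w t * S x)) z))"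

lemma lin_cotwist: "lin sF sF cotwist"
proof -
  have "lin sF sH (\<lambda>w. cotwist w s)" for s
    unfolding cotwist_def by (intro lin_intros lin_comp[OF lin_e] lin_eval)
  then show ?thesis by (auto simp: lin_def fscl_def fun_eq_iff)
qed

lemma cotwist_full: "cotwist w \<in> full"
proof -
  have "cotwist w s = 0" if "s \<notin> B" for s
    unfolding cotwist_def e_outside[OF that] V.scale_zero_left sw_zero[OF vs_H] by simp
  then show ?thesis by (simp add: supported_def)
qed

text \<open>Multiplying by the next leg turns \<open>y S(t_1) t_2 \<otimes> t_3\<close> back into
  \<open>y \<otimes> t\<close>.\<close>

lemma cotwist_inverse:
  assumes w: "w \<in> full" shows "(\<Sum>s\<in>B. s * L (e r) (cotwist w s)) = w r"
proof -
  have "(\<Sum>s\<in>B. s * L (e r) (cotwist w s)) = (\<Sum>s\<in>B. \<Sum>t\<in>B. D sH t (\<lambda>x z. s * sH (e s (w t * S x)) (L (e r) z)))"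
    unfolding cotwist_def lin_sum[OF lin_L[OF lin_e]] lin_sw[OF lin_L[OF lin_e]] lin_scale[OF lin_L[OF lin_e]] sum_distrib_left
      lin_sw[OF lin_mult_right[OF k_algebra_H lin_id]] ..
  also have "\<dots> = (\<Sum>t\<in>B. D sH t (\<lambda>x z. \<Sum>s\<in>B. s * sH (e s (w t * S x)) (L (e r) z)))"
    unfolding sw_sum[OF vs_H] by (rule sum.swap)
  also have "\<dots> = (\<Sum>t\<in>B. D sH t (\<lambda>x z. (\<Sum>s\<in>B. sH (e s (w t * S x)) s) * L (e r) z))"
    using k_algebra_H by (simp add: sum_distrib_right k_algebra_def)
  also have "\<dots> = (\<Sum>t\<in>B. w t * D sH t (\<lambda>x z. S x * L (e r) z))"
    unfolding sum_coords lin_sw[OF lin_mult_right[OF k_algebra_H lin_id]] mult.assoc ..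
  also have "\<dots> = (\<Sum>t\<in>B. w t * sH (e r t) 1)"
    unfolding conv_antipode_L'[OF lin_e] ..
  also have "\<dots> = (\<Sum>t\<in>B. if t = r then w r else 0)"
    by (rule sum.cong) (use k_algebra_H in \<open>auto simp: e_basis k_algebra_def\<close>)
  also have "\<dots> = w r" using w V.finite_Basis by (auto simp: supported_def)
  finally show ?thesis .
qed

lemma cotwist_inj: "w \<in> full \<Longrightarrow> cotwist w = 0 \<Longrightarrow> w = 0"
  using cotwist_inverse[of w] by (auto simp: fun_eq_iff lin_zero[OF lin_L[OF lin_e]])

text \<open>\<open>S(y_1) y_2 \<otimes> y_3 = 1 \<otimes> y\<close>: twisting a coinvariant leaves
  multiples of 1, the source of trivial subcomodules.\<close>

lemma twist_sigma: "twist (\<lambda>t. if t \<in> B then \<sigma> (e t) y else 0) = (\<lambda>s. sH (e s y) 1)"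
proof
  fix s
  have "bil sH sH sH (\<lambda>x z. S x * L (e s) z)" by (rule bilI; intro lin_intros)
  from sum_L_coords[OF this, of y] show "twist (\<lambda>t. if t \<in> B then \<sigma> (e t) y else 0) s = sH (e s y) 1"
    by (simp add: twist_def \<sigma>_def conv_antipode_L'[OF lin_e])
qed

text \<open>Each \<open>w' r t\<close> is again a functional. So if the entries of w lie in
  \<open>sol X\<close>, the right-hand side is the twist of a family in X, and
  \<open>cotwist w\<close> is a solution for the twist of \<open>X \<otimes> H\<close>.\<close>

lemma sigma_cotwist:
  assumes u: "lin sH (*) u"
  defines "w' \<equiv> \<lambda>r t z. D (*) t (\<lambda>a c. u c * e r (z * S a))"
  shows "(\<lambda>s. \<sigma> u (cotwist w s)) = twist (\<lambda>r. \<Sum>t\<in>B. \<sigma> (w' r t) (w t))"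
proof
  fix s
  have "(\<Sum>r\<in>B. \<sigma> (w' r t) y * L (e s) r) = D sH t (\<lambda>x z. sH (e s (y * S x)) (\<sigma> u z))" for t y
  proof -
    have "(\<Sum>r\<in>B. \<sigma> (w' r t) y * L (e s) r) =
       (\<Sum>r\<in>B. D sH y (\<lambda>b h. D sH t (\<lambda>a c. sH (u c) (S b * sH (e r (h * S a)) (L (e s) r)))))"
    proof (rule sum.cong[OF refl])
      fix r
      have "\<sigma> (w' r t) y * L (e s) r = D sH y (\<lambda>b h. sH (w' r t h) (S b * L (e s) r))"
        unfolding \<sigma>_def L_def[of "w' r t"] lin_sw[OF lin_antipode] lin_scale[OF lin_antipode]
          lin_sw[OF lin_mult_left[OF k_algebra_H lin_id]] lin_scale[OF lin_mult_left[OF k_algebra_H lin_id]] ..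
      also have "\<dots> = D sH y (\<lambda>b h. D sH t (\<lambda>a c. sH (u c * e r (h * S a)) (S b * L (e s) r)))"
        unfolding w'_def lin_sw[of "(*)" sH "\<lambda>c. sH c z" for z, OF lin_scale_left[OF vs_H lin_id]] ..
      finally show "\<sigma> (w' r t) y * L (e s) r = D sH y (\<lambda>b h. D sH t (\<lambda>a c. sH (u c) (S b * sH (e r (h * S a)) (L (e s) r))))"
        unfolding lin_scale[OF lin_mult_right[OF k_algebra_H lin_id]] by simp
    qed
    also have "\<dots> = D sH y (\<lambda>b h. D sH t (\<lambda>a c. sH (u c) (S b * (\<Sum>r\<in>B. sH (e r (h * S a)) (L (e s) r)))))"
      unfolding sw_sum[OF vs_H, symmetric] V.scale_sum_right[symmetric] sum_distrib_left[symmetric] ..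
    also have "\<dots> = D sH y (\<lambda>b h. D sH t (\<lambda>a c. sH (u c) (S b * L (e s) (h * S a))))"
    proof -
      have "(\<Sum>r\<in>B. sH (e r x) (L (e s) r)) = L (e s) x" for x
        unfolding lin_scale[OF lin_L[OF lin_e], symmetric] lin_sum[OF lin_L[OF lin_e], symmetric] sum_coords ..
      then show ?thesis by simp
    qed
    also have "\<dots> = D sH t (\<lambda>x z. sH (e s (y * S x)) (\<sigma> u z))"
      by (rule sigma_twist[OF u lin_e])
    finally show ?thesis .
  qed
  then have "twist (\<lambda>r. \<Sum>t\<in>B. \<sigma> (w' r t) (w t)) s = (\<Sum>t\<in>B. D sH t (\<lambda>x z. sH (e s (w t * S x)) (\<sigma> u z)))"
    unfolding twist_def sum_distrib_right by (subst sum.swap) simp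
  then show "\<sigma> u (cotwist w s) = twist (\<lambda>r. \<Sum>t\<in>B. \<sigma> (w' r t) (w t)) s"
    unfolding cotwist_def lin_sum[OF lin_sigma[OF u]] lin_sw[OF lin_sigma[OF u]] lin_scale[OF lin_sigma[OF u]] by simp
qed

text \<open>Slicing a twist by d amounts to slicing beforehand by the functionals
  \<open>d (q * a)\<close>, which vanish on a right ideal if d does; so stability passes to
  twists.\<close>

lemma R_twist:
  assumes d: "lin sH (*) d"
  shows "(\<lambda>s. R d (twist v s)) = twist (\<lambda>r. \<Sum>t\<in>B. D sH t (\<lambda>a c. sH (e r c) (R (\<lambda>q. d (q * a)) (v t))))"
proof
  fix s
  note [lin_intros] = lin_comp[OF d]
  have l: "lin sH sH (\<lambda>a. R (\<lambda>q. d (q * a)) x)" for x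
    unfolding R_eq by (intro lin_intros)
  have c: "(\<Sum>r\<in>B. sH (e r x) (L (e s) r)) = L (e s) x" for x
    unfolding lin_scale[OF lin_L[OF lin_e], symmetric] lin_sum[OF lin_L[OF lin_e], symmetric] sum_coords ..
  have "(\<Sum>r\<in>B. D sH t (\<lambda>a c. sH (e r c) (R (\<lambda>q. d (q * a)) x)) * L (e s) r) = R d (x * L (e s) t)" for t x
  proof -
    have "(\<Sum>r\<in>B. D sH t (\<lambda>a c. sH (e r c) (R (\<lambda>q. d (q * a)) x)) * L (e s) r) =
      (\<Sum>r\<in>B. D sH t (\<lambda>a c. R (\<lambda>q. d (q * a)) x * sH (e r c) (L (e s) r)))"
      unfolding lin_sw[OF lin_mult_left[OF k_algebra_H lin_id]] lin_scale[OF lin_mult_left[OF k_algebra_H lin_id]]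
        lin_scale[OF lin_mult_right[OF k_algebra_H lin_id]] ..
    also have "\<dots> = D sH t (\<lambda>a c. R (\<lambda>q. d (q * a)) x * L (e s) c)"
      unfolding sw_sum[OF vs_H, symmetric] sum_distrib_left[symmetric] c ..
    also have "\<dots> = R d (x * L (e s) t)" by (rule R_mult_L[OF d lin_e, symmetric])
    finally show ?thesis .
  qed
  then have "twist (\<lambda>r. \<Sum>t\<in>B. D sH t (\<lambda>a c. sH (e r c) (R (\<lambda>q. d (q * a)) (v t)))) s = (\<Sum>t\<in>B. R d (v t * L (e s) t))"
    unfolding twist_def sum_distrib_right by (subst sum.swap) simp
  then show "R d (twist v s) = twist (\<lambda>r. \<Sum>t\<in>B. D sH t (\<lambda>a c. sH (e r c) (R (\<lambda>q. d (q * a)) (v t)))) s"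
    unfolding twist_def lin_sum[OF self.lin_slice[OF d]] by simp
qed

end

section \<open>The dimension formula for a quotient\<close>

locale fin_quot = fin_hopf H B for H :: "('k::field, 'h::{ring, monoid_mult}) hopf" and B +
  fixes I :: "'h set"
  assumes coideal: "coideal H I" and right_ideal: "right_ideal H I"
begin

lemma subI: "V.subspace I"
  using right_ideal by (simp add: right_ideal_def)

lemma counit_I: "i \<in> I \<Longrightarrow> \<epsilon> i = 0"
  using coideal by (simp add: coideal_def)

lemma mem_I_iff: "x \<in> I \<longleftrightarrow> (\<forall>u. lin sH (*) u \<and> (\<forall>i\<in>I. u i = 0) \<longrightarrow> u x = 0)"
  using span_iff_functionals[OF vs_H, of x I] unfolding V.subspace_span_eq[OF subI] .

definition dual :: "('h \<Rightarrow> 'k) \<Rightarrow> bool" where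
  "dual d \<longleftrightarrow> lin sH (*) d \<and> (\<forall>i\<in>I. d i = 0)"

lemma D_ideal:
  assumes i: "i \<in> I" and d: "dual d" and u: "dual u"
  shows "D (*) i (\<lambda>b h. d b * u h) = 0"
proof -
  have "bil sH sH (*) (\<lambda>b h. d b * u h)"
    by (rule bilI; intro lin_intros) (use d u in \<open>auto simp: dual_def\<close>)
  moreover have "\<forall>i\<in>I. \<forall>h. d i * u h = 0 \<and> d h * u i = 0" using d u by (simp add: dual_def)
  ultimately show ?thesis using coideal[unfolded coideal_iff[OF subI]] i by blast
qed

lemma R_mem_I: assumes i: "i \<in> I" and d: "dual d" shows "R d i \<in> I"
  unfolding mem_I_iff dual_def[symmetric]
proof (intro allI impI)
  fix u assume u: "dual u"
  then have "u (R d i) = D (*) i (\<lambda>b h. d b * u h)" by (intro self.lin_form_slice) (simp add: dual_def)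
  then show "u (R d i) = 0" using D_ideal[OF i d u] by simp
qed

lemma L_mem_I: assumes i: "i \<in> I" and d: "dual d" shows "L d i \<in> I"
  unfolding mem_I_iff dual_def[symmetric]
proof (intro allI impI)
  fix u assume u: "dual u"
  then have "u (L d i) = D (*) i (\<lambda>b h. d h * u b)" by (intro form_L) (simp add: dual_def)
  then show "u (L d i) = 0" using D_ideal[OF i u d] by (simp add: mult.commute)
qed

text \<open>\<open>X / I\<close> is a subcomodule of H/I for the coaction induced by \<Delta>, and
  the maps \<open>R d\<close> are the slices of that coaction. Full preimages in H are used in place
  of quotient spaces; \<open>stableF\<close> treats subcomodules of several copies of H/I in the
  same way.\<close>

definition stable :: "'h set \<Rightarrow> bool" where
  "stable X \<longleftrightarrow> V.subspace X \<and> I \<subseteq> X \<and> (\<forall>d x. dual d \<longrightarrow> x \<in> X \<longrightarrow> R d x \<in> X)"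

definition stableF :: "('h \<Rightarrow> 'h) set \<Rightarrow> bool" where
  "stableF M \<longleftrightarrow> F.subspace M \<and> supported B I \<subseteq> M \<and> M \<subseteq> full \<and>
     (\<forall>d v. dual d \<longrightarrow> v \<in> M \<longrightarrow> (\<lambda>t. R d (v t)) \<in> M)"

text \<open>\<open>y \<mapsto> S y\<^sub>1 \<otimes> y\<^sub>2\<close> identifies \<open>sol X\<close> with the \<open>H / I\<close>-coinvariants of \<open>X / I \<otimes> H\<close> (diagonal coaction),
  and similarly for \<open>solF M\<close>, where \<open>M\<close> is a subcomodule of several copies of \<open>H\<close>.\<close>

definition sol :: "'h set \<Rightarrow> 'h set" where
  "sol X = {y. \<forall>u. lin sH (*) u \<longrightarrow> \<sigma> u y \<in> X}"

definition solF :: "('h \<Rightarrow> 'h) set \<Rightarrow> ('h \<Rightarrow> 'h) set" where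
  "solF M = {y \<in> full. \<forall>u. lin sH (*) u \<longrightarrow> (\<lambda>t. \<sigma> u (y t)) \<in> M}"

lemma sol_subspace: assumes X: "V.subspace X" shows "V.subspace (sol X)"
  unfolding V.subspace_def
  using V.subspace_0[OF X] V.subspace_add[OF X] V.subspace_scale[OF X]
  by (auto simp: sol_def lin_zero[OF lin_sigma] lin_add[OF lin_sigma] lin_scale[OF lin_sigma])

lemma full_subspace: "F.subspace full"
  by (rule supported_subspace[OF vs_H V.subspace_UNIV])

lemma solF_subspace: assumes M: "F.subspace M" shows "F.subspace (solF M)"
proof -
  have l: "lin sF sF (\<lambda>y t. \<sigma> u (y t))" if "lin sH (*) u" for u
    using lin_sigma[OF that] by (auto simp: lin_def fscl_def fun_eq_iff)
  have "(\<lambda>t. \<sigma> u ((x + y) t)) \<in> M"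
    if "lin sH (*) u" "(\<lambda>t. \<sigma> u (x t)) \<in> M" "(\<lambda>t. \<sigma> u (y t)) \<in> M" for u x y
    unfolding lin_add[OF l[OF that(1)]] by (rule F.subspace_add[OF M that(2,3)])
  moreover have "(\<lambda>t. \<sigma> u (fscl sH c x t)) \<in> M"
    if "lin sH (*) u" "(\<lambda>t. \<sigma> u (x t)) \<in> M" for u x c
    unfolding lin_scale[OF l[OF that(1)]] by (rule F.subspace_scale[OF M that(2)])
  moreover have "(\<lambda>t. \<sigma> u ((0 :: 'h \<Rightarrow> 'h) t)) \<in> M" if "lin sH (*) u" for u
    unfolding lin_zero[OF l[OF that]] by (rule F.subspace_0[OF M])
  ultimately show ?thesis
    using F.subspace_0[OF full_subspace] F.subspace_add[OF full_subspace] F.subspace_scale[OF full_subspace]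
    unfolding F.subspace_def solF_def by blast
qed

lemma stableF_D: assumes "stableF M"
  shows "F.subspace M" "supported B I \<subseteq> M" "M \<subseteq> full" "\<And>d v. dual d \<Longrightarrow> v \<in> M \<Longrightarrow> (\<lambda>t. R d (v t)) \<in> M"
  using assms by (auto simp: stableF_def)

lemma V_dim_mono: "U \<subseteq> W \<Longrightarrow> V.dim U \<le> V.dim W"
  by (rule V.dim_subset)

lemma F_dim_mono: "U \<subseteq> W \<Longrightarrow> W \<subseteq> full \<Longrightarrow> F.dim U \<le> F.dim W"
  by (rule F.dim_mono_span[OF finite_full_gens fin_F])

lemma ft_dual:
  assumes f: "lin sF (*) f" and f0: "\<And>v. v \<in> supported B I \<Longrightarrow> f v = 0" and t: "t \<in> B"
  shows "dual (ft f t)"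
  unfolding dual_def using lin_ft[OF f]
proof (intro conjI ballI)
  fix i assume "i \<in> I"
  then have "fsingle t i \<in> supported B I" using t V.subspace_0[OF subI] by (auto simp: supported_def fsingle_def)
  then show "ft f t i = 0" unfolding ft_def by (rule f0)
qed

lemma phiF_supported_I:
  assumes f: "lin sF (*) f" and f0: "\<And>v. v \<in> supported B I \<Longrightarrow> f v = 0" and v: "v \<in> supported B I"
  shows "phiF f v \<in> I"
  unfolding phiF_def
  by (rule V.subspace_sum[OF subI]) (use v L_mem_I ft_dual[OF f f0] in \<open>auto simp: supported_def\<close>)

text \<open>Left exactness of \<open>M \<mapsto> solF M\<close> for the colinear map \<open>phiF f\<close> into \<open>H / I\<close>.\<close>

lemma exact_step:
  assumes M: "stableF M" and f: "lin sF (*) f" and f0: "\<And>v. v \<in> supported B I \<Longrightarrow> f v = 0"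
  defines "M' \<equiv> {v \<in> M. phiF f v \<in> I}" and "X \<equiv> {phiF f v + i | v i. v \<in> M \<and> i \<in> I}"
  shows "stableF M'" "stable X" "F.dim M + V.dim I = F.dim M' + V.dim X"
    "F.dim (solF M) \<le> F.dim (solF M') + V.dim (sol X)"
proof -
  note l = lin_phiF[OF f]
  note MD = stableF_D[OF M]
  show "stableF M'"
    unfolding stableF_def F.subspace_def
  proof (intro conjI ballI allI impI)
    show "0 \<in> M'" using F.subspace_0[OF MD(1)] V.subspace_0[OF subI] by (simp add: M'_def lin_zero[OF l])
    show "supported B I \<subseteq> M'" using MD(2) phiF_supported_I[OF f f0] by (auto simp: M'_def)
    show "M' \<subseteq> full" using MD(3) by (auto simp: M'_def)
    fix x y c assume x: "x \<in> M'"
    show "fscl sH c x \<in> M'" using x F.subspace_scale[OF MD(1)] V.subspace_scale[OF subI]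
      by (simp add: M'_def lin_scale[OF l])
    assume y: "y \<in> M'"
    show "x + y \<in> M'" using x y F.subspace_add[OF MD(1)] V.subspace_add[OF subI]
      by (simp add: M'_def lin_add[OF l])
  next
    fix d v assume d: "dual d" and v: "v \<in> M'"
    have "phiF f (\<lambda>t. R d (v t)) = R d (phiF f v)"
      by (rule R_phiF[OF f, symmetric]) (use d in \<open>simp add: dual_def\<close>)
    then show "(\<lambda>t. R d (v t)) \<in> M'" using v MD(4)[OF d] R_mem_I[OF _ d] by (simp add: M'_def)
  qed
  have XI: "I \<subseteq> X"
    using F.subspace_0[OF MD(1)] lin_zero[OF l] by (force simp: X_def)
  have subX: "V.subspace X"
  proof -
    have "X = {x + y |x y. x \<in> phiF f ` M \<and> y \<in> I}" by (auto simp: X_def)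
    then show ?thesis
      using V.subspace_sums[OF lin_image_subspace[OF vs_F vs_H l MD(1)] subI] by simp
  qed
  show "stable X" unfolding stable_def
  proof (intro conjI allI impI XI subX)
    fix d x assume d: "dual d" and "x \<in> X"
    then obtain v i where x: "x = phiF f v + i" and v: "v \<in> M" and i: "i \<in> I" by (auto simp: X_def)
    have ld: "lin sH (*) d" using d by (simp add: dual_def)
    have "R d x = phiF f (\<lambda>t. R d (v t)) + R d i"
      unfolding x lin_add[OF self.lin_slice[OF ld]] R_phiF[OF f ld] ..
    then show "R d x \<in> X" using MD(4)[OF d v] R_mem_I[OF i d] by (auto simp: X_def)
  qed
  \<comment> \<open>\<open>p\<close> replaces the quotient map to H/I. Rank-nullity is applied to
    \<open>p\<close> on X and to its composite with \<open>phiF f\<close> on M, which have the same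
    image.\<close>
  obtain p where p: "lin sH sH p" "\<And>x. p x = 0 \<longleftrightarrow> x \<in> I"
    using V.exists_linear_with_kernel[OF subI] by blast
  have "F.dim M = F.dim {v \<in> M. p (phiF f v) = 0} + V.dim ((\<lambda>v. p (phiF f v)) ` M)"
    by (rule rank_nullity[OF vs_F vs_H lin_comp[OF p(1) l] MD(1) finite_full_gens fin_F[OF MD(3)]])
  moreover have "{v \<in> M. p (phiF f v) = 0} = M'" by (simp add: M'_def p(2))
  moreover have "V.dim X = V.dim {x \<in> X. p x = 0} + V.dim (p ` X)"
    by (rule rank_nullity[OF vs_H vs_H p(1) subX V.finite_Basis fin_H])
  moreover have "{x \<in> X. p x = 0} = I" using XI by (auto simp: p(2))
  moreover have "p ` X = (\<lambda>v. p (phiF f v)) ` M"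
  proof -
    have "p (phiF f v + i) = p (phiF f v)" if "i \<in> I" for v i
      using that by (simp add: lin_add[OF p(1)] p(2)[THEN iffD2])
    then show ?thesis using V.subspace_0[OF subI] unfolding X_def by (auto simp: image_iff) (metis add.right_neutral)
  qed
  ultimately show "F.dim M + V.dim I = F.dim M' + V.dim X" by simp
  \<comment> \<open>By \<open>phiF_sigma\<close>, the kernel of \<open>PhiF f\<close> on
    \<open>solF M\<close> lies in \<open>solF M'\<close> and its image in
    \<open>sol X\<close>.\<close>
  have "F.dim (solF M) = F.dim {y \<in> solF M. PhiF f y = 0} + V.dim (PhiF f ` solF M)"
    by (rule rank_nullity[OF vs_F vs_H lin_PhiF[OF f] solF_subspace[OF MD(1)] finite_full_gens fin_F])
       (auto simp: solF_def)
  moreover have "F.dim {y \<in> solF M. PhiF f y = 0} \<le> F.dim (solF M')"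
  proof (rule F_dim_mono)
    show "{y \<in> solF M. PhiF f y = 0} \<subseteq> solF M'"
      using V.subspace_0[OF subI] by (auto simp: solF_def M'_def phiF_sigma[OF f] lin_zero[OF lin_sigma])
    show "solF M' \<subseteq> full" by (auto simp: solF_def)
  qed
  moreover have "V.dim (PhiF f ` solF M) \<le> V.dim (sol X)"
  proof (rule V_dim_mono, safe)
    fix y assume y: "y \<in> solF M"
    show "PhiF f y \<in> sol X" unfolding sol_def
    proof safe
      fix u :: "'h \<Rightarrow> 'k" assume u: "lin sH (*) u"
      have "\<sigma> u (PhiF f y) = phiF f (\<lambda>t. \<sigma> u (y t)) + 0" by (simp add: phiF_sigma[OF f u])
      moreover have "(\<lambda>t. \<sigma> u (y t)) \<in> M" using y u by (simp add: solF_def)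
      ultimately show "\<sigma> u (PhiF f y) \<in> X" using V.subspace_0[OF subI] unfolding X_def by blast
    qed
  qed
  ultimately show "F.dim (solF M) \<le> F.dim (solF M') + V.dim (sol X)" by simp
qed

definition rk :: "'h set \<Rightarrow> real" where
  "rk X = real (V.dim X) - real (V.dim I)"

lemma rk_pos: assumes "stable X" "X \<noteq> I" shows "rk X > 0"
proof -
  have "V.dim I < V.dim X"
    using V.dim_eq_span_subset[OF V.finite_Basis fin_H _ subI, of X] assms
    by (force simp: stable_def not_less)
  then show ?thesis by (simp add: rk_def)
qed

text \<open>The defect of \<open>N \<subseteq> M\<close> is bounded by mapping \<open>M / N\<close> to \<open>H / I\<close> along functionals vanishing on \<open>N\<close>.\<close>

lemma dim_solF_bound:
  assumes \<rho>: "\<And>X. stable X \<Longrightarrow> X \<noteq> I \<Longrightarrow> real (V.dim (sol X)) \<le> \<rho> * rk X"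
    and N: "stableF N" and M: "stableF M" "N \<subseteq> M"
  shows "real (F.dim (solF M)) \<le> real (F.dim (solF N)) + \<rho> * (real (F.dim M) - real (F.dim N))"
  using M
proof (induction "F.dim M" arbitrary: M rule: less_induct)
  case less
  note MD = stableF_D[OF less.prems(1)] and ND = stableF_D[OF N]
  show ?case
  proof (cases "M = N")
    case False
    then obtain v where v: "v \<in> M" "v \<notin> F.span N"
      using less.prems(2) unfolding F.subspace_span_eq[OF ND(1)] by blast
    \<comment> \<open>\<open>phiF f\<close> does not map v into I, since \<epsilon> recovers f; but
      it maps N into I, since N is stable and f vanishes on N. Hence M' is properly smaller than M
      and still contains N.\<close>
    from separating_functional[OF vs_F v(2)]
    obtain f where f: "lin sF (*) f" "\<And>y. y \<in> N \<Longrightarrow> f y = 0" "f v = (1::'k)" by metis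
    have f0: "f w = 0" if "w \<in> supported B I" for w using that ND(2) f(2) by blast
    define M' where "M' = {v \<in> M. phiF f v \<in> I}"
    define X where "X = {phiF f v + i | v i. v \<in> M \<and> i \<in> I}"
    note step = exact_step[OF less.prems(1) f(1) f0, folded M'_def X_def]
    have vI: "phiF f v \<notin> I"
      using counit_phiF[OF f(1)] v(1) MD(3) f(3) counit_I by force
    have "phiF f n \<in> I" if n: "n \<in> N" for n
      unfolding mem_I_iff dual_def[symmetric]
    proof (intro allI impI)
      fix d assume d: "dual d"
      then have "d (phiF f n) = f (\<lambda>t. R d (n t))"
        using n ND(3) by (intro form_phiF[OF f(1)]) (auto simp: dual_def)
      also have "\<dots> = 0" by (rule f(2)[OF ND(4)[OF d n]])
      finally show "d (phiF f n) = 0" .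
    qed
    then have NM': "N \<subseteq> M'" using less.prems(2) by (auto simp: M'_def)
    have "phiF f v + 0 \<in> X" using v(1) V.subspace_0[OF subI] unfolding X_def by blast
    then have XI: "X \<noteq> I" using vI by auto
    have "rk X > 0" by (rule rk_pos[OF step(2) XI])
    then have "F.dim M' < F.dim M" using step(3) by (simp add: rk_def)
    from less.hyps[OF this step(1) NM']
    have "real (F.dim (solF M')) \<le> real (F.dim (solF N)) + \<rho> * (real (F.dim M') - real (F.dim N))" .
    moreover have "real (F.dim (solF M)) \<le> real (F.dim (solF M')) + real (V.dim (sol X))"
      using step(4) by linarith
    moreover have "real (V.dim (sol X)) \<le> \<rho> * rk X" by (rule \<rho>[OF step(2) XI])
    moreover have "rk X = real (F.dim M) - real (F.dim M')" using step(3) unfolding rk_def by linarith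
    ultimately show ?thesis by (simp add: algebra_simps)
  qed simp
qed

text \<open>One inclusion is the right ideal property; equality follows by counting dimensions, as
  \<open>twist\<close> is injective there.\<close>

lemma twist_supported_I: "twist ` supported B I = supported B I"
proof -
  have "twist v \<in> supported B I" if "v \<in> supported B I" for v
    using that right_ideal twist_full[of v] V.subspace_0[OF subI]
    by (auto simp: supported_def twist_def right_ideal_def intro!: V.subspace_sum[OF subI])
  then have s: "twist ` supported B I \<subseteq> supported B I" by blast
  have sf: "supported B I \<subseteq> full" by (rule supported_mono) simp
  have sub: "F.subspace (supported B I)" by (rule supported_subspace[OF vs_H subI])
  have "F.dim (twist ` supported B I) = F.dim (supported B I)"
    by (rule dim_image_inj[OF vs_F vs_F lin_twist sub finite_full_gens fin_F[OF sf]])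
       (use twist_inj sf in blast)
  then show ?thesis
    using F.dim_eq_span_subset[OF finite_full_gens fin_F[OF sf] s lin_image_subspace[OF vs_F vs_F lin_twist sub]]
    by simp
qed

lemma stable_D: assumes "stable X"
  shows "V.subspace X" "I \<subseteq> X" "\<And>d x. dual d \<Longrightarrow> x \<in> X \<Longrightarrow> R d x \<in> X"
  using assms by (auto simp: stable_def)

lemma stableF_twist:
  assumes X: "stable X" shows "stableF (twist ` supported B X)"
  unfolding stableF_def
proof (intro conjI allI impI)
  note XD = stable_D[OF X]
  show "F.subspace (twist ` supported B X)"
    by (rule lin_image_subspace[OF vs_F vs_F lin_twist supported_subspace[OF vs_H XD(1)]])
  show "supported B I \<subseteq> twist ` supported B X"
    using twist_supported_I supported_mono[OF XD(2)] by blast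
  show "twist ` supported B X \<subseteq> full" using twist_full by blast
  fix d w assume d: "dual d" and "w \<in> twist ` supported B X"
  then obtain v where w: "w = twist v" and v: "v \<in> supported B X" by blast
  have ld: "lin sH (*) d" using d by (simp add: dual_def)
  let ?v = "\<lambda>r. \<Sum>t\<in>B. D sH t (\<lambda>a c. sH (e r c) (R (\<lambda>q. d (q * a)) (v t)))"
  have "dual (\<lambda>q. d (q * a))" for a
    using d right_ideal lin_comp[OF ld lin_mult_left[OF k_algebra_H lin_id]] by (auto simp: dual_def right_ideal_def)
  then have "R (\<lambda>q. d (q * a)) (v t) \<in> X" for a t using v XD(3) by (simp add: supported_def)
  then have "?v r \<in> X" for r
    by (intro V.subspace_sum[OF XD(1)] sw_mem[OF vs_H XD(1)] V.subspace_scale[OF XD(1)])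
  moreover have "?v r = 0" if "r \<notin> B" for r
    unfolding e_outside[OF that] V.scale_zero_left sw_zero[OF vs_H] by simp
  ultimately have "?v \<in> supported B X" by (simp add: supported_def)
  then show "(\<lambda>t. R d (w t)) \<in> twist ` supported B X"
    unfolding w R_twist[OF ld] by blast
qed

lemma dim_twist: assumes X: "stable X" shows "F.dim (twist ` supported B X) = card B * V.dim X"
proof -
  have sf: "supported B X \<subseteq> full" by (rule supported_mono) simp
  have "F.dim (twist ` supported B X) = F.dim (supported B X)"
    by (rule dim_image_inj[OF vs_F vs_F lin_twist supported_subspace[OF vs_H stable_D(1)[OF X]] finite_full_gens fin_F[OF sf]])
       (use twist_inj sf in blast)
  then show ?thesis by (simp add: dim_supp[OF stable_D(1)[OF X]])
qed

text \<open>\<open>cotwist\<close> embeds \<open>sol X \<otimes> H\<close> into the solutions for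
  \<open>X \<otimes> H\<close>. The lower bound suffices, because maximality of the ratio supplies
  the upper one.\<close>

lemma dim_solF_twist:
  assumes X: "stable X" shows "card B * V.dim (sol X) \<le> F.dim (solF (twist ` supported B X))"
proof -
  note XD = stable_D[OF X]
  have sf: "supported B (sol X) \<subseteq> full" by (rule supported_mono) simp
  have "card B * V.dim (sol X) = F.dim (supported B (sol X))"
    by (rule dim_supp[OF sol_subspace[OF XD(1)], symmetric])
  also have "\<dots> = F.dim (cotwist ` supported B (sol X))"
    by (rule dim_image_inj[OF vs_F vs_F lin_cotwist supported_subspace[OF vs_H sol_subspace[OF XD(1)]] finite_full_gens fin_F[OF sf], symmetric])
       (use cotwist_inj sf in blast)
  also have "\<dots> \<le> F.dim (solF (twist ` supported B X))"
  proof (rule F_dim_mono, safe)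
    fix w assume w: "w \<in> supported B (sol X)"
    show "cotwist w \<in> solF (twist ` supported B X)"
      unfolding solF_def
    proof (intro CollectI conjI allI impI cotwist_full)
      fix u :: "'h \<Rightarrow> 'k" assume u: "lin sH (*) u"
      let ?w = "\<lambda>r t z. D (*) t (\<lambda>a c. u c * e r (z * S a))"
      let ?v = "\<lambda>r. \<Sum>t\<in>B. \<sigma> (?w r t) (w t)"
      have "lin sH (*) (?w r t)" for r t by (intro lin_intros)
      then have "\<sigma> (?w r t) (w t) \<in> X" for r t using w by (auto simp: supported_def sol_def)
      then have "?v r \<in> X" for r by (intro V.subspace_sum[OF XD(1)])
      moreover have "?v r = 0" if "r \<notin> B" for r
        by (simp add: e_outside[OF that] sw_zero[OF vs_field] sw_zero[OF vs_H] \<sigma>_def L_def lin_zero[OF lin_antipode])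
      ultimately have "?v \<in> supported B X" by (simp add: supported_def)
      then show "(\<lambda>t. \<sigma> u (cotwist w t)) \<in> twist ` supported B X" unfolding sigma_cotwist[OF u] by blast
    qed
  next
    show "\<And>x. x \<in> solF (twist ` supported B X) \<Longrightarrow> x \<in> full" by (simp add: solF_def)
  qed
  finally show ?thesis .
qed

text \<open>The preimage in H of the trivial subcomodule of H/I spanned by
  \<open>\<pi>(1)\<close>.\<close>

definition unit_space :: "'h set" where
  "unit_space = {sH c 1 + i | c i. i \<in> I}"

lemma unit_space_subspace: "V.subspace unit_space"
proof -
  have "V.subspace {x + y | x y. x \<in> V.span {1} \<and> y \<in> I}"
    by (rule V.subspace_sums[OF V.subspace_span subI])
  moreover have "{x + y | x y. x \<in> V.span {1} \<and> y \<in> I} = unit_space"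
    unfolding unit_space_def V.span_singleton by auto
  ultimately show ?thesis by simp
qed

lemma unit_space_mem: "x \<in> unit_space \<longleftrightarrow> x - sH (\<epsilon> x) 1 \<in> I"
proof
  assume "x \<in> unit_space"
  then obtain c i where x: "x = sH c 1 + i" "i \<in> I" by (auto simp: unit_space_def)
  then have "\<epsilon> x = c" by (simp add: lin_add[OF lin_counit] lin_scale[OF lin_counit] counit_one counit_I)
  then show "x - sH (\<epsilon> x) 1 \<in> I" using x by simp
next
  assume "x - sH (\<epsilon> x) 1 \<in> I"
  then show "x \<in> unit_space" unfolding unit_space_def by (intro CollectI exI[of _ "\<epsilon> x"] exI[of _ "x - sH (\<epsilon> x) 1"]) simp
qed

lemma stable_unit_space: "stable unit_space"
  unfolding stable_def
proof (intro conjI allI impI unit_space_subspace)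
  show "I \<subseteq> unit_space" by (auto simp: unit_space_mem counit_I)
  fix d x assume d: "dual d" and "x \<in> unit_space"
  then obtain c i where x: "x = sH c 1 + i" "i \<in> I" by (auto simp: unit_space_def)
  have ld: "lin sH (*) d" using d by (simp add: dual_def)
  have "R d x = sH (c * d 1) 1 + R d i"
    by (simp add: x(1) lin_add[OF self.lin_slice[OF ld]] lin_scale[OF self.lin_slice[OF ld]] R_one[OF ld])
  then show "R d x \<in> unit_space" using R_mem_I[OF x(2) d] unfolding unit_space_def by blast
qed

lemma one_notin_I: "1 \<notin> I"
  using counit_I[of 1] counit_one by auto

lemma unit_space_neq: "unit_space \<noteq> I"
proof -
  have "1 \<in> unit_space" using V.subspace_0[OF subI] by (simp add: unit_space_mem counit_one)
  then show ?thesis using one_notin_I by blast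
qed

lemma dim_unit_space: "rk unit_space = 1"
proof -
  have "V.dim unit_space = V.dim {x \<in> unit_space. \<epsilon> x = 0} + vector_space.dim (*) (\<epsilon> ` unit_space)"
    by (rule rank_nullity[OF vs_H vs_field lin_counit unit_space_subspace V.finite_Basis fin_H])
  moreover have "{x \<in> unit_space. \<epsilon> x = 0} = I" by (auto simp: unit_space_mem counit_I)
  moreover have "\<epsilon> ` unit_space = UNIV"
  proof -
    have "c = \<epsilon> (sH c 1 + 0)" for c by (simp add: lin_scale[OF lin_counit] counit_one)
    moreover have "sH c 1 + 0 \<in> unit_space" for c using V.subspace_0[OF subI] unfolding unit_space_def by blast
    ultimately show ?thesis by blast
  qed
  moreover have "vector_space.dim (*) (UNIV :: 'k set) = 1"
  proof -
    interpret k: vector_space "(*) :: 'k \<Rightarrow> 'k \<Rightarrow> 'k" by (rule vs_field)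
    have "(UNIV :: 'k set) \<subseteq> k.span {1}" unfolding k.span_singleton by auto
    from k.basis_card_eq_dim[OF _ this] show ?thesis by (simp add: k.dependent_single)
  qed
  ultimately show ?thesis by (simp add: rk_def)
qed

lemma stable_UNIV: "stable UNIV"
  by (simp add: stable_def)

lemma sol_UNIV: "sol UNIV = UNIV"
  by (simp add: sol_def)

text \<open>\<epsilon> vanishes on I while \<open>\<epsilon> (\<sigma> u y) = u y\<close>; so the
  zero comodule has no nonzero solution.\<close>

lemma sigma_I_zero: assumes "\<And>u. lin sH (*) u \<Longrightarrow> \<sigma> u y \<in> I" shows "y = 0"
proof (rule functional_ext[OF vs_H])
  fix u :: "'h \<Rightarrow> 'k" assume u: "lin sH (*) u"
  show "u y = u 0" using counit_I[OF assms[OF u]] counit_sigma[OF u] lin_zero[OF u] by simp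
qed

lemma solF_supported_I: "F.dim (solF (supported B I)) = 0"
proof -
  have "y = 0" if "y \<in> solF (supported B I)" for y
  proof
    fix t show "y t = 0 t"
      using that sigma_I_zero[of "y t"] by (auto simp: solF_def supported_def)
  qed
  then have "solF (supported B I) \<subseteq> F.span {}" by auto
  then show ?thesis using F.dim_le_card[of _ "{}"] by force
qed

lemma stableF_supported_I: "stableF (supported B I)"
  unfolding stableF_def
proof (intro conjI allI impI supported_subspace[OF vs_H subI] subset_refl supported_mono subset_UNIV)
  fix d v assume d: "dual d" and v: "v \<in> supported B I"
  have "R d 0 = 0" using d by (intro lin_zero[OF self.lin_slice]) (simp add: dual_def)
  then show "(\<lambda>t. R d (v t)) \<in> supported B I" using v R_mem_I[OF _ d] by (auto simp: supported_def)
qed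

text \<open>A nonzero \<open>y\<close> with all \<open>\<sigma> u y\<close> in \<open>X\<close> yields the trivial submodule \<open>k (1 \<otimes> y)\<close> of \<open>X \<otimes> H\<close>.\<close>

lemma trivial_submodule:
  assumes X: "stable X" and y: "y \<in> sol X" "y \<noteq> 0"
  obtains N where "stableF N" "N \<subseteq> twist ` supported B X" "F.dim N \<ge> F.dim (supported B I) + 1"
    "F.dim (solF N) \<le> V.dim (sol unit_space)"
proof -
  note XD = stable_D[OF X] and MD = stableF_D[OF stableF_twist[OF X]]
  define w where "w = (\<lambda>s. sH (e s y) 1)"
  have w_full: "w \<in> full" by (simp add: supported_def w_def e_outside)
  have w_M: "w \<in> twist ` supported B X"
  proof -
    have "(\<lambda>t. if t \<in> B then \<sigma> (e t) y else 0) \<in> supported B X"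
      using y(1) lin_e V.subspace_0[OF XD(1)] by (auto simp: supported_def sol_def)
    then show ?thesis unfolding w_def twist_sigma[symmetric] by blast
  qed
  \<comment> \<open>A coordinate at which y is nonzero; evaluation there embeds
    \<open>solF N\<close> into H.\<close>
  obtain s0 where s0: "s0 \<in> B" "e s0 y \<noteq> 0"
    using y(2) sum_coords[of y] by (metis (no_types, lifting) V.scale_zero_left sum.neutral)
  define N where "N = {fscl sH c w + v | c v. v \<in> supported B I}"
  have subsI: "F.subspace (supported B I)" by (rule supported_subspace[OF vs_H subI])
  have subN: "F.subspace N"
  proof -
    have "F.subspace {x + y | x y. x \<in> F.span {w} \<and> y \<in> supported B I}"
      by (rule F.subspace_sums[OF F.subspace_span subsI])
    moreover have "{x + y | x y. x \<in> F.span {w} \<and> y \<in> supported B I} = N"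
      unfolding N_def F.span_singleton by auto
    ultimately show ?thesis by simp
  qed
  have IN: "supported B I \<subseteq> N"
  proof
    fix v assume "v \<in> supported B I"
    moreover have "v = fscl sH 0 w + v" by simp
    ultimately show "v \<in> N" unfolding N_def by blast
  qed
  have NM: "N \<subseteq> twist ` supported B X"
    using w_M MD(2) F.subspace_scale[OF MD(1)] F.subspace_add[OF MD(1)] by (auto simp: N_def)
  have stN: "stableF N"
    unfolding stableF_def
  proof (intro conjI allI impI subN IN)
    show "N \<subseteq> full" using NM MD(3) by blast
    fix d v assume d: "dual d" and "v \<in> N"
    then obtain c x where v: "v = fscl sH c w + x" and x: "x \<in> supported B I" by (auto simp: N_def)
    have ld: "lin sH (*) d" using d by (simp add: dual_def)
    have "(\<lambda>t. R d (v t)) = fscl sH (c * d 1) w + (\<lambda>t. R d (x t))"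
      by (rule ext) (simp add: v w_def fscl_def lin_add[OF self.lin_slice[OF ld]] lin_scale[OF self.lin_slice[OF ld]] R_one[OF ld] mult.assoc mult.commute mult.left_commute)
    then show "(\<lambda>t. R d (v t)) \<in> N"
      using stableF_D(4)[OF stableF_supported_I d x] unfolding N_def by blast
  qed
  have wN: "w \<in> N"
  proof -
    have "w = fscl sH 1 w + 0" by simp
    then show ?thesis unfolding N_def using F.subspace_0[OF subsI] by blast
  qed
  have "w \<notin> supported B I"
  proof
    assume "w \<in> supported B I"
    then have "\<epsilon> (w s0) = 0" using counit_I by (auto simp: supported_def)
    then show False using s0(2) by (simp add: w_def lin_scale[OF lin_counit] counit_one)
  qed
  then have "\<not> F.dim N \<le> F.dim (supported B I)"
    using F.dim_eq_span_subset[OF finite_full_gens fin_F IN subsI] stableF_D(3)[OF stN] wN by blast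
  then have dN: "F.dim N \<ge> F.dim (supported B I) + 1" by simp
  \<comment> \<open>Modulo I the slices of a solution lie on the line through w. Applying \<epsilon>
    shows that \<open>u (z s)\<close> is proportional to the coordinates of y, with a factor
    depending only on z and u.\<close>
  have key: "\<exists>c. (\<lambda>s. u (z s)) = (\<lambda>s. c * e s y) \<and> (\<forall>s. \<sigma> u (z s) - sH (c * e s y) 1 \<in> I)"
    if z: "z \<in> solF N" and u: "lin sH (*) u" for z u
  proof -
    have "(\<lambda>t. \<sigma> u (z t)) \<in> N" using z u by (simp add: solF_def)
    then obtain c v where cv: "(\<lambda>t. \<sigma> u (z t)) = fscl sH c w + v" and v: "v \<in> supported B I" by (auto simp: N_def)
    have s: "\<sigma> u (z t) = sH (c * e t y) 1 + v t" for t
      using fun_cong[OF cv, of t] by (simp add: fscl_def w_def)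
    have vt: "v t \<in> I" for t using v by (simp add: supported_def)
    have "u (z t) = c * e t y" for t
      using arg_cong[OF s, of \<epsilon> t] counit_I[OF vt, of t]
      by (simp add: counit_sigma[OF u] lin_add[OF lin_counit] lin_scale[OF lin_counit] counit_one)
    then show ?thesis using s vt by (intro exI[of _ c]) simp
  qed
  have img: "(\<lambda>z. z s0) ` solF N \<subseteq> sol unit_space"
  proof safe
    fix z assume z: "z \<in> solF N"
    show "z s0 \<in> sol unit_space" unfolding sol_def
    proof safe
      fix u :: "'h \<Rightarrow> 'k" assume u: "lin sH (*) u"
      from key[OF z u] obtain c where c: "\<sigma> u (z s0) - sH (c * e s0 y) 1 \<in> I" by blast
      have "\<sigma> u (z s0) = sH (c * e s0 y) 1 + (\<sigma> u (z s0) - sH (c * e s0 y) 1)" by simp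
      with c show "\<sigma> u (z s0) \<in> unit_space" unfolding unit_space_def by blast
    qed
  qed
  have "F.dim (solF N) = V.dim ((\<lambda>z. z s0) ` solF N)"
  proof (rule dim_image_inj[OF vs_F vs_H lin_eval solF_subspace[OF subN] finite_full_gens fin_F, symmetric])
    show "solF N \<subseteq> full" by (auto simp: solF_def)
    fix z assume z: "z \<in> solF N" and z0: "z s0 = 0"
    show "z = 0"
    proof
      fix s
      show "z s = 0 s"
      proof (rule functional_ext[OF vs_H])
        fix u :: "'h \<Rightarrow> 'k" assume u: "lin sH (*) u"
        from key[OF z u] obtain c where c: "\<And>s. u (z s) = c * e s y" by metis
        have "c = 0" using c[of s0] z0 s0(2) lin_zero[OF u] by simp
        then show "u (z s) = u (0 s)" using c[of s] lin_zero[OF u] by simp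
      qed
    qed
  qed
  also have "\<dots> \<le> V.dim (sol unit_space)" by (rule V_dim_mono[OF img])
  finally show ?thesis using that stN NM dN by blast
qed

text \<open>For \<open>X\<close> maximising \<open>\<rho> = dim (sol X) / rk X\<close>, the tensor product \<open>X \<otimes> H\<close> has the same ratio and
  contains a trivial submodule, so the trivial module also has ratio \<open>\<rho>\<close>. Then so has \<open>H\<close>, which maps
  onto \<open>H / I\<close>, and \<open>H / I\<close> itself has \<open>dim (sol UNIV) = dim H\<close>.\<close>

lemma dim_sol_unit_space:
  "real (V.dim (sol unit_space)) * rk UNIV = real (card B)"
proof -
  let ?r = "\<lambda>X. real (V.dim (sol X)) / rk X"
  let ?S = "{X. stable X \<and> X \<noteq> I}"
  let ?n = "card B" and ?h = "real (V.dim (sol unit_space))"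
  have dimU: "V.dim (UNIV :: 'h set) = card B" by (rule V.dim_UNIV)
  have le: "V.dim Y \<le> card B" for Y using V.dim_subset[OF subset_UNIV, of Y] dimU by simp
  \<comment> \<open>All dimensions are at most dim H, so only finitely many ratios occur and a
    maximum exists.\<close>
  have "?r ` ?S \<subseteq> (\<lambda>(a, b). real a / real b) ` ({..card B} \<times> {..card B})"
  proof (intro subsetI, elim imageE CollectE conjE, hypsubst)
    fix X assume X: "stable X" "X \<noteq> I"
    have "rk X = real (V.dim X - V.dim I)" using rk_pos[OF X] by (simp add: rk_def)
    then show "?r X \<in> (\<lambda>(a, b). real a / real b) ` ({..card B} \<times> {..card B})"
      using le[of X] le[of "sol X"] by (intro image_eqI[where x = "(V.dim (sol X), V.dim X - V.dim I)"]) auto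
  qed
  then have finS: "finite (?r ` ?S)" by (rule finite_subset) simp
  have Uin: "UNIV \<in> ?S" using stable_UNIV one_notin_I by auto
  then have neS: "?r ` ?S \<noteq> {}" by blast
  define \<rho> where "\<rho> = Max (?r ` ?S)"
  have "\<rho> \<in> ?r ` ?S" unfolding \<rho>_def by (rule Max_in[OF finS neS])
  then obtain X where X: "stable X" "X \<noteq> I" and \<rho>X: "\<rho> = ?r X" by blast
  have rho: "real (V.dim (sol Y)) \<le> \<rho> * rk Y" if "stable Y" "Y \<noteq> I" for Y
  proof -
    have "?r Y \<le> \<rho>" unfolding \<rho>_def by (rule Max_ge[OF finS]) (use that in blast)
    then show ?thesis using rk_pos[OF that] by (simp add: field_simps)
  qed
  have Npos: "?n > 0"
  proof -
    have "V.dim I < V.dim (UNIV :: 'h set)" using rk_pos[of UNIV] Uin by (simp add: rk_def)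
    then show ?thesis using dimU by simp
  qed
  have hU: "real ?n \<le> \<rho> * rk UNIV" using rho[of UNIV] Uin dimU sol_UNIV by simp
  have rkU: "rk UNIV > 0" using rk_pos[of UNIV] Uin by simp
  have \<rho>pos: "\<rho> > 0"
  proof (rule ccontr)
    assume "\<not> \<rho> > 0"
    then have "\<rho> * rk UNIV \<le> 0" using rkU by (simp add: mult_nonpos_nonneg)
    then show False using hU Npos by simp
  qed
  have XeqR: "real (V.dim (sol X)) = \<rho> * rk X" using \<rho>X rk_pos[OF X] by simp
  have "sol X \<noteq> {0}"
  proof
    assume "sol X = {0}"
    then have 0: "V.dim (sol X) = 0" by simp
    show False using XeqR[unfolded 0] \<rho>pos rk_pos[OF X] by simp
  qed
  moreover have "0 \<in> sol X" using V.subspace_0[OF sol_subspace[OF stable_D(1)[OF X(1)]]] .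
  ultimately obtain y where y: "y \<in> sol X" "y \<noteq> 0" by blast
  obtain N where N: "stableF N" "N \<subseteq> twist ` supported B X" "F.dim N \<ge> F.dim (supported B I) + 1"
    "F.dim (solF N) \<le> V.dim (sol unit_space)"
    by (rule trivial_submodule[OF X(1) y])
  have dI: "F.dim (supported B I) = ?n * V.dim I" by (rule dim_supp[OF subI])
  \<comment> \<open>X attains \<rho> and passes it to its twist. Comparing with N, of rank at least
    one, leaves \<rho> bounded by the dimension of \<open>sol unit_space\<close>.\<close>
  have "real ?n * (\<rho> * rk X) \<le> real (F.dim (solF (twist ` supported B X)))"
    using dim_solF_twist[OF X(1)] XeqR[symmetric] by (simp flip: of_nat_mult)
  also have "\<dots> \<le> real (F.dim (solF N)) + \<rho> * (real (F.dim (twist ` supported B X)) - real (F.dim N))"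
    by (rule dim_solF_bound[OF rho N(1) stableF_twist[OF X(1)] N(2)])
  also have "\<dots> \<le> ?h + \<rho> * (real ?n * real (V.dim X) - (real ?n * real (V.dim I) + 1))"
  proof (intro add_mono mult_left_mono)
    show "real (F.dim (solF N)) \<le> ?h" using N(4) by simp
    have "real (F.dim N) \<ge> real ?n * real (V.dim I) + 1" using N(3) dI by (simp flip: of_nat_mult)
    then show "real (F.dim (twist ` supported B X)) - real (F.dim N) \<le> real ?n * real (V.dim X) - (real ?n * real (V.dim I) + 1)"
      by (simp add: dim_twist[OF X(1)])
  qed (use \<rho>pos in simp)
  also have "\<dots> = ?h + real ?n * (\<rho> * rk X) - \<rho>" by (simp add: rk_def algebra_simps)
  finally have "\<rho> \<le> ?h" by simp
  moreover have "?h \<le> \<rho>" using rho[OF stable_unit_space unit_space_neq] dim_unit_space by simp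
  ultimately have \<rho>h: "\<rho> = ?h" by simp
  let ?M = "twist ` supported B unit_space"
  \<comment> \<open>With this choice \<open>phiF f\<close> is
    \<open>id \<otimes> \<epsilon>\<close>, which sends the twist \<open>r_1 \<otimes> r_2\<close>
    of \<open>1 \<otimes> r\<close> to r. So it maps the twisted copy of
    \<open>k \<otimes> H\<close> onto H/I.\<close>
  define f where "f v = (\<Sum>t\<in>B. \<epsilon> t * \<epsilon> (v t))" for v :: "'h \<Rightarrow> 'h"
  have f: "lin sF (*) f" unfolding f_def[abs_def]
    by (intro lin_sumI vs_field lin_mult_right_field lin_comp[OF lin_counit lin_eval])
  have f0: "f v = 0" if "v \<in> supported B I" for v
    using that counit_I by (auto simp: f_def supported_def intro!: sum.neutral)
  define M' where "M' = {v \<in> ?M. phiF f v \<in> I}"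
  define Y where "Y = {phiF f v + i | v i. v \<in> ?M \<and> i \<in> I}"
  note step = exact_step[OF stableF_twist[OF stable_unit_space] f f0, folded M'_def Y_def]
  have "UNIV \<subseteq> Y"
  proof -
    have "r \<in> Y" if r: "r \<in> B" for r
    proof -
      have u1: "1 \<in> unit_space" using V.subspace_0[OF subI] by (simp add: unit_space_mem counit_one)
      have mem: "fsingle r 1 \<in> supported B unit_space"
        using r u1 V.subspace_0[OF unit_space_subspace] by (auto simp: supported_def fsingle_def)
      have ths: "twist (fsingle r 1) s = L (e s) r" for s
      proof -
        have "twist (fsingle r 1) s = (\<Sum>t\<in>B. if t = r then L (e s) r else 0)"
          unfolding twist_def by (rule sum.cong) (auto simp: fsingle_def)
        then show ?thesis using r V.finite_Basis by simp
      qed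
      have ftf: "ft f t = (\<lambda>h. \<epsilon> t * \<epsilon> h)" if "t \<in> B" for t
      proof
        fix h
        have "ft f t h = (\<Sum>s\<in>B. if s = t then \<epsilon> t * \<epsilon> h else 0)"
          unfolding ft_def f_def by (rule sum.cong) (auto simp: fsingle_def lin_zero[OF lin_counit])
        then show "ft f t h = \<epsilon> t * \<epsilon> h" using that V.finite_Basis by simp
      qed
      have Leps: "L (\<lambda>h. c * \<epsilon> h) z = sH c z" for c z
      proof -
        have "L (\<lambda>h. c * \<epsilon> h) z = D sH z (\<lambda>b h. sH c (sH (\<epsilon> h) b))" by (simp add: L_def)
        also have "\<dots> = sH c (D sH z (\<lambda>b h. sH (\<epsilon> h) b))"
          by (rule lin_sw[OF lin_scale_right[OF vs_H lin_id], symmetric])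
        also have "\<dots> = sH c z" unfolding D_counit_right[OF lin_id] ..
        finally show ?thesis .
      qed
      have "phiF f (twist (fsingle r 1)) = (\<Sum>s\<in>B. sH (\<epsilon> s) (L (e s) r))"
        unfolding phiF_def ths by (rule sum.cong) (simp_all add: ftf Leps)
      also have "\<dots> = D sH r (\<lambda>x z. sH (\<epsilon> z) x)"
        by (rule sum_L_coords) (rule bilI; intro lin_intros)
      also have "\<dots> = r" by (rule D_counit_right[OF lin_id])
      finally have "r = phiF f (twist (fsingle r 1)) + 0" by simp
      then show ?thesis unfolding Y_def using mem V.subspace_0[OF subI] by blast
    qed
    then have "V.span B \<subseteq> Y" by (intro V.span_minimal) (use stable_D(1)[OF step(2)] in blast)+
    then show ?thesis by (simp add: V.span_Basis)
  qed
  then have Y: "Y = UNIV" by blast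
  have M'I: "supported B I \<subseteq> M'" by (rule stableF_D(2)[OF step(1)])
  \<comment> \<open>The kernel M' is bounded by \<rho> times its rank, as the zero comodule
    contributes nothing. What remains of the solutions embeds into \<open>sol UNIV\<close>, of
    dimension dim H; this yields the missing inequality for \<open>\<rho> * rk UNIV\<close>.\<close>
  have "real (F.dim (solF M')) \<le> 0 + \<rho> * (real (F.dim M') - real ?n * real (V.dim I))"
    using dim_solF_bound[OF rho stableF_supported_I step(1) M'I] dI by (simp add: solF_supported_I)
  moreover have "real ?n * \<rho> \<le> real (F.dim (solF ?M))"
    using dim_solF_twist[OF stable_unit_space] unfolding \<rho>h by (simp flip: of_nat_mult)
  moreover have "real (F.dim (solF ?M)) \<le> real (F.dim (solF M')) + real ?n"
    using step(4) unfolding Y sol_UNIV dimU by simp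
  moreover have "real (F.dim M') = real ?n * (real (V.dim I) + 1) - rk UNIV"
  proof -
    have "real (F.dim ?M) + real (V.dim I) = real (F.dim M') + real (V.dim (UNIV :: 'h set))"
      using step(3) unfolding Y by linarith
    moreover have "real (V.dim unit_space) = real (V.dim I) + 1" using dim_unit_space by (simp add: rk_def)
    ultimately show ?thesis by (simp add: dim_twist[OF stable_unit_space] rk_def)
  qed
  ultimately have "real ?n * \<rho> \<le> \<rho> * (real ?n - rk UNIV) + real ?n" by (simp add: algebra_simps)
  then have "\<rho> * rk UNIV \<le> real ?n" by (simp add: algebra_simps)
  with hU \<rho>h show ?thesis by simp
qed

lemma sol_unit_space_eq: "sol unit_space = {y. \<forall>u. lin sH (*) u \<longrightarrow> \<sigma> u y - sH (u y) 1 \<in> I}"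
  by (auto simp: sol_def unit_space_mem counit_sigma)

text \<open>By coassociativity, slicing twice equals slicing once with the functional
  \<open>uw\<close>.\<close>

lemma L_mem_sol_unit_space:
  assumes y: "y \<in> sol unit_space" and u: "lin sH (*) u" shows "L u y \<in> sol unit_space"
  unfolding sol_def
proof safe
  fix w :: "'h \<Rightarrow> 'k" assume w: "lin sH (*) w"
  note [lin_intros] = lin_comp[OF w] lin_comp[OF u] w u
  define uw where "uw z = D (*) z (\<lambda>p q. w p * u q)" for z
  have l: "lin sH (*) uw" unfolding uw_def by (intro lin_intros)
  have "L w (L u y) = D sH y (\<lambda>b h. D sH b (\<lambda>x z. sH (u h) (sH (w z) x)))"
    unfolding L_def[of u] lin_sw[OF lin_L[OF w]] lin_scale[OF lin_L[OF w]]
    unfolding L_def lin_sw[OF lin_scale_right[OF vs_H lin_id]] ..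
  also have "\<dots> = D sH y (\<lambda>x q. D sH q (\<lambda>z h. sH (u h) (sH (w z) x)))"
    by (simp add: D_coassoc lin_intros del: V.scale_scale)
  also have "\<dots> = D sH y (\<lambda>x q. D sH q (\<lambda>z h. sH (w z * u h) x))"
    by (simp add: mult.commute)
  also have "\<dots> = L uw y"
    unfolding L_def uw_def lin_sw[of "(*)" sH "\<lambda>c. sH c z" for z, OF lin_scale_left[OF vs_H lin_id]] ..
  finally have "\<sigma> w (L u y) = \<sigma> uw y" by (simp add: \<sigma>_def)
  then show "\<sigma> w (L u y) \<in> unit_space" using y l by (simp add: sol_def)
qed

text \<open>Since \<Delta>(S y) is \<open>S(y_2) \<otimes> S(y_1)\<close>, its slice by f is
  \<open>\<sigma>\<close> of y for the functional \<open>f \<circ> S\<close>.\<close>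

lemma antipode_sol_unit_space:
  assumes y: "y \<in> sol unit_space" shows "S y \<in> self.coinv I"
  unfolding self.coinv_def
proof safe
  fix f :: "'h \<Rightarrow> 'k" assume f: "lin sH (*) f"
  have l: "lin sH (*) (\<lambda>x. f (S x))" by (rule lin_comp[OF f lin_antipode])
  have "R f (S y) = D sH y (\<lambda>x z. sH (f (S z)) (S x))"
    unfolding R_eq by (rule D_antipode) (simp_all add: lin_intros vs_H f)
  also have "\<dots> = \<sigma> (\<lambda>x. f (S x)) y"
    unfolding \<sigma>_def L_def lin_sw[OF lin_antipode] lin_scale[OF lin_antipode] ..
  finally show "R f (S y) - sH (f (S y)) 1 \<in> I"
    using y[unfolded sol_unit_space_eq] l by simp blast
qed

text \<open>Both ideals have the same \<open>sol unit_space\<close>, hence the same codimension.\<close>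

lemma ideal_eq_aug_ideal: "self.aug_ideal (self.coinv I) = I"
proof -
  let ?J = "self.aug_ideal (self.coinv I)"
  interpret q: fin_quot H B ?J
    by unfold_locales (rule self.coideal_aug_ideal self.right_ideal_aug_ideal)+
  have sub: "?J \<subseteq> I" using self.aug_ideal_subset_iff[OF right_ideal] by blast
  have "sol unit_space = q.sol q.unit_space"
  proof (intro equalityI subsetI)
    fix y assume y: "y \<in> q.sol q.unit_space"
    then show "y \<in> sol unit_space" using sub unfolding sol_unit_space_eq q.sol_unit_space_eq by blast
  next
    fix y assume y: "y \<in> sol unit_space"
    show "y \<in> q.sol q.unit_space" unfolding q.sol_unit_space_eq
    proof safe
      fix u :: "'h \<Rightarrow> 'k"
      assume u: "lin (hscale H) (*) u"
      let ?k = "\<sigma> u y"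
      have k: "?k \<in> self.coinv I"
        unfolding \<sigma>_def by (rule antipode_sol_unit_space[OF L_mem_sol_unit_space[OF y u]])
      \<comment> \<open>Slicing by \<epsilon> returns the element itself, so \<open>?k\<close> minus
        its counit is one of the generators of \<open>?J\<close>.\<close>
      have "R \<epsilon> ?k = ?k" unfolding R_eq by (rule D_counit_left[OF lin_id])
      then have "?k - hscale H (counit H ?k) 1 \<in> self.aug (self.coinv I)"
        unfolding self.aug_def using lin_counit k by (intro CollectI exI[of _ \<epsilon>] exI[of _ ?k]) simp
      then have "(?k - hscale H (counit H ?k) 1) * 1 \<in> ?J"
        unfolding self.aug_ideal_def by (blast intro: V.span_base)
      then show "\<sigma> u y - hscale H (u y) 1 \<in> ?J" by (simp add: counit_sigma[OF u])
    qed
  qed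
  then have "real (V.dim (sol unit_space)) * q.rk UNIV = real (V.dim (sol unit_space)) * rk UNIV"
    using dim_sol_unit_space q.dim_sol_unit_space by simp
  moreover have "V.dim (sol unit_space) \<noteq> 0"
  proof
    assume 0: "V.dim (sol unit_space) = 0"
    have "card B = 0" using dim_sol_unit_space unfolding 0 by simp
    moreover have "V.dim (UNIV :: 'h set) = card B" by (rule V.dim_UNIV)
    moreover have "V.dim I < V.dim (UNIV :: 'h set)"
      using rk_pos[OF stable_UNIV] one_notin_I by (auto simp: rk_def)
    ultimately show False by simp
  qed
  ultimately have "V.dim I = V.dim ?J" by (simp add: rk_def q.rk_def)
  then show ?thesis using V.dim_eq_span_subset[OF V.finite_Basis fin_H sub q.subI] by simp
qed

end

section \<open>Closed elements and Galois extensions\<close>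

theorem theorem7p4:
  fixes H :: "('k::field, 'h::{ring, monoid_mult}) hopf"
    and A :: "('k, 'h, 'a::{ring, monoid_mult}) comod_alg"
    and B :: "'a set"
  assumes "hopf_algebra H"
    and "cleft_extension H A B"
    and "(UNIV :: 'a set) \<noteq> {0}"
  shows "galois_connection (quot_sub_connection H A) \<and>
    (\<forall>Q \<in> quot_gen H. psi H A (phi A Q) = Q \<longleftrightarrow> is_Galois A Q) \<and>
    ((\<exists>Basis. finite_dimensional_vector_space (hscale H) Basis) \<longrightarrow>
       bij_betw (phi A) (quot_gen H) (sub_Hext H A) \<and>
       bij_betw (psi H A) (sub_Hext H A) (quot_gen H) \<and>
       (\<forall>Q \<in> quot_gen H. psi H A (phi A Q) = Q) \<and>
       (\<forall>C \<in> sub_Hext H A. phi A (psi H A C) = C))"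
proof -
  interpret comod H A
    using assms by unfold_locales (simp_all add: cleft_extension_def extension_def)
  obtain \<gamma> \<gamma>' where g: "comodule_map H A \<gamma>" "Vector_Spaces.linear sH sA \<gamma>'"
      "\<forall>h. convolution H sA \<gamma> \<gamma>' h = sA (\<epsilon> h) 1" "\<forall>h. convolution H sA \<gamma>' \<gamma> h = sA (\<epsilon> h) 1"
    using assms(2) by (auto simp: cleft_extension_def convolution_invertible_def)
  interpret cleft H A \<gamma> \<gamma>'
    using g by unfold_locales (auto simp: linear_iff_lin)
  have closed: "psi H A (phi A Q) = Q \<longleftrightarrow> is_Galois A Q" if "Q \<in> quot_gen H" for Q
    using that by (elim quot_gen_cases) (simp add: closed_iff Galois_iff(1)[OF assms(3)])
  have fin: "psi H A (phi A Q) = Q"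
    if B: "finite_dimensional_vector_space sH Basis" and "Q \<in> quot_gen H" for Basis Q
    using that(2)
  proof (elim quot_gen_cases)
    fix I assume I: "Q = quotient_by H I" "coideal H I" "right_ideal H I"
    interpret q: fin_quot H Basis I
      by (intro fin_quot.intro fin_hopf.intro hopf_axioms fin_hopf_axioms.intro fin_quot_axioms.intro B I)
    \<comment> \<open>Finite dimension enters through this inclusion; closedness then follows from
      cleftness.\<close>
    have "I \<subseteq> coinv_ideal I" using self.aug_ideal_coinv_subset q.ideal_eq_aug_ideal by blast
    then show "psi H A (phi A Q) = Q"
      unfolding I(1) closed_iff[OF I(2,3)] by (rule Galois_iff(2)[OF assms(3) I(3)])
  qed
  have sub: "sub_Hext H A = phi A ` quot_gen H" by (auto simp: sub_Hext_def)
  show ?thesis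
  proof (intro conjI impI ballI galois_connection_quot_sub closed)
    assume "\<exists>Basis. finite_dimensional_vector_space sH Basis"
    then have f: "psi H A (phi A Q) = Q" if "Q \<in> quot_gen H" for Q using fin that by blast
    show "psi H A (phi A Q) = Q" if "Q \<in> quot_gen H" for Q by (rule f[OF that])
    show "phi A (psi H A C) = C" if "C \<in> sub_Hext H A" for C using that f by (auto simp: sub)
    show "bij_betw (phi A) (quot_gen H) (sub_Hext H A)"
      by (rule bij_betw_byWitness[where f' = "psi H A"]) (auto simp: sub f)
    show "bij_betw (psi H A) (sub_Hext H A) (quot_gen H)"
      by (rule bij_betw_byWitness[where f' = "phi A"]) (auto simp: sub f)
  qed
qed

end
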